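(* Let $q>0$ be a constant with $q\neq 1$. Let $\Omega\subset\mathbb{R}^2$ be an ellipse (i.e. the open region bounded by an ellipse) centered at the origin, whose eccentricity $e$ satisfies $$0<e^2<\frac{\sqrt{q}}{1+\sqrt{q}}.$$ Let $\phi$ be a $C^1$ function on $\mathbb{S}^1$ which is not identically zero. Then there are at most finitely many wave numbers $k>0$ such that $\Omega$ is non-scattering in the presence of the incident wave $v=\mathbf{H}[k,\phi]$.
   Context: We identify $\mathbb{S}^1$ with $[0,2\pi)$ (and with $\mathbb{R}/(2\pi\mathbb{Z})$) via $\theta\mapsto(\cos\theta,\sin\theta)^T$; for $\xi\in\mathbb{S}^1$, $\theta_\xi$ denotes its angular coordinate. For $k>0$ and $\phi\in L^2(\mathbb{S}^1)$ the Herglotz wave is $\mathbf{H}[k,\phi](x)=\int_{-\pi}^{\pi}\phi(\xi)e^{\mathrm{i}k\xi\cdot x}\,d\theta_\xi$, $x\in\mathbb{R}^2$. For a bounded domain $\Omega$ with index of refraction the constant $q$, $\Omega$ is called non-scattering in the presence of the incident wave $\mathbf{H}[k,\phi]$ (at wave number $k$) if there exists $u\in H^1(\Omega)$ with $\Delta u+k^2qu=0$ in $\Omega$ and $u=\mathbf{H}[k,\phi]$, $\partial_\nu u=\partial_\nu\mathbf{H}[k,\phi]$ on $\partial\Omega$ ($\nu$ the outward unit normal). The eccentricity of an ellipse with semi-major axis $a$ and semi-minor axis $b$ is $\sqrt{1-b^2/a^2}$. *)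

theory Defs
  imports "HOL-Analysis.Analysis"
begin

definition pd :: "2 \<Rightarrow> (real^2 \<Rightarrow> 'b::real_normed_vector) \<Rightarrow> real^2 \<Rightarrow> 'b" where
  "pd i f x = frechet_derivative f (at x) (axis i 1)"

fun iter_pd :: "2 list \<Rightarrow> (real^2 \<Rightarrow> 'b::real_normed_vector) \<Rightarrow> real^2 \<Rightarrow> 'b" where
  "iter_pd [] f = f"
| "iter_pd (i # is) f = pd i (iter_pd is f)"

definition smooth :: "(real^2 \<Rightarrow> 'b::real_normed_vector) \<Rightarrow> bool" where
  "smooth f \<longleftrightarrow> (\<forall>is. iter_pd is f differentiable_on UNIV)"

definition test_fun :: "(real^2) set \<Rightarrow> (real^2 \<Rightarrow> 'b::real_normed_vector) \<Rightarrow> bool" where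
  "test_fun S f \<longleftrightarrow> smooth f \<and> compact (closure {x. f x \<noteq> 0}) \<and> closure {x. f x \<noteq> 0} \<subseteq> S"

definition L2 :: "(real^2) set \<Rightarrow> (real^2 \<Rightarrow> complex) \<Rightarrow> bool" where
  "L2 \<Omega> f \<longleftrightarrow> f \<in> borel_measurable (lebesgue_on \<Omega>) \<and>
                 integrable (lebesgue_on \<Omega>) (\<lambda>x. (norm (f x))\<^sup>2)"

definition H1 :: "(real^2) set \<Rightarrow> (real^2 \<Rightarrow> complex) \<Rightarrow> (real^2 \<Rightarrow> complex^2) \<Rightarrow> bool" where
  "H1 \<Omega> u g \<longleftrightarrow> L2 \<Omega> u \<and> (\<forall>i. L2 \<Omega> (\<lambda>x. g x $ i)) \<and>
     (\<forall>\<phi>::real^2 \<Rightarrow> real. test_fun \<Omega> \<phi> \<longrightarrow> (\<forall>i.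
        integral\<^sup>L (lebesgue_on \<Omega>) (\<lambda>x. u x * of_real (pd i \<phi> x))
        = - integral\<^sup>L (lebesgue_on \<Omega>) (\<lambda>x. g x $ i * of_real (\<phi> x))))"

definition H10 :: "(real^2) set \<Rightarrow> (real^2 \<Rightarrow> complex) \<Rightarrow> bool" where
  "H10 \<Omega> w \<longleftrightarrow> (\<exists>g. H1 \<Omega> w g \<and>
     (\<exists>\<psi>::nat \<Rightarrow> real^2 \<Rightarrow> complex. (\<forall>n. test_fun \<Omega> (\<psi> n)) \<and>
        (\<lambda>n. integral\<^sup>L (lebesgue_on \<Omega>)
                (\<lambda>x. (norm (w x - \<psi> n x))\<^sup>2 + (\<Sum>i\<in>UNIV. (norm (g x $ i - pd i (\<psi> n) x))\<^sup>2)))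
        \<longlonglongrightarrow> 0))"

text \<open>Herglotz wave; densities on S^1 are 2pi-periodic functions of the angle.\<close>
definition herglotz :: "real \<Rightarrow> (real \<Rightarrow> complex) \<Rightarrow> real^2 \<Rightarrow> complex" where
  "herglotz k \<phi> x = integral {-pi..pi}
      (\<lambda>\<theta>. \<phi> \<theta> * exp (\<i> * of_real (k * (cos \<theta> * x$1 + sin \<theta> * x$2))))"

text \<open>Non-scattering: there is u \<in> H^1(\<Omega>) with \<Delta>u + k^2 q u = 0 in \<Omega> (weakly),
  u = v on the boundary (u - v \<in> H^1_0(\<Omega>)), and \<partial>_\<nu> u = \<partial>_\<nu> v on the boundary,
  the normal derivatives being understood in the weak (Green's formula) sense:
  <\<partial>_\<nu> u, \<phi>> = \<integral>_\<Omega> \<nabla>u\<cdot>\<nabla>\<phi> + \<Delta>u \<phi>  for all \<phi> \<in> C_c^infinity(R^2),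
  where \<Delta>u = -k^2 q u and \<Delta>v = -k^2 v.\<close>
definition non_scattering :: "(real^2) set \<Rightarrow> real \<Rightarrow> real \<Rightarrow> (real^2 \<Rightarrow> complex) \<Rightarrow> bool" where
  "non_scattering \<Omega> q k v \<longleftrightarrow> (\<exists>u gu gv. H1 \<Omega> u gu \<and> H1 \<Omega> v gv \<and>
     (\<forall>\<phi>::real^2 \<Rightarrow> real. test_fun \<Omega> \<phi> \<longrightarrow>
        integral\<^sup>L (lebesgue_on \<Omega>) (\<lambda>x. (\<Sum>i\<in>UNIV. gu x $ i * of_real (pd i \<phi> x)))
        = integral\<^sup>L (lebesgue_on \<Omega>) (\<lambda>x. of_real (k\<^sup>2 * q) * u x * of_real (\<phi> x))) \<and>
     H10 \<Omega> (\<lambda>x. u x - v x) \<and>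
     (\<forall>\<phi>::real^2 \<Rightarrow> real. test_fun UNIV \<phi> \<longrightarrow>
        integral\<^sup>L (lebesgue_on \<Omega>) (\<lambda>x. (\<Sum>i\<in>UNIV. gu x $ i * of_real (pd i \<phi> x))
                                      - of_real (k\<^sup>2 * q) * u x * of_real (\<phi> x))
        = integral\<^sup>L (lebesgue_on \<Omega>) (\<lambda>x. (\<Sum>i\<in>UNIV. gv x $ i * of_real (pd i \<phi> x))
                                      - of_real (k\<^sup>2) * v x * of_real (\<phi> x))))"

definition ellipse :: "real \<Rightarrow> real \<Rightarrow> real \<Rightarrow> (real^2) set" where
  "ellipse a b \<alpha> = {x. ((cos \<alpha> * x$1 + sin \<alpha> * x$2) / a)\<^sup>2
                      + ((- sin \<alpha> * x$1 + cos \<alpha> * x$2) / b)\<^sup>2 < 1}"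

definition eccentricity :: "real \<Rightarrow> real \<Rightarrow> real" where
  "eccentricity a b = sqrt (1 - b\<^sup>2 / a\<^sup>2)"

end

theory Submission
  imports Defs "HOL-Complex_Analysis.Complex_Analysis"
begin

unbundle no fps_syntax

text \<open>Pairing both sides of the transmission problem with a refracted plane wave \<open>w\<close>, a solution of the
  Helmholtz equation with wave number \<open>k * sqrt q\<close>, shows that the Herglotz wave is orthogonal to
  \<open>w\<close> on the ellipse.  For every direction \<open>s\<close> of \<open>w\<close> this reads
  \<open>integral {-pi..pi} (\<lambda>t. \<phi> t * J (k * \<Phi> t s)) = 0\<close>, where \<open>J\<close> is the Fourier transform of the unit disc
  and \<open>\<Phi> t s\<close> is the length of the sum of the two wave vectors after mapping the ellipse to the disc.
  If infinitely many \<open>k\<close> occur, then by analyticity they can be taken to tend to infinity, and the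
  asymptotics of \<open>J\<close> combined with stationary phase concentrates the integral at the critical points of
  \<open>\<Phi>\<close> in \<open>t\<close>, which the eccentricity bound makes nondegenerate.

  To separate the critical points, the direction \<open>s\<close> is perturbed by \<open>\<sigma> / k\<close>.  The contribution of the
  critical point \<open>t\<close> is then modulated by \<open>cis (\<plusminus> \<sigma> * \<mu>)\<close>, where \<open>\<mu>\<close> is the derivative of \<open>\<Phi>\<close> in
  \<open>s\<close>, the impact parameter of a refracted ray.  Apart from finitely many \<open>s\<close> these frequencies are nonzero
  and pairwise distinct up to sign, so \<open>\<phi>\<close> vanishes at each critical point.  The eccentricity bound also
  makes every \<open>t\<close> critical for some \<open>s\<close>, whence \<open>\<phi>\<close> vanishes outside a finite set.\<close>

section \<open>Stationary phase\<close>

text \<open>The transform \<open>disc_ft x\<close> behaves like \<open>Re (Z * cis (- x))\<close>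
  divided by \<open>x * sqrt x\<close>, so every critical point enters with both signs of its phase.
  The wave numbers are just some sequence tending to infinity, over which there is no control, and
  critical values of \<Phi> might coincide; contributions therefore cannot be separated through
  \<open>k\<close>. What is available is that the integral vanishes for every direction, so the
  direction may depend on \<open>k\<close>. A shift of size \<open>\<sigma> / k\<close> multiplies
  each contribution, to leading order, by a factor that does not depend on \<open>k\<close>.

  With \<open>p = sqrt q\<close> the eccentricity condition reads
  \<open>a^2 - b^2 < p * b^2\<close>. The condition \<open>q \<noteq> 1\<close> enters through the
  factor \<open>q - 1\<close> of the orthogonality relation, through the lower bound
  \<open>b * \<bar>1 - p\<bar>\<close> of \<Phi>, and through the polynomial whose roots give the
  exceptional directions. The density is only C^1, so stationary phase is done with a single
  integration by parts and yields a limit without a rate.\<close>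

lemma norm_cis_diff_1_le: "norm (cis x - 1) \<le> \<bar>x\<bar>"
proof -
  have "norm (cis x - 1) = 2 * \<bar>sin (x / 2)\<bar>"
    using dist_exp_i_1[of x] by (simp add: cis_conv_exp)
  also have "\<dots> \<le> \<bar>x\<bar>" using abs_sin_x_le_abs_x[of "x/2"] by simp
  finally show ?thesis .
qed

lemma norm_cis_diff_1_le_2: "norm (cis x - 1) \<le> 2"
  using norm_triangle_ineq4[of "cis x" 1] by simp

lemma has_vector_derivative_cis [derivative_intros]:
  assumes "(g has_real_derivative g') (at x within S)"
  shows "((\<lambda>x. cis (g x)) has_vector_derivative (of_real g' * \<i> * cis (g x))) (at x within S)"
proof -
  have c: "((\<lambda>x. cos (g x)) has_real_derivative (- sin (g x) * g')) (at x within S)"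
   and s: "((\<lambda>x. sin (g x)) has_real_derivative (cos (g x) * g')) (at x within S)"
    using assms by (auto intro!: derivative_eq_intros)
  have "((\<lambda>x. cis (g x)) has_vector_derivative Complex (- sin (g x) * g') (cos (g x) * g')) (at x within S)"
    using c s by (simp add: has_vector_derivative_complex_iff)
  moreover have "Complex (- sin (g x) * g') (cos (g x) * g') = of_real g' * \<i> * cis (g x)"
    by (simp add: complex_eq_iff)
  ultimately show ?thesis by simp
qed

text \<open>For nonzero \<open>l\<close> the resulting \<open>fresnel_const l\<close> is the Fresnel
  integral of \<open>cis (l * y^2 / 2)\<close> over the positive half line. That integral converges
  only conditionally; integrating by parts, with \<open>cis (l * y^2 / 2) - 1\<close> as the
  primitive, turns it into this absolutely convergent one.\<close>

definition fresnel_integrand :: "real \<Rightarrow> real \<Rightarrow> complex" where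
  "fresnel_integrand l y = (if 0 < y then (cis (l * y\<^sup>2 / 2) - 1) / (\<i> * of_real (y\<^sup>2)) else 0)"

definition fresnel_const :: "real \<Rightarrow> complex" where
  "fresnel_const l = integral\<^sup>L lborel (fresnel_integrand l) / of_real l"

text \<open>Comparison with a multiple of \<open>1 / (1 + y^2)\<close>, whose primitive is arctan.
  The minimum is the shape of the dominating functions used for the Fresnel integral and for the
  rescaled remainder: constant near the critical point, of inverse square decay away from
  it.\<close>

lemma integrable_min_inverse_square:
  assumes "C \<ge> 0" "D \<ge> 0"
  shows "integrable lborel (\<lambda>y::real. indicator {0<..} y * min C (D / y\<^sup>2))"
proof -
  have *: "(\<integral>\<^sup>+x. ennreal (1 / (1 + x\<^sup>2)) * indicator {0..} x \<partial>lborel) = ennreal (pi / 2 - arctan 0)"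
    by (rule nn_integral_FTC_atLeast)
       (auto intro!: derivative_eq_intros tendsto_arctan_at_top simp: add_nonneg_eq_0_iff inverse_eq_divide)
  have "integrable lborel (\<lambda>x::real. indicator {0..} x * (1 / (1 + x\<^sup>2)))"
  proof (intro integrableI_nonneg)
    have "ennreal (indicator {0..} x * (1 / (1 + x\<^sup>2))) = ennreal (1 / (1 + x\<^sup>2)) * indicator {0..} x" for x :: real
      by (simp add: indicator_def)
    then show "(\<integral>\<^sup>+x. ennreal (indicator {0..} x * (1 / (1 + x\<^sup>2))) \<partial>lborel) < \<infinity>"
      using * by simp
  qed auto
  then have *: "integrable lborel (\<lambda>x::real. indicator {0..} x * (1 / (1 + x\<^sup>2)) * (C + D))"
    by (intro integrable_mult_left)
  show ?thesis
  proof (rule Bochner_Integration.integrable_bound[OF *])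
    show "AE y in lborel. norm (indicat_real {0<..} y * min C (D / y\<^sup>2))
           \<le> norm (indicator {0..} y * (1 / (1 + y\<^sup>2)) * (C + D))"
    proof (rule AE_I2)
      fix y :: real
      have "min C (D / y\<^sup>2) \<le> (C + D) / (1 + y\<^sup>2)" if "y > 0"
      proof -
        have "min C (D / y\<^sup>2) * y\<^sup>2 \<le> D / y\<^sup>2 * y\<^sup>2" by (intro mult_right_mono) auto
        then have "min C (D / y\<^sup>2) * (1 + y\<^sup>2) \<le> C + D"
          using that min.cobounded1[of C "D / y\<^sup>2"] by (simp add: distrib_left del: min.cobounded1)
        then show ?thesis by (simp add: pos_le_divide_eq add_pos_nonneg)
      qed
      then show "norm (indicat_real {0<..} y * min C (D / y\<^sup>2))
           \<le> norm (indicator {0..} y * (1 / (1 + y\<^sup>2)) * (C + D))"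
        using assms by (auto simp: indicator_def min_def)
    qed
  qed auto
qed

lemma fresnel_integrand_integrable: "integrable lborel (fresnel_integrand l)"
proof (rule Bochner_Integration.integrable_bound[OF integrable_min_inverse_square[of "\<bar>l\<bar>/2" 2]])
  show "fresnel_integrand l \<in> borel_measurable lborel"
    unfolding fresnel_integrand_def cis.ctr Complex_eq by measurable
  show "AE y in lborel. norm (fresnel_integrand l y) \<le> norm (indicat_real {0<..} y * min (\<bar>l\<bar>/2) (2 / y\<^sup>2))"
  proof (rule AE_I2)
    fix y :: real
    show "norm (fresnel_integrand l y) \<le> norm (indicat_real {0<..} y * min (\<bar>l\<bar>/2) (2 / y\<^sup>2))"
      using norm_cis_diff_1_le[of "l * y\<^sup>2/2"] norm_cis_diff_1_le_2[of "l * y\<^sup>2/2"]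
      by (auto simp: fresnel_integrand_def norm_divide norm_mult divide_simps abs_mult norm_power)
  qed
qed auto

text \<open>Positivity takes the place of an evaluation: the imaginary part of the integrand is
  \<open>(1 - cos (l * y^2 / 2)) / y^2\<close>, which is nonnegative everywhere and positive for
  small \<open>y > 0\<close>.\<close>

lemma fresnel_const_nonzero:
  assumes "l \<noteq> 0" shows "fresnel_const l \<noteq> 0"
proof
  assume "fresnel_const l = 0"
  then have "Im (integral\<^sup>L lborel (fresnel_integrand l)) = 0"
    using assms by (simp add: fresnel_const_def)
  then have 0: "(\<integral>y. Im (fresnel_integrand l y) \<partial>lborel) = 0"
    using fresnel_integrand_integrable by simp
  have Im: "Im (fresnel_integrand l y) = (if 0 < y then (1 - cos (l * y\<^sup>2 / 2)) / y\<^sup>2 else 0)" for y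
    by (simp add: fresnel_integrand_def Im_divide power2_eq_square minus_divide_left)
  have "Im (fresnel_integrand l y) \<ge> 0" for y by (simp add: Im)
  then have "AE y in lborel. Im (fresnel_integrand l y) = 0"
    using 0 integral_nonneg_eq_0_iff_AE[of lborel "\<lambda>y. Im (fresnel_integrand l y)"]
      fresnel_integrand_integrable by simp
  \<comment> \<open>For \<open>0 < y < r\<close> the argument \<open>\<bar>l\<bar> * y^2 / 2\<close>
    lies strictly between 0 and 1, where the cosine is strictly decreasing.\<close>
  moreover define r where "r = sqrt (2 / \<bar>l\<bar>)"
  have "Im (fresnel_integrand l y) \<noteq> 0" if "y \<in> {0<..<r}" for y
  proof -
    have "y\<^sup>2 < r\<^sup>2" using that by (intro power_strict_mono) auto
    then have "\<bar>l\<bar> * y\<^sup>2 / 2 < 1" using assms by (simp add: r_def field_simps)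
    moreover have "\<bar>l\<bar> * y\<^sup>2 / 2 > 0" using assms that by simp
    ultimately have "cos (\<bar>l\<bar> * y\<^sup>2 / 2) < cos 0"
      using pi_gt3 by (intro cos_monotone_0_pi) auto
    moreover have "cos (l * y\<^sup>2 / 2) = cos (\<bar>l\<bar> * y\<^sup>2 / 2)"
      by (cases "l \<ge> 0") auto
    ultimately show ?thesis using that by (simp add: Im)
  qed
  ultimately have "AE y in lborel. y \<notin> {0<..<r}" by (auto elim!: eventually_mono)
  then have "{0<..<r} \<in> null_sets lborel" by (subst AE_iff_null_sets) auto
  moreover have "r > 0" using assms by (simp add: r_def)
  ultimately show False by (simp add: null_sets_def)
qed

text \<open>One integration by parts against \<open>E n\<close>, the primitive of
  \<open>f1 * cis (k n * (f - f c))\<close> that vanishes at the critical point. Since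
  \<open>E n\<close> is of second order in \<open>x - c\<close>, dividing by \<open>f1\<close>, and
  even by its square, leaves bounded functions. After multiplication by \<open>sqrt (k n)\<close>
  the boundary term at \<open>d\<close> and the term with \<open>h1\<close> still tend to zero; the
  term with \<open>f2\<close> lives on the scale \<open>1 / sqrt (k n)\<close> and converges to the
  Fresnel integral.\<close>

lemma half_stationary_phase:
  fixes f f1 f2 :: "real \<Rightarrow> real" and h h1 :: "real \<Rightarrow> complex" and k :: "nat \<Rightarrow> real"
  assumes f: "\<And>x. (f has_real_derivative f1 x) (at x)"
    and f1: "\<And>x. (f1 has_real_derivative f2 x) (at x)" and f2: "continuous_on UNIV f2"
    and h: "\<And>x. (h has_vector_derivative h1 x) (at x)" and h1: "continuous_on UNIV h1"
    and cd: "c < d" and crit: "f1 c = 0" "f2 c \<noteq> 0" and ne: "\<And>x. c < x \<Longrightarrow> x \<le> d \<Longrightarrow> f1 x \<noteq> 0"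
    and k: "\<And>n. k n \<ge> 1" "filterlim k at_top sequentially"
  shows "(\<lambda>n. sqrt (k n) *\<^sub>R integral {c..d} (\<lambda>x. h x * cis (k n * (f x - f c))))
           \<longlonglongrightarrow> h c * fresnel_const (f2 c)"
proof -
  have cf: "continuous_on S f" for S
    by (rule DERIV_continuous_on) (rule has_field_derivative_at_within[OF f])
  have cf1: "continuous_on S f1" for S
    by (rule DERIV_continuous_on) (rule has_field_derivative_at_within[OF f1])
  have ch: "continuous_on S h" for S
    by (rule continuous_on_vector_derivative) (rule has_vector_derivative_at_within[OF h])
  have cf2: "continuous_on S f2" and ch1: "continuous_on S h1" for S
    using f2 h1 by (auto intro: continuous_on_subset)
  have k0: "k n > 0" for n using k(1)[of n] by linarith
  have sk: "filterlim (\<lambda>n. sqrt (k n)) at_top sequentially"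
    using k(2) by (rule filterlim_compose[OF sqrt_at_top])
  have isk: "(\<lambda>n. 1 / sqrt (k n)) \<longlonglongrightarrow> 0"
    using tendsto_divide_0[OF tendsto_const filterlim_at_top_imp_at_infinity[OF sk], of 1] by simp
  have f2bd: "\<exists>L>0. \<forall>x\<in>{c..d}. \<bar>f2 x\<bar> \<le> L"
  proof -
    have "bounded (f2 ` {c..d})" by (intro compact_imp_bounded compact_continuous_image cf2 compact_Icc)
    then show ?thesis by (auto simp: bounded_pos)
  qed
  then obtain L where L: "L > 0" "\<And>x. x \<in> {c..d} \<Longrightarrow> \<bar>f2 x\<bar> \<le> L" by blast
  obtain H where H: "H > 0" "\<And>x. x \<in> {c..d} \<Longrightarrow> norm (h x) \<le> H"
    using compact_imp_bounded[OF compact_continuous_image[OF ch compact_Icc], of c d] by (auto simp: bounded_pos)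
  obtain H1 where H1: "H1 > 0" "\<And>x. x \<in> {c..d} \<Longrightarrow> norm (h1 x) \<le> H1"
    using compact_imp_bounded[OF compact_continuous_image[OF ch1 compact_Icc], of c d] by (auto simp: bounded_pos)
  have f1up: "\<bar>f1 x\<bar> \<le> L * (x - c)" if "x \<in> {c..d}" for x
  proof (cases "x = c")
    case False
    then have "\<exists>z>c. z < x \<and> f1 x - f1 c = (x - c) * f2 z"
      using that by (intro MVT2 f1) auto
    then obtain z where "c < z" "z < x" "f1 x - f1 c = (x - c) * f2 z" by blast
    then show ?thesis
      using L(2)[of z] that crit mult_left_mono[of "\<bar>f2 z\<bar>" L "x - c"] by (simp add: abs_mult mult_ac)
  qed (use crit in auto)
  have Fup: "\<bar>f x - f c\<bar> \<le> L * (x - c)\<^sup>2" if "x \<in> {c..d}" for x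
  proof (cases "x = c")
    case False
    then have "\<exists>z>c. z < x \<and> f x - f c = (x - c) * f1 z"
      using that by (intro MVT2 f) auto
    then obtain z where z: "c < z" "z < x" "f x - f c = (x - c) * f1 z" by blast
    have "\<bar>f1 z\<bar> \<le> L * (z - c)" using z that by (intro f1up) auto
    also have "\<dots> \<le> L * (x - c)" using z L by auto
    finally show ?thesis
      using z mult_left_mono[of "\<bar>f1 z\<bar>" "L * (x - c)" "x - c"] by (simp add: abs_mult power2_eq_square mult_ac)
  qed auto
  have q_lim: "((\<lambda>x. f1 x / (x - c)) \<longlongrightarrow> f2 c) (at c)"
    using f1[of c] crit by (simp add: has_field_derivative_iff)
  have F_lim: "((\<lambda>x. (f x - f c) / (x - c)\<^sup>2) \<longlongrightarrow> f2 c / 2) (at_right c)"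
  proof (rule lhopital_right[where f' = f1 and g' = "\<lambda>x. 2 * (x - c)"])
    have "(f \<longlongrightarrow> f c) (at_right c)"
      by (rule tendsto_within_subset[OF isContD[OF DERIV_isCont[OF f]]]) auto
    then show "((\<lambda>x. f x - f c) \<longlongrightarrow> 0) (at_right c)" by (rule LIM_zero)
    show "((\<lambda>x. (x - c)\<^sup>2) \<longlongrightarrow> 0) (at_right c)" by (auto intro!: tendsto_eq_intros)
    show "\<forall>\<^sub>F x in at_right c. (x - c)\<^sup>2 \<noteq> 0" "\<forall>\<^sub>F x in at_right c. 2 * (x - c) \<noteq> 0"
      by (auto simp: eventually_at_right_field intro!: exI[of _ "c+1"])
    show "\<forall>\<^sub>F x in at_right c. ((\<lambda>x. f x - f c) has_real_derivative f1 x) (at x)"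
      using f by (auto intro!: always_eventually derivative_eq_intros)
    show "\<forall>\<^sub>F x in at_right c. ((\<lambda>x. (x - c)\<^sup>2) has_real_derivative 2 * (x - c)) (at x)"
      by (auto intro!: always_eventually derivative_eq_intros)
    have "((\<lambda>x. f1 x / (x - c) / 2) \<longlongrightarrow> f2 c / 2) (at_right c)"
      by (intro tendsto_divide tendsto_within_subset[OF q_lim] tendsto_const) auto
    then show "((\<lambda>x. f1 x / (2 * (x - c))) \<longlongrightarrow> f2 c / 2) (at_right c)" by (simp add: mult.commute)
  qed
  \<comment> \<open>The quotient \<open>f1 x / (x - c)\<close>, completed by \<open>f2 c\<close> at
    \<open>c\<close>, is continuous and has no zero on the compact interval; \<open>m\<close> is the
    minimum of its modulus.\<close>
  obtain m where m: "m > 0" "\<And>x. x \<in> {c..d} \<Longrightarrow> m * (x - c) \<le> \<bar>f1 x\<bar>"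
  proof -
    define q where "q x = (if x = c then f2 c else f1 x / (x - c))" for x
    have "continuous_on {c..d} q"
      unfolding continuous_on_def
    proof
      fix x assume x: "x \<in> {c..d}"
      have "(q \<longlongrightarrow> q x) (at x)"
      proof (cases "x = c")
        case True
        have "(q \<longlongrightarrow> f2 c) (at c)"
          using q_lim by (rule Lim_transform_eventually) (auto simp: eventually_at_filter q_def)
        then show ?thesis by (simp add: True q_def)
      next
        case False
        have "((\<lambda>x. f1 x / (x - c)) \<longlongrightarrow> f1 x / (x - c)) (at x)"
          by (intro tendsto_divide tendsto_diff tendsto_const tendsto_ident_at isContD[OF DERIV_isCont[OF f1]]) (use False in auto)
        moreover have "\<forall>\<^sub>F y in at x. y \<noteq> c"
          using False eventually_neq_at_within by blast
        moreover from this have "\<forall>\<^sub>F y in at x. f1 y / (y - c) = q y"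
          by eventually_elim (simp add: q_def)
        ultimately have "(q \<longlongrightarrow> f1 x / (x - c)) (at x)"
          using Lim_transform_eventually by blast
        then show ?thesis using False by (simp add: q_def)
      qed
      then show "(q \<longlongrightarrow> q x) (at x within {c..d})" by (rule tendsto_within_subset) auto
    qed
    then have "continuous_on {c..d} (\<lambda>x. \<bar>q x\<bar>)" by (intro continuous_intros)
    from continuous_attains_inf[OF compact_Icc _ this] cd
    obtain x0 where x0: "x0 \<in> {c..d}" "\<And>x. x \<in> {c..d} \<Longrightarrow> \<bar>q x0\<bar> \<le> \<bar>q x\<bar>" by fastforce
    show ?thesis
    proof (rule that[of "\<bar>q x0\<bar>"])
      show "\<bar>q x0\<bar> > 0" using x0(1) ne crit by (auto simp: q_def)
      show "\<bar>q x0\<bar> * (x - c) \<le> \<bar>f1 x\<bar>" if "x \<in> {c..d}" for x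
        using x0(2)[OF that] that by (cases "x = c") (auto simp: q_def abs_divide pos_le_divide_eq)
    qed
  qed
  define E where "E n x = (cis (k n * (f x - f c)) - 1) / (\<i> * of_real (k n))" for n x
  have E1: "norm (E n x) \<le> 2 / k n" for n x
    using norm_cis_diff_1_le_2[of "k n * (f x - f c)"] k0[of n]
    by (simp add: E_def norm_divide norm_mult divide_right_mono)
  have E2: "norm (E n x) \<le> L * (x - c)\<^sup>2" if "x \<in> {c..d}" for n x
  proof -
    have "norm (E n x) = norm (cis (k n * (f x - f c)) - 1) / k n"
      using k0[of n] by (simp add: E_def norm_divide norm_mult)
    also have "\<dots> \<le> \<bar>k n * (f x - f c)\<bar> / k n"
      using k0[of n] by (intro divide_right_mono norm_cis_diff_1_le) auto
    also have "\<dots> = \<bar>f x - f c\<bar>" using k0[of n] by (simp add: abs_mult)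
    finally show ?thesis using Fup[OF that] by simp
  qed
  \<comment> \<open>Essentially the geometric mean of the bounds \<open>E1\<close> and
    \<open>E2\<close>. Multiplied by \<open>sqrt (k n)\<close> it is linear in \<open>x - c\<close>
    uniformly in \<open>n\<close>, and the simple zero of \<open>f1\<close> absorbs it.\<close>
  have E3: "norm (E n x) \<le> 2 * sqrt L * (x - c) / sqrt (k n)" if "x \<in> {c..d}" for n x
  proof -
    have "(norm (E n x))\<^sup>2 \<le> 2 / k n * (L * (x - c)\<^sup>2)"
      unfolding power2_eq_square[of "norm _"] by (intro mult_mono E1 E2 that) (use k0[of n] in auto)
    also have "\<dots> \<le> (2 * sqrt L * (x - c) / sqrt (k n))\<^sup>2"
      using k0[of n] L by (simp add: power_divide power_mult_distrib divide_simps)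
    finally show ?thesis by (rule power2_le_imp_le) (use that L k0[of n] in auto)
  qed
  have cE: "continuous_on S (E n)" for S n
    unfolding E_def cis.ctr Complex_eq using k0[of n] by (intro continuous_intros cf) auto
  \<comment> \<open>By the product rule the derivative of \<open>B n\<close> is
    \<open>T1 n - T2 n + T3 n\<close>, and \<open>T3 n\<close> is the integrand under study.\<close>
  define T1 T2 T3 where "T1 n x = h1 x / of_real (f1 x) * E n x"
    and "T2 n x = h x * of_real (f2 x) / (of_real (f1 x))\<^sup>2 * E n x"
    and "T3 n x = h x * cis (k n * (f x - f c))" for n x
  define B where "B n x = h x / of_real (f1 x) * E n x" for n x
  \<comment> \<open>At \<open>c\<close> the quotient has the value 0, because division by zero gives
    0. This is also its limit, since \<open>E n\<close> vanishes to second order there and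
    \<open>f1\<close> only to first.\<close>
  have ccont: "continuous_on {c..d} (\<lambda>x. g x / of_real (f1 x) * E n x)" if g: "continuous_on UNIV g" for g n
    unfolding continuous_on_def
  proof
    fix x assume x: "x \<in> {c..d}"
    show "((\<lambda>x. g x / of_real (f1 x) * E n x) \<longlongrightarrow> g x / of_real (f1 x) * E n x) (at x within {c..d})"
    proof (cases "x = c")
      case False
      have "isCont g x" "isCont f1 x" "isCont (E n) x"
        using g cf1[of UNIV] cE[of UNIV] by (auto simp: continuous_on_eq_continuous_at)
      then have "isCont (\<lambda>x. g x / of_real (f1 x) * E n x) x"
        using ne[of x] False x by (intro continuous_intros) auto
      then show ?thesis by (rule tendsto_within_subset[OF isContD]) auto
    next
      case True
      obtain K where K: "K > 0" "\<And>x. x \<in> {c..d} \<Longrightarrow> norm (g x) \<le> K"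
        using compact_imp_bounded[OF compact_continuous_image[OF continuous_on_subset[OF g] compact_Icc], of c d]
        by (auto simp: bounded_pos)
      have "((\<lambda>x. g x / of_real (f1 x) * E n x) \<longlongrightarrow> 0) (at c within {c..d})"
      proof (rule Lim_null_comparison[where g = "\<lambda>x. K / m * L * (x - c)"])
        show "\<forall>\<^sub>F x in at c within {c..d}. norm (g x / of_real (f1 x) * E n x) \<le> K / m * L * (x - c)"
          unfolding eventually_at_filter
        proof (intro always_eventually allI impI)
          fix x assume "x \<noteq> c" and x: "x \<in> {c..d}"
          then have "norm (g x / of_real (f1 x) * E n x) \<le> K / (m * (x - c)) * (L * (x - c)\<^sup>2)"
            unfolding norm_mult norm_divide norm_of_real using K m(1) m(2)[OF x]
            by (intro mult_mono frac_le E2) auto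
          also have "\<dots> = K / m * L * (x - c)" using \<open>x \<noteq> c\<close> m by (simp add: power2_eq_square)
          finally show "norm (g x / of_real (f1 x) * E n x) \<le> K / m * L * (x - c)" .
        qed
      qed (use m in \<open>auto intro!: tendsto_eq_intros\<close>)
      then show ?thesis by (simp add: True crit)
    qed
  qed
  have T1c: "continuous_on {c..d} (T1 n)" for n
    unfolding T1_def by (rule ccont[OF ch1])
  have T3c: "continuous_on {c..d} (T3 n)" for n
    unfolding T3_def cis.ctr Complex_eq by (intro continuous_intros ch cf)
  have FTC: "((\<lambda>x. T1 n x - T2 n x + T3 n x) has_integral B n d) {c..d}" for n
  proof -
    have "((\<lambda>x. T1 n x - T2 n x + T3 n x) has_integral (B n d - B n c)) {c..d}"
    proof (rule fundamental_theorem_of_calculus_interior)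
      show "continuous_on {c..d} (B n)" unfolding B_def by (rule ccont[OF ch])
      fix x assume x: "x \<in> {c<..<d}"
      then have nz: "f1 x \<noteq> 0" using ne[of x] by auto
      have i: "((\<lambda>x. complex_of_real (inverse (f1 x))) has_vector_derivative of_real (- f2 x / (f1 x)\<^sup>2)) (at x)"
        by (rule has_vector_derivative_of_real)
           (use nz f1[of x] in \<open>auto intro!: derivative_eq_intros simp: power2_eq_square divide_simps\<close>)
      have e: "(E n has_vector_derivative (of_real (f1 x) * cis (k n * (f x - f c)))) (at x)"
      proof -
        have "((\<lambda>x. (cis (k n * (f x - f c)) - 1) * (1 / (\<i> * of_real (k n)))) has_vector_derivative
               (of_real (k n * f1 x) * \<i> * cis (k n * (f x - f c)) - 0) * (1 / (\<i> * of_real (k n)))) (at x)"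
          by (intro has_vector_derivative_mult_left has_vector_derivative_diff has_vector_derivative_cis has_vector_derivative_const)
             (auto intro!: derivative_eq_intros f)
        moreover have "(of_real (k n * f1 x) * \<i> * cis (k n * (f x - f c)) - 0) * (1 / (\<i> * of_real (k n)))
            = of_real (f1 x) * cis (k n * (f x - f c))"
          using k0[of n] by (simp add: field_simps)
        ultimately show ?thesis unfolding E_def by simp
      qed
      have "((\<lambda>x. h x * of_real (inverse (f1 x)) * E n x) has_vector_derivative
           (h x * of_real (inverse (f1 x))) * (of_real (f1 x) * cis (k n * (f x - f c)))
           + (h x * of_real (- f2 x / (f1 x)\<^sup>2) + h1 x * of_real (inverse (f1 x))) * E n x) (at x)"
        by (intro has_vector_derivative_mult h i e)
      moreover have "(h x * of_real (inverse (f1 x))) * (of_real (f1 x) * cis (k n * (f x - f c)))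
           + (h x * of_real (- f2 x / (f1 x)\<^sup>2) + h1 x * of_real (inverse (f1 x))) * E n x
           = T1 n x - T2 n x + T3 n x"
        using nz by (simp add: T1_def T2_def T3_def field_simps)
      ultimately show "(B n has_vector_derivative T1 n x - T2 n x + T3 n x) (at x)"
        by (simp add: B_def[abs_def] divide_inverse)
    qed (use cd in auto)
    then show ?thesis by (simp add: B_def crit)
  qed
  have T1i: "T1 n integrable_on {c..d}" and T3i: "T3 n integrable_on {c..d}" for n
    using T1c T3c by (auto intro: integrable_continuous_real)
  \<comment> \<open>At \<open>c\<close> the function \<open>T2 n\<close> has the value 0 but the
    limit \<open>h c / 2\<close>. Continuity may thus fail, and integrability is read off from the
    identity \<open>FTC\<close>.\<close>
  have T2i: "T2 n integrable_on {c..d}" for n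
  proof -
    have "(\<lambda>x. T1 n x + T3 n x - (T1 n x - T2 n x + T3 n x)) integrable_on {c..d}"
      by (intro integrable_diff integrable_add T1i T3i has_integral_integrable[OF FTC])
    then show ?thesis by simp
  qed
  have split: "integral {c..d} (T3 n) = B n d - integral {c..d} (T1 n) + integral {c..d} (T2 n)" for n
  proof -
    have "B n d = integral {c..d} (\<lambda>x. T1 n x - T2 n x + T3 n x)"
      using FTC[of n] by (simp add: integral_unique)
    also have "\<dots> = integral {c..d} (T1 n) - integral {c..d} (T2 n) + integral {c..d} (T3 n)"
      using T1i[of n] T2i[of n] T3i[of n] by (simp add: integral_add integral_diff integrable_diff)
    finally show ?thesis by simp
  qed
  have sk_div: "sqrt (k n) * (A * (2 / k n)) = A * 2 * (1 / sqrt (k n))" for A n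
  proof -
    have "sqrt (k n) * (A * (2 / k n)) = A * 2 * (sqrt (k n) / k n)" by simp
    then show ?thesis using k0[of n] by (simp add: sqrt_divide_self_eq inverse_eq_divide)
  qed
  have lim0: "(\<lambda>n. sqrt (k n) *\<^sub>R B n d) \<longlonglongrightarrow> 0"
  proof (rule Lim_null_comparison[where g = "\<lambda>n. norm (h d / of_real (f1 d)) * 2 * (1 / sqrt (k n))"])
    show "\<forall>\<^sub>F n in sequentially. norm (sqrt (k n) *\<^sub>R B n d) \<le> norm (h d / of_real (f1 d)) * 2 * (1 / sqrt (k n))"
    proof (intro always_eventually allI)
      fix n
      have "norm (sqrt (k n) *\<^sub>R B n d) \<le> sqrt (k n) * (norm (h d / of_real (f1 d)) * (2 / k n))"
        unfolding B_def norm_scaleR norm_mult using k0[of n] by (intro mult_mono E1) auto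
      also have "\<dots> = norm (h d / of_real (f1 d)) * 2 * (1 / sqrt (k n))"
        by (rule sk_div)
      finally show "norm (sqrt (k n) *\<^sub>R B n d) \<le> norm (h d / of_real (f1 d)) * 2 * (1 / sqrt (k n))" .
    qed
  qed (use tendsto_mult_right_zero[OF isk] in blast)
  have lim1: "(\<lambda>n. integral {c..d} (\<lambda>x. sqrt (k n) *\<^sub>R T1 n x)) \<longlonglongrightarrow> integral {c..d} (\<lambda>x. 0)"
  proof (rule dominated_convergence(2)[where h = "\<lambda>x. H1 / m * 2 * sqrt L"])
    show "(\<lambda>x. sqrt (k n) *\<^sub>R T1 n x) integrable_on {c..d}" for n
      by (intro integrable_cmul T1i)
    show "norm (sqrt (k n) *\<^sub>R T1 n x) \<le> H1 / m * 2 * sqrt L" if x: "x \<in> {c..d}" for n x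
    proof (cases "x = c")
      case False
      have "norm (sqrt (k n) *\<^sub>R T1 n x) \<le> sqrt (k n) * (H1 / (m * (x - c)) * (2 * sqrt L * (x - c) / sqrt (k n)))"
        unfolding T1_def norm_mult norm_scaleR norm_divide norm_of_real using H1 m(1) m(2)[OF x] x False k0[of n]
        by (intro mult_mono frac_le E3) auto
      also have "\<dots> = H1 / m * 2 * sqrt L" using False m k0[of n] by (simp add: field_simps)
      finally show ?thesis .
    qed (use H1 m L in \<open>simp add: T1_def crit\<close>)
    show "(\<lambda>n. sqrt (k n) *\<^sub>R T1 n x) \<longlonglongrightarrow> 0" if x: "x \<in> {c..d}" for x
    proof (rule Lim_null_comparison[where g = "\<lambda>n. norm (h1 x / of_real (f1 x)) * 2 * (1 / sqrt (k n))"])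
      show "\<forall>\<^sub>F n in sequentially. norm (sqrt (k n) *\<^sub>R T1 n x) \<le> norm (h1 x / of_real (f1 x)) * 2 * (1 / sqrt (k n))"
      proof (intro always_eventually allI)
        fix n
        have "norm (sqrt (k n) *\<^sub>R T1 n x) \<le> sqrt (k n) * (norm (h1 x / of_real (f1 x)) * (2 / k n))"
          unfolding T1_def norm_scaleR norm_mult using k0[of n] by (intro mult_mono E1) auto
        also have "\<dots> = norm (h1 x / of_real (f1 x)) * 2 * (1 / sqrt (k n))"
          by (rule sk_div)
        finally show "norm (sqrt (k n) *\<^sub>R T1 n x) \<le> norm (h1 x / of_real (f1 x)) * 2 * (1 / sqrt (k n))" .
      qed
    qed (use tendsto_mult_right_zero[OF isk] in blast)
  qed auto
  have m2: "(\<lambda>x. T2 n x) \<in> borel_measurable borel" for n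
    unfolding T2_def
    by (intro borel_measurable_times borel_measurable_divide borel_measurable_continuous_onI ch cE
        borel_measurable_power continuous_on_of_real cf1 cf2)
  \<comment> \<open>Both bounds on \<open>E n\<close> are kept. In the variable
    \<open>y = sqrt (k n) * (x - c)\<close> their minimum divided by \<open>(x - c)^2\<close>
    becomes a fixed integrable function.\<close>
  have bT2: "norm (T2 n x) \<le> H * L / m\<^sup>2 * min L (2 / (k n * (x - c)\<^sup>2))" if x: "x \<in> {c<..d}" for n x
  proof -
    have "norm (T2 n x) \<le> H * L / (m * (x - c))\<^sup>2 * min (2 / k n) (L * (x - c)\<^sup>2)"
      unfolding T2_def norm_mult norm_divide norm_power norm_of_real
      using H L m(1) m(2)[of x] x E1[of n x] E2[of x n]
      by (intro mult_mono frac_le power_mono mult_nonneg_nonneg) auto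
    also have "\<dots> = H * L / m\<^sup>2 * (min (2 / k n) (L * (x - c)\<^sup>2) / (x - c)\<^sup>2)"
      by (simp add: power_mult_distrib)
    also have "min (2 / k n) (L * (x - c)\<^sup>2) / (x - c)\<^sup>2 = min L (2 / (k n * (x - c)\<^sup>2))"
      using x k0[of n] by (auto simp: min_def divide_simps mult_ac)
    finally show ?thesis .
  qed
  define K where "K = H * L / m\<^sup>2"
  have K0: "K \<ge> 0" using H L by (simp add: K_def)
  have si: "set_integrable lborel {c..d} (T2 n)" for n
    unfolding set_integrable_def
  proof (rule Bochner_Integration.integrable_bound[where f = "\<lambda>x. indicator {c..d} x * (K * L)"])
    show "AE x in lborel. norm (indicat_real {c..d} x *\<^sub>R T2 n x) \<le> norm (indicat_real {c..d} x * (K * L))"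
    proof (rule AE_I2)
      fix x
      have "norm (T2 n x) \<le> K * L" if "x \<in> {c..d}"
      proof (cases "x = c")
        case False
        then have "norm (T2 n x) \<le> K * min L (2 / (k n * (x - c)\<^sup>2))" using bT2[of x n] that by (simp add: K_def)
        also have "\<dots> \<le> K * L" using K0 by (intro mult_left_mono) auto
        finally show ?thesis .
      qed (use K0 L in \<open>simp add: T2_def crit\<close>)
      then show "norm (indicat_real {c..d} x *\<^sub>R T2 n x) \<le> norm (indicat_real {c..d} x * (K * L))"
        by (auto simp: indicator_def)
    qed
    show "integrable lborel (\<lambda>x. indicat_real {c..d} x * (K * L))"
      using cd by (intro integrable_mult_left integrable_real_indicator) auto
  qed (use m2[of n] in \<open>auto intro!: borel_measurable_scaleR borel_measurable_indicator\<close>)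
  \<comment> \<open>The substitution \<open>x = c + y / sqrt (k n)\<close>, with the integrand
    extended by zero outside the interval. Its Jacobian cancels the factor
    \<open>sqrt (k n)\<close>.\<close>
  define U where "U n y = indicat_real {c..d} (c + 1 / sqrt (k n) * y) *\<^sub>R T2 n (c + 1 / sqrt (k n) * y)" for n y
  have U: "sqrt (k n) *\<^sub>R integral {c..d} (T2 n) = integral\<^sup>L lborel (U n)" for n
  proof -
    have "integral {c..d} (T2 n) = (\<integral>x. indicat_real {c..d} x *\<^sub>R T2 n x \<partial>lborel)"
      using set_borel_integral_eq_integral(2)[OF si[of n]] by (simp add: set_lebesgue_integral_def)
    also have "\<dots> = \<bar>1 / sqrt (k n)\<bar> *\<^sub>R integral\<^sup>L lborel (U n)"
      unfolding U_def using k0[of n] by (subst lborel_integral_real_affine[where t = c and c = "1 / sqrt (k n)"]) auto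
    finally show ?thesis using k0[of n] by simp
  qed
  have lim2: "(\<lambda>n. integral\<^sup>L lborel (U n)) \<longlonglongrightarrow> integral\<^sup>L lborel (\<lambda>y. h c / of_real (f2 c) * fresnel_integrand (f2 c) y)"
  proof (rule integral_dominated_convergence[where w = "\<lambda>y. K * (indicator {0<..} y * min L (2 / y\<^sup>2))"])
    show "(\<lambda>y. h c / complex_of_real (f2 c) * fresnel_integrand (f2 c) y) \<in> borel_measurable lborel"
      using fresnel_integrand_integrable by auto
    show "U n \<in> borel_measurable lborel" for n
      unfolding U_def using m2[of n] by measurable
    show "integrable lborel (\<lambda>y. K * (indicator {0<..} y * min L (2 / y\<^sup>2)))"
      using L by (intro integrable_mult_right integrable_min_inverse_square) auto
    show "AE y in lborel. norm (U n y) \<le> K * (indicator {0<..} y * min L (2 / y\<^sup>2))" for n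
    proof (rule AE_I2)
      fix y
      show "norm (U n y) \<le> K * (indicator {0<..} y * min L (2 / y\<^sup>2))"
      proof (cases "y > 0")
        case True
        have "0 \<le> K * min L (2 / y\<^sup>2)" using K0 L by simp
        moreover have "norm (T2 n (c + 1 / sqrt (k n) * y)) \<le> K * min L (2 / y\<^sup>2)" if "c + 1 / sqrt (k n) * y \<le> d"
          using bT2[of "c + 1 / sqrt (k n) * y" n] k0[of n] True that by (simp add: K_def power_divide)
        ultimately show ?thesis
          using True by (simp add: U_def indicator_def)
      next
        case False
        have "c + 1 / sqrt (k n) * y \<notin> {c..d}" if "y < 0"
          using divide_neg_pos[OF that, of "sqrt (k n)"] k0[of n] by simp
        then show ?thesis using False by (cases "y = 0") (auto simp: U_def T2_def crit)
      qed
    qed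
    show "AE y in lborel. (\<lambda>n. U n y) \<longlonglongrightarrow> h c / complex_of_real (f2 c) * fresnel_integrand (f2 c) y"
    proof (rule AE_I2)
      fix y :: real
      show "(\<lambda>n. U n y) \<longlonglongrightarrow> h c / complex_of_real (f2 c) * fresnel_integrand (f2 c) y"
      proof (cases "y > 0")
        case False
        have "c + 1 / sqrt (k n) * y \<notin> {c..d}" if "y < 0" for n
          using divide_neg_pos[OF that, of "sqrt (k n)"] k0[of n] by simp
        then have "U n y = 0" for n
          using False by (cases "y = 0") (auto simp: U_def T2_def crit)
        then show ?thesis using False by (simp add: fresnel_integrand_def)
      next
        case y: True
        define x where "x n = c + 1 / sqrt (k n) * y" for n
        have xc: "x n - c = y / sqrt (k n)" and x_gt: "x n > c" for n
          using y k0[of n] by (auto simp: x_def)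
        have xlim: "x \<longlonglongrightarrow> c"
          unfolding x_def using tendsto_add[OF tendsto_const tendsto_mult_left_zero[OF isk, of y], of c] by simp
        have xr: "filterlim x (at_right c) sequentially"
          unfolding filterlim_at using xlim x_gt less_imp_neq[OF x_gt, THEN not_sym] by auto
        then have xa: "filterlim x (at c) sequentially"
          by (rule filterlim_mono) (auto simp: at_le)
        have ev: "\<forall>\<^sub>F n in sequentially. x n \<in> {c..d}"
          using order_tendstoD(2)[OF xlim cd] by eventually_elim (use x_gt in \<open>auto simp: less_imp_le\<close>)
        have l1: "(\<lambda>n. f1 (x n) * sqrt (k n)) \<longlonglongrightarrow> f2 c * y"
        proof -
          have "(\<lambda>n. f1 (x n) / (x n - c) * y) \<longlonglongrightarrow> f2 c * y"
            by (intro tendsto_mult tendsto_const filterlim_compose[OF q_lim xa])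
          then show ?thesis unfolding xc using y by simp
        qed
        have l2: "(\<lambda>n. k n * (f (x n) - f c)) \<longlonglongrightarrow> f2 c * y\<^sup>2 / 2"
        proof -
          have "(\<lambda>n. (f (x n) - f c) / (x n - c)\<^sup>2 * y\<^sup>2) \<longlonglongrightarrow> f2 c / 2 * y\<^sup>2"
            by (intro tendsto_mult tendsto_const filterlim_compose[OF F_lim xr])
          moreover have "(f (x n) - f c) / (x n - c)\<^sup>2 * y\<^sup>2 = k n * (f (x n) - f c)" for n
            unfolding xc using y k0[of n] by (simp add: power_divide)
          ultimately show ?thesis by simp
        qed
        have l3: "(\<lambda>n. h (x n)) \<longlonglongrightarrow> h c" "(\<lambda>n. f2 (x n)) \<longlonglongrightarrow> f2 c"
          using ch[of UNIV] cf2[of UNIV] xlim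
          by (auto intro!: isCont_tendsto_compose[where l = c] simp: continuous_on_eq_continuous_at)
        have l4: "(\<lambda>n. cis (k n * (f (x n) - f c))) \<longlonglongrightarrow> cis (f2 c * y\<^sup>2 / 2)"
          unfolding cis.ctr Complex_eq by (intro tendsto_intros l2)
        \<comment> \<open>Here \<open>T2 n\<close> is rewritten so that \<open>f1\<close> occurs
          only in the combination \<open>f1 (x n) * sqrt (k n)\<close>, which converges to
          \<open>f2 c * y\<close>; the powers of \<open>k n\<close> balance exactly.\<close>
        have "(\<lambda>n. h (x n) * of_real (f2 (x n)) / (of_real (f1 (x n) * sqrt (k n)))\<^sup>2
                * ((cis (k n * (f (x n) - f c)) - 1) / \<i>))
              \<longlonglongrightarrow> h c * of_real (f2 c) / (of_real (f2 c * y))\<^sup>2 * ((cis (f2 c * y\<^sup>2 / 2) - 1) / \<i>)"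
          using crit y by (intro tendsto_intros l1 l3 l4) auto
        also have "h c * of_real (f2 c) / (of_real (f2 c * y))\<^sup>2 * ((cis (f2 c * y\<^sup>2 / 2) - 1) / \<i>)
            = h c / complex_of_real (f2 c) * fresnel_integrand (f2 c) y"
          using y crit by (simp add: fresnel_integrand_def power_mult_distrib) (simp add: power2_eq_square divide_simps algebra_simps)
        finally show ?thesis
        proof (rule Lim_transform_eventually)
          have *: "(complex_of_real (sqrt (k n)))\<^sup>2 = of_real (k n)" for n
            using k0[of n] by (metis of_real_power real_sqrt_pow2 less_imp_le)
          show "\<forall>\<^sub>F n in sequentially. h (x n) * of_real (f2 (x n)) / (of_real (f1 (x n) * sqrt (k n)))\<^sup>2
                * ((cis (k n * (f (x n) - f c)) - 1) / \<i>) = U n y"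
            using ev
          proof eventually_elim
            case (elim n)
            then have "U n y = T2 n (x n)" by (simp add: U_def x_def)
            then show ?case using k0[of n]
              by (simp add: T2_def E_def power_mult_distrib * divide_inverse mult_ac)
          qed
        qed
      qed
    qed
  qed
  have "(\<lambda>n. sqrt (k n) *\<^sub>R B n d - integral {c..d} (\<lambda>x. sqrt (k n) *\<^sub>R T1 n x) + integral\<^sup>L lborel (U n))
      \<longlonglongrightarrow> 0 - integral {c..d} (\<lambda>x. 0) + integral\<^sup>L lborel (\<lambda>y. h c / of_real (f2 c) * fresnel_integrand (f2 c) y)"
    by (intro tendsto_intros lim0 lim1 lim2)
  moreover have "sqrt (k n) *\<^sub>R B n d - integral {c..d} (\<lambda>x. sqrt (k n) *\<^sub>R T1 n x) + integral\<^sup>L lborel (U n)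
      = sqrt (k n) *\<^sub>R integral {c..d} (T3 n)" for n
    unfolding split U[symmetric] by (simp add: algebra_simps)
  ultimately show ?thesis
    by (simp add: T3_def[abs_def] fresnel_const_def)
qed

text \<open>The reflection \<open>x \<mapsto> - x\<close> changes the sign of \<open>f1\<close> and
  \<open>h1\<close> but not that of \<open>f2\<close>, so the same Fresnel constant appears on the
  left.\<close>

lemma half_stationary_phase_left:
  fixes f f1 f2 :: "real \<Rightarrow> real" and h h1 :: "real \<Rightarrow> complex" and k :: "nat \<Rightarrow> real"
  assumes f: "\<And>x. (f has_real_derivative f1 x) (at x)"
    and f1: "\<And>x. (f1 has_real_derivative f2 x) (at x)" and f2: "continuous_on UNIV f2"
    and h: "\<And>x. (h has_vector_derivative h1 x) (at x)" and h1: "continuous_on UNIV h1"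
    and cd: "d < c" and crit: "f1 c = 0" "f2 c \<noteq> 0" and ne: "\<And>x. d \<le> x \<Longrightarrow> x < c \<Longrightarrow> f1 x \<noteq> 0"
    and k: "\<And>n. k n \<ge> 1" "filterlim k at_top sequentially"
  shows "(\<lambda>n. sqrt (k n) *\<^sub>R integral {d..c} (\<lambda>x. h x * cis (k n * (f x - f c))))
           \<longlonglongrightarrow> h c * fresnel_const (f2 c)"
proof -
  have "(\<lambda>n. sqrt (k n) *\<^sub>R integral {-c..-d} (\<lambda>x. h (- x) * cis (k n * (f (- x) - f (- (- c))))))
           \<longlonglongrightarrow> h (- (- c)) * fresnel_const (f2 (- (- c)))"
  proof (rule half_stationary_phase[where ?f1.0 = "\<lambda>x. - f1 (- x)" and ?h1.0 = "\<lambda>x. - h1 (- x)"])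
    show "((\<lambda>x. f (- x)) has_real_derivative - f1 (- x)) (at x)" for x
      using DERIV_chain2[OF f DERIV_minus[OF DERIV_ident], of x] by simp
    show "((\<lambda>x. - f1 (- x)) has_real_derivative f2 (- x)) (at x)" for x
      using DERIV_minus[OF DERIV_chain2[OF f1 DERIV_minus[OF DERIV_ident], of x]] by simp
    show "continuous_on UNIV (\<lambda>x. f2 (- x))" "continuous_on UNIV (\<lambda>x. - h1 (- x))"
      by (auto intro!: continuous_intros continuous_on_compose2[OF f2] continuous_on_compose2[OF h1])
    show "((\<lambda>x. h (- x)) has_vector_derivative - h1 (- x)) (at x)" for x
    proof -
      have "((\<lambda>x. - x) has_vector_derivative (-1::real)) (at x)" by (auto intro!: derivative_eq_intros)
      from vector_diff_chain_at[OF this h] show ?thesis by (simp add: o_def)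
    qed
  qed (use cd crit ne k in auto)
  then show ?thesis
    using Henstock_Kurzweil_Integration.integral_reflect_real[of c d "\<lambda>x. h x * cis (k n * (f x - f c))" for n] by simp
qed

text \<open>Without a critical point one integration by parts gives a bound of order
  \<open>1 / k n\<close>, which still vanishes after multiplication by
  \<open>sqrt (k n)\<close>.\<close>

lemma nonstationary_phase:
  fixes f f1 f2 :: "real \<Rightarrow> real" and h h1 :: "real \<Rightarrow> complex" and k :: "nat \<Rightarrow> real"
  assumes f: "\<And>x. (f has_real_derivative f1 x) (at x)"
    and f1: "\<And>x. (f1 has_real_derivative f2 x) (at x)" and f2: "continuous_on UNIV f2"
    and h: "\<And>x. (h has_vector_derivative h1 x) (at x)" and h1: "continuous_on UNIV h1"
    and cd: "c \<le> d" and ne: "\<And>x. c \<le> x \<Longrightarrow> x \<le> d \<Longrightarrow> f1 x \<noteq> 0"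
    and k: "\<And>n. k n \<ge> 1" "filterlim k at_top sequentially"
  shows "(\<lambda>n. sqrt (k n) *\<^sub>R integral {c..d} (\<lambda>x. h x * cis (k n * f x))) \<longlonglongrightarrow> 0"
proof -
  have cf: "continuous_on S f" for S
    by (rule DERIV_continuous_on) (rule has_field_derivative_at_within[OF f])
  have cf1: "continuous_on S f1" for S
    by (rule DERIV_continuous_on) (rule has_field_derivative_at_within[OF f1])
  have ch: "continuous_on S h" for S
    by (rule continuous_on_vector_derivative) (rule has_vector_derivative_at_within[OF h])
  have cf2: "continuous_on S f2" and ch1: "continuous_on S h1" for S
    using f2 h1 by (auto intro: continuous_on_subset)
  have k0: "k n > 0" for n using k(1)[of n] by linarith
  have sk: "filterlim (\<lambda>n. sqrt (k n)) at_top sequentially"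
    using k(2) by (rule filterlim_compose[OF sqrt_at_top])
  have isk: "(\<lambda>n. 1 / sqrt (k n)) \<longlonglongrightarrow> 0"
    using tendsto_divide_0[OF tendsto_const filterlim_at_top_imp_at_infinity[OF sk], of 1] by simp
  define g where "g x = h x * of_real (inverse (f1 x))" for x
  define g1 where "g1 x = h x * of_real (- f2 x / (f1 x)\<^sup>2) + h1 x * of_real (inverse (f1 x))" for x
  have g: "(g has_vector_derivative g1 x) (at x)" if "x \<in> {c..d}" for x
    unfolding g_def g1_def
  proof (intro has_vector_derivative_mult h has_vector_derivative_of_real)
    show "((\<lambda>x. inverse (f1 x)) has_real_derivative - f2 x / (f1 x)\<^sup>2) (at x)"
      using ne[of x] f1[of x] that by (auto intro!: derivative_eq_intros simp: power2_eq_square divide_simps)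
  qed
  have cg: "continuous_on {c..d} g" unfolding g_def
    by (intro continuous_intros ch cf1) (use ne in auto)
  have cg1: "continuous_on {c..d} g1" unfolding g1_def
    by (intro continuous_intros ch cf1 cf2 ch1) (use ne in auto)
  obtain G where G: "G > 0" "\<And>x. x \<in> {c..d} \<Longrightarrow> norm (g x) \<le> G"
    using compact_imp_bounded[OF compact_continuous_image[OF cg compact_Icc]] by (auto simp: bounded_pos)
  obtain G1 where G1: "G1 > 0" "\<And>x. x \<in> {c..d} \<Longrightarrow> norm (g1 x) \<le> G1"
    using compact_imp_bounded[OF compact_continuous_image[OF cg1 compact_Icc]] by (auto simp: bounded_pos)
  define e where "e n x = cis (k n * f x) / (\<i> * of_real (k n))" for n x
  have ne: "norm (e n x) = 1 / k n" for n x using k0[of n] by (simp add: e_def norm_divide norm_mult)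
  have ce: "continuous_on S (e n)" for S n
    unfolding e_def cis.ctr Complex_eq using k0[of n] by (intro continuous_intros cf) auto
  have e: "(e n has_vector_derivative of_real (f1 x) * cis (k n * f x)) (at x)" for n x
  proof -
    have "((\<lambda>x. cis (k n * f x) * (1 / (\<i> * of_real (k n)))) has_vector_derivative
           (of_real (k n * f1 x) * \<i> * cis (k n * f x)) * (1 / (\<i> * of_real (k n)))) (at x)"
      by (intro has_vector_derivative_mult_left has_vector_derivative_cis) (auto intro!: derivative_eq_intros f)
    moreover have "(of_real (k n * f1 x) * \<i> * cis (k n * f x)) * (1 / (\<i> * of_real (k n))) = of_real (f1 x) * cis (k n * f x)"
      using k0[of n] by (simp add: field_simps)
    ultimately show ?thesis unfolding e_def by simp
  qed
  have FTC: "((\<lambda>x. g x * (of_real (f1 x) * cis (k n * f x)) + g1 x * e n x) has_integral g d * e n d - g c * e n c) {c..d}" for n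
  proof (rule fundamental_theorem_of_calculus[OF cd])
    fix x assume "x \<in> {c..d}"
    from has_vector_derivative_mult[OF g[OF this] e]
    show "((\<lambda>x. g x * e n x) has_vector_derivative g x * (of_real (f1 x) * cis (k n * f x)) + g1 x * e n x) (at x within {c..d})"
      by (rule has_vector_derivative_at_within)
  qed
  have gf: "g x * (of_real (f1 x) * cis (k n * f x)) = h x * cis (k n * f x)" if "x \<in> {c..d}" for x n
    using assms(7)[of x] that by (simp add: g_def)
  have i: "(\<lambda>x. g1 x * e n x) integrable_on {c..d}" for n
    by (intro integrable_continuous_real continuous_intros cg1 ce)
  have split: "integral {c..d} (\<lambda>x. h x * cis (k n * f x)) = g d * e n d - g c * e n c - integral {c..d} (\<lambda>x. g1 x * e n x)" for n
  proof -
    have "((\<lambda>x. (g x * (of_real (f1 x) * cis (k n * f x)) + g1 x * e n x) - g1 x * e n x) has_integral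
         (g d * e n d - g c * e n c - integral {c..d} (\<lambda>x. g1 x * e n x))) {c..d}"
      by (intro has_integral_diff FTC integrable_integral i)
    then have "((\<lambda>x. h x * cis (k n * f x)) has_integral
         (g d * e n d - g c * e n c - integral {c..d} (\<lambda>x. g1 x * e n x))) {c..d}"
      by (rule has_integral_eq[rotated]) (simp add: gf)
    then show ?thesis by (rule integral_unique)
  qed
  have bd: "norm (integral {c..d} (\<lambda>x. h x * cis (k n * f x))) \<le> (2 * G + G1 * (d - c)) / k n" for n
  proof -
    have "norm (integral {c..d} (\<lambda>x. g1 x * e n x)) \<le> G1 / k n * (d - c)"
      using cd
    proof (rule integral_bound)
      show "norm (g1 x * e n x) \<le> G1 / k n" if "x \<in> {c..d}" for x
        unfolding norm_mult ne using G1(2)[OF that] k0[of n] by (simp add: divide_right_mono)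
    qed (intro continuous_intros cg1 ce)
    moreover have "norm (g d * e n d) \<le> G / k n" "norm (g c * e n c) \<le> G / k n"
      unfolding norm_mult ne using G(2)[of d] G(2)[of c] cd k0[of n] by (auto simp: divide_right_mono)
    moreover have "norm (integral {c..d} (\<lambda>x. h x * cis (k n * f x)))
        \<le> norm (g d * e n d) + norm (g c * e n c) + norm (integral {c..d} (\<lambda>x. g1 x * e n x))"
      unfolding split by (smt (verit) norm_triangle_ineq4)
    ultimately show ?thesis by (simp add: add_divide_distrib)
  qed
  show ?thesis
  proof (rule Lim_null_comparison[where g = "\<lambda>n. (2 * G + G1 * (d - c)) * (1 / sqrt (k n))"])
    show "\<forall>\<^sub>F n in sequentially. norm (sqrt (k n) *\<^sub>R integral {c..d} (\<lambda>x. h x * cis (k n * f x)))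
          \<le> (2 * G + G1 * (d - c)) * (1 / sqrt (k n))"
    proof (intro always_eventually allI)
      fix n
      have "norm (sqrt (k n) *\<^sub>R integral {c..d} (\<lambda>x. h x * cis (k n * f x)))
          \<le> sqrt (k n) * ((2 * G + G1 * (d - c)) / k n)"
        unfolding norm_scaleR using k0[of n] by (intro mult_mono bd) auto
      also have "\<dots> = (2 * G + G1 * (d - c)) * (sqrt (k n) / k n)" by simp
      also have "\<dots> = (2 * G + G1 * (d - c)) * (1 / sqrt (k n))"
        using k0[of n] by (simp add: sqrt_divide_self_eq inverse_eq_divide)
      finally show "norm (sqrt (k n) *\<^sub>R integral {c..d} (\<lambda>x. h x * cis (k n * f x)))
          \<le> (2 * G + G1 * (d - c)) * (1 / sqrt (k n))" .
    qed
  qed (use tendsto_mult_right_zero[OF isk] in blast)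
qed

text \<open>Each side from which a critical point is approached contributes one half of the usual term,
  so that critical end points need no separate treatment.\<close>

definition side_count :: "real \<Rightarrow> real \<Rightarrow> real \<Rightarrow> real" where
  "side_count u v t = (if u < t \<and> t \<le> v then 1 else 0) + (if u \<le> t \<and> t < v then 1 else 0)"

text \<open>The assertion is additive over adjacent intervals, so bisection reduces it to short
  intervals around a point, which contain at most one critical point. Finiteness of the critical set
  comes out of the same induction. The conclusion is a difference tending to zero because the
  factors \<open>cis (k n * f t)\<close> have in general no limit.\<close>

theorem stationary_phase:
  fixes f f1 f2 :: "real \<Rightarrow> real" and h h1 :: "real \<Rightarrow> complex" and k :: "nat \<Rightarrow> real"
  assumes f: "\<And>x. (f has_real_derivative f1 x) (at x)"
    and f1: "\<And>x. (f1 has_real_derivative f2 x) (at x)" and f2: "continuous_on UNIV f2"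
    and h: "\<And>x. (h has_vector_derivative h1 x) (at x)" and h1: "continuous_on UNIV h1"
    and ab: "a \<le> b" and nondeg: "\<And>x. f1 x = 0 \<Longrightarrow> f2 x \<noteq> 0"
    and k: "\<And>n. k n \<ge> 1" "filterlim k at_top sequentially"
  defines "Z \<equiv> {t. f1 t = 0}"
  shows "finite (Z \<inter> {a..b}) \<and>
    (\<lambda>n. sqrt (k n) *\<^sub>R integral {a..b} (\<lambda>x. h x * cis (k n * f x))
      - (\<Sum>t\<in>Z \<inter> {a..b}. of_real (side_count a b t) * (h t * fresnel_const (f2 t) * cis (k n * f t)))) \<longlonglongrightarrow> 0"
proof -
  have cf: "continuous_on S f" for S
    by (rule DERIV_continuous_on) (rule has_field_derivative_at_within[OF f])
  have cf1: "continuous_on S f1" for S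
    by (rule DERIV_continuous_on) (rule has_field_derivative_at_within[OF f1])
  have ch: "continuous_on S h" for S
    by (rule continuous_on_vector_derivative) (rule has_vector_derivative_at_within[OF h])
  have int: "(\<lambda>x. h x * cis (k n * f x)) integrable_on {u..v}" for n u v
    unfolding cis.ctr Complex_eq by (intro integrable_continuous_real continuous_intros ch cf)
  define c where "c n t = h t * fresnel_const (f2 t) * cis (k n * f t)" for n t
  define P where "P u v \<longleftrightarrow> finite (Z \<inter> {u..v}) \<and>
    (\<lambda>n. sqrt (k n) *\<^sub>R integral {u..v} (\<lambda>x. h x * cis (k n * f x))
      - (\<Sum>t\<in>Z \<inter> {u..v}. of_real (side_count u v t) * c n t)) \<longlonglongrightarrow> 0" for u v
  have glue: "P u w" if uv': "P u v" and vw': "P v w" and le: "u \<le> v" "v \<le> w" for u v w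
    unfolding P_def
  proof
    note uv = uv'[unfolded P_def] and vw = vw'[unfolded P_def]
    have Zun: "Z \<inter> {u..w} = (Z \<inter> {u..v}) \<union> (Z \<inter> {v..w})" using le by auto
    then show fin: "finite (Z \<inter> {u..w})" using uv vw by simp
    have "(\<Sum>t\<in>Z \<inter> {u..w}. of_real (side_count u w t) * c n t)
        = (\<Sum>t\<in>Z \<inter> {u..v}. of_real (side_count u v t) * c n t) + (\<Sum>t\<in>Z \<inter> {v..w}. of_real (side_count v w t) * c n t)" for n
    proof -
      have "(\<Sum>t\<in>Z \<inter> {u..v}. of_real (side_count u v t) * c n t) = (\<Sum>t\<in>Z \<inter> {u..w}. of_real (side_count u v t) * c n t)"
        by (intro sum.mono_neutral_left fin) (use le in \<open>auto simp: side_count_def\<close>)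
      moreover have "(\<Sum>t\<in>Z \<inter> {v..w}. of_real (side_count v w t) * c n t) = (\<Sum>t\<in>Z \<inter> {u..w}. of_real (side_count v w t) * c n t)"
        by (intro sum.mono_neutral_left fin) (use le in \<open>auto simp: side_count_def\<close>)
      moreover have "side_count u w t = side_count u v t + side_count v w t" if "t \<in> {u..w}" for t
        using that le by (auto simp: side_count_def)
      moreover have "(\<Sum>t\<in>Z \<inter> {u..w}. of_real (side_count u w t) * c n t)
         = (\<Sum>t\<in>Z \<inter> {u..w}. of_real (side_count u v t) * c n t + of_real (side_count v w t) * c n t)"
        by (rule sum.cong) (use calculation(3) in \<open>auto simp: distrib_right\<close>)
      ultimately show ?thesis by (simp only: sum.distrib)
    qed
    moreover have "integral {u..w} (\<lambda>x. h x * cis (k n * f x))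
        = integral {u..v} (\<lambda>x. h x * cis (k n * f x)) + integral {v..w} (\<lambda>x. h x * cis (k n * f x))" for n
      using Henstock_Kurzweil_Integration.integral_combine[OF le int, of n] by simp
    ultimately have eq: "sqrt (k n) *\<^sub>R integral {u..w} (\<lambda>x. h x * cis (k n * f x)) - (\<Sum>t\<in>Z \<inter> {u..w}. of_real (side_count u w t) * c n t)
      = (sqrt (k n) *\<^sub>R integral {u..v} (\<lambda>x. h x * cis (k n * f x)) - (\<Sum>t\<in>Z \<inter> {u..v}. of_real (side_count u v t) * c n t))
      + (sqrt (k n) *\<^sub>R integral {v..w} (\<lambda>x. h x * cis (k n * f x)) - (\<Sum>t\<in>Z \<inter> {v..w}. of_real (side_count v w t) * c n t))" for n
      by (simp add: scaleR_add_right)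
    show "(\<lambda>n. sqrt (k n) *\<^sub>R integral {u..w} (\<lambda>x. h x * cis (k n * f x))
      - (\<Sum>t\<in>Z \<inter> {u..w}. of_real (side_count u w t) * c n t)) \<longlonglongrightarrow> 0"
      using tendsto_add[OF conjunct2[OF uv] conjunct2[OF vw]]
      unfolding eq by (simp only: add_0)
  qed
  have nonstat: "P u v" if "\<And>x. x \<in> {u..v} \<Longrightarrow> f1 x \<noteq> 0" "u \<le> v" for u v
  proof -
    have "Z \<inter> {u..v} = {}" using that by (auto simp: Z_def)
    then show ?thesis using nonstationary_phase[OF f f1 f2 h h1 that(2) _ k] that(1) by (simp add: P_def)
  qed
  \<comment> \<open>The one-sided lemmas remove the critical value from the phase. Multiplying by
    the unimodular \<open>cis (k n * f t)\<close> puts it back and preserves convergence to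
    zero.\<close>
  have pull: "(\<lambda>n. sqrt (k n) *\<^sub>R integral {u..v} (\<lambda>x. h x * cis (k n * f x)) - c n t) \<longlonglongrightarrow> 0"
    if lim: "(\<lambda>n. sqrt (k n) *\<^sub>R integral {u..v} (\<lambda>x. h x * cis (k n * (f x - f t)))) \<longlonglongrightarrow> h t * fresnel_const (f2 t)" for u v t
  proof -
    have "(\<lambda>n. sqrt (k n) *\<^sub>R integral {u..v} (\<lambda>x. h x * cis (k n * (f x - f t))) - h t * fresnel_const (f2 t)) \<longlonglongrightarrow> 0"
      using lim by (rule LIM_zero)
    then have "(\<lambda>n. cis (k n * f t) * (sqrt (k n) *\<^sub>R integral {u..v} (\<lambda>x. h x * cis (k n * (f x - f t))) - h t * fresnel_const (f2 t))) \<longlonglongrightarrow> 0"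
      by (rule Lim_null_comparison[rotated, OF tendsto_norm_zero]) (simp add: norm_mult)
    moreover have "cis (k n * f t) * (sqrt (k n) *\<^sub>R integral {u..v} (\<lambda>x. h x * cis (k n * (f x - f t))) - h t * fresnel_const (f2 t))
       = sqrt (k n) *\<^sub>R integral {u..v} (\<lambda>x. h x * cis (k n * f x)) - c n t" for n
    proof -
      have "cis (k n * f t) * integral {u..v} (\<lambda>x. h x * cis (k n * (f x - f t)))
          = integral {u..v} (\<lambda>x. cis (k n * f t) * (h x * cis (k n * (f x - f t))))" by simp
      also have "\<dots> = integral {u..v} (\<lambda>x. h x * cis (k n * f x))"
        by (intro integral_cong) (simp add: cis_mult algebra_simps mult.left_commute[of "cis _"])
      finally show ?thesis by (simp add: c_def algebra_simps scaleR_conv_of_real)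
    qed
    ultimately show ?thesis by simp
  qed
  have right: "P u v" if "f1 u = 0" "u < v" "\<And>x. u < x \<Longrightarrow> x \<le> v \<Longrightarrow> f1 x \<noteq> 0" for u v
  proof -
    have "Z \<inter> {u..v} = {u}" using that by (auto simp: Z_def) (metis order_less_le)
    moreover have "side_count u v u = 1" using that by (simp add: side_count_def)
    ultimately show ?thesis
      using pull[OF half_stationary_phase[OF f f1 f2 h h1 that(2,1) nondeg[OF that(1)] that(3) k]] by (simp add: P_def)
  qed
  have left: "P u v" if "f1 v = 0" "u < v" "\<And>x. u \<le> x \<Longrightarrow> x < v \<Longrightarrow> f1 x \<noteq> 0" for u v
  proof -
    have "Z \<inter> {u..v} = {v}" using that by (auto simp: Z_def) (metis order_less_le)
    moreover have "side_count u v v = 1" using that by (simp add: side_count_def)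
    ultimately show ?thesis
      using pull[OF half_stationary_phase_left[OF f f1 f2 h h1 that(2,1) nondeg[OF that(1)] that(3) k]] by (simp add: P_def)
  qed
  \<comment> \<open>On a degenerate interval both terms of \<open>side_count\<close> are 0, in
    agreement with the vanishing integral. This covers a critical point that is an end point of a
    bisection interval.\<close>
  have point: "P u u" for u
    by (simp add: side_count_def P_def)
  have "P a b"
    using ab
  proof (induction rule: Bolzano[where P = P])
    case (trans u v w) then show ?case by (rule glue)
  next
    case (local x)
    show ?case
    proof (cases "f1 x = 0")
      case False
      have "isCont f1 x" using f1 by (rule DERIV_isCont)
      then obtain e where e: "e > 0" "\<And>y. \<bar>y - x\<bar> < e \<Longrightarrow> f1 y \<noteq> 0"
        using False continuous_at_avoid[of x f1 0] by (auto simp: dist_real_def abs_minus_commute)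
      show ?thesis
      proof (rule exI[of _ e], rule conjI[OF e(1)], intro allI impI)
        fix u v assume "u \<le> x \<and> x \<le> v \<and> v - u < e"
        then show "P u v" by (intro nonstat e(2)) auto
      qed
    next
      case True
      have "((\<lambda>y. f1 y / (y - x)) \<longlongrightarrow> f2 x) (at x)"
        using f1[of x] True by (simp add: has_field_derivative_iff)
      then have "\<forall>\<^sub>F y in at x. f1 y / (y - x) \<noteq> 0"
        using nondeg[OF True] tendsto_imp_eventually_ne by blast
      then obtain e where e: "e > 0" "\<And>y. y \<noteq> x \<Longrightarrow> \<bar>y - x\<bar> < e \<Longrightarrow> f1 y \<noteq> 0"
        unfolding eventually_at by (auto simp: dist_real_def)
      show ?thesis
      proof (rule exI[of _ e], rule conjI[OF e(1)], intro allI impI)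
        fix u v assume uv: "u \<le> x \<and> x \<le> v \<and> v - u < e"
        have "P u x"
        proof (cases "u = x")
          case eq: True
          show ?thesis unfolding eq by (rule point)
        next
          case False
          then show ?thesis by (intro left True e(2)) (use uv in auto)
        qed
        moreover have "P x v"
        proof (cases "v = x")
          case eq: True
          show ?thesis unfolding eq by (rule point)
        next
          case False
          then show ?thesis by (intro right True e(2)) (use uv in auto)
        qed
        ultimately show "P u v" by (rule glue) (use uv in auto)
      qed
    qed
  qed
  then show ?thesis by (simp only: P_def c_def)
qed

text \<open>Induction on the competing frequencies. Subtracting \<open>cis (s * \<nu> j)\<close>
  times the sum at \<open>\<sigma>\<close> from the sum at \<open>\<sigma> + s\<close> cancels the
  frequency \<open>\<nu> j\<close> and multiplies the other coefficients by constants. The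
  coefficients may vary with \<open>n\<close> without any bound.\<close>

lemma exponential_separation:
  fixes a0 :: "nat \<Rightarrow> complex" and a :: "nat \<Rightarrow> 'i \<Rightarrow> complex" and \<nu> :: "'i \<Rightarrow> real"
  assumes "finite I" "\<And>\<sigma>. (\<lambda>n. a0 n * cis (\<sigma> * \<nu>0) + (\<Sum>i\<in>I. a n i * cis (\<sigma> * \<nu> i))) \<longlonglongrightarrow> 0"
    and "\<And>i. i \<in> I \<Longrightarrow> \<nu> i \<noteq> \<nu>0"
  shows "a0 \<longlonglongrightarrow> 0"
  using assms
proof (induction I arbitrary: a a0 rule: finite_induct)
  case empty
  from empty(1)[of 0] show ?case by simp
next
  case (insert j I)
  \<comment> \<open>This shift makes \<open>cis (s * \<nu>0)\<close> and
    \<open>cis (s * \<nu> j)\<close> opposite to each other, so the factor gained by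
    \<open>a0\<close> is nonzero.\<close>
  define s where "s = pi / (\<nu>0 - \<nu> j)"
  have nej: "\<nu> j \<noteq> \<nu>0" using insert.prems(2)[of j] by simp
  have "s * (\<nu>0 - \<nu> j) = pi" using nej by (simp add: s_def)
  then have "s * \<nu>0 = s * \<nu> j + pi" by (simp add: algebra_simps)
  then have "cis (s * \<nu>0) = cis (s * \<nu> j) * cis pi" by (simp only: cis_mult)
  then have ne: "cis (s * \<nu>0) - cis (s * \<nu> j) \<noteq> 0" by (simp add: cis_neq_zero)
  define c where "c = cis (s * \<nu>0) - cis (s * \<nu> j)"
  have c: "c \<noteq> 0" using ne by (simp add: c_def)
  have "(\<lambda>n. a0 n * (cis (s * \<nu>0) - cis (s * \<nu> j))) \<longlonglongrightarrow> 0"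
  proof (rule insert.IH)
    show "\<nu> i \<noteq> \<nu>0" if "i \<in> I" for i using insert.prems(2)[of i] that by simp
    fix \<sigma>
    let ?S = "\<lambda>\<sigma> n. a0 n * cis (\<sigma> * \<nu>0) + (\<Sum>i\<in>insert j I. a n i * cis (\<sigma> * \<nu> i))"
    have "(\<lambda>n. ?S (\<sigma> + s) n - cis (s * \<nu> j) * ?S \<sigma> n) \<longlonglongrightarrow> 0 - cis (s * \<nu> j) * 0"
      by (intro tendsto_diff tendsto_mult_left insert.prems)
    moreover have "?S (\<sigma> + s) n - cis (s * \<nu> j) * ?S \<sigma> n
       = a0 n * (cis (s * \<nu>0) - cis (s * \<nu> j)) * cis (\<sigma> * \<nu>0)
         + (\<Sum>i\<in>I. a n i * (cis (s * \<nu> i) - cis (s * \<nu> j)) * cis (\<sigma> * \<nu> i))" for n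
    proof -
      have cm: "cis ((\<sigma> + s) * x) = cis (\<sigma> * x) * cis (s * x)" for x
        by (simp add: cis_mult distrib_right)
      have "(\<Sum>i\<in>I. a n i * (cis (s * \<nu> i) - cis (s * \<nu> j)) * cis (\<sigma> * \<nu> i))
        = (\<Sum>i\<in>I. a n i * cis ((\<sigma> + s) * \<nu> i)) - cis (s * \<nu> j) * (\<Sum>i\<in>I. a n i * cis (\<sigma> * \<nu> i))"
        unfolding sum_distrib_left sum_subtractf[symmetric] by (intro sum.cong refl) (simp only: cm, simp add: algebra_simps)
      then show ?thesis
        unfolding cm using insert(1,2) by (simp add: algebra_simps)
    qed
    ultimately show "(\<lambda>n. a0 n * (cis (s * \<nu>0) - cis (s * \<nu> j)) * cis (\<sigma> * \<nu>0)
         + (\<Sum>i\<in>I. a n i * (cis (s * \<nu> i) - cis (s * \<nu> j)) * cis (\<sigma> * \<nu> i))) \<longlonglongrightarrow> 0"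
      by (simp only: mult_zero_right diff_zero)
  qed
  then have "(\<lambda>n. a0 n * c) \<longlonglongrightarrow> 0" by (simp only: c_def)
  from tendsto_divide[OF this tendsto_const[of c]] c show ?case by simp
qed

section \<open>Critical points of the phase\<close>

text \<open>Geometrically, the boundary point of the ellipse with normal vector
  \<open>(cos t + p * cos s, sin t + p * sin s)\<close> lies on the line through the origin in
  direction \<open>t\<close>. The tangential components of the two wave vectors cancel at that
  point, which is Snell's law with index \<open>p = sqrt q\<close>.\<close>

definition snell :: "real \<Rightarrow> real \<Rightarrow> real \<Rightarrow> real \<Rightarrow> real \<Rightarrow> bool" where
  "snell a b p t s \<longleftrightarrow>
     (a\<^sup>2 - b\<^sup>2) * sin t * cos t = p * (b\<^sup>2 * sin s * cos t - a\<^sup>2 * cos s * sin t)"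

text \<open>Up to sign the expression is the numerator of the second derivative of \<Phi> in
  \<open>t\<close> at a critical point. If it vanished as well, two linear equations would determine
  \<open>p * cos s\<close> and \<open>p * sin s\<close>, and the identity between sine and cosine
  would give \<open>p * b^2 \<le> a^2 - b^2\<close>.\<close>

lemma snell_nondegenerate:
  assumes "0 < b" "b < a" "0 < p" "a\<^sup>2 - b\<^sup>2 < p * b\<^sup>2" and crit: "snell a b p t s"
  shows "(a\<^sup>2 - b\<^sup>2) * ((cos t)\<^sup>2 - (sin t)\<^sup>2) + p * (a\<^sup>2 * cos t * cos s + b\<^sup>2 * sin t * sin s) \<noteq> 0"
proof
  assume 0: "(a\<^sup>2 - b\<^sup>2) * ((cos t)\<^sup>2 - (sin t)\<^sup>2) + p * (a\<^sup>2 * cos t * cos s + b\<^sup>2 * sin t * sin s) = 0"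
  define D where "D = a\<^sup>2 - b\<^sup>2"
  define c z C S where "c = cos t" and "z = sin t" and "C = cos s" and "S = sin s"
  have u: "c\<^sup>2 + z\<^sup>2 = 1" "C\<^sup>2 + S\<^sup>2 = 1" by (simp_all add: c_def z_def C_def S_def)
  have e1: "D * (c\<^sup>2 - z\<^sup>2) + p * (a\<^sup>2 * c * C + b\<^sup>2 * z * S) = 0"
    using 0 by (simp add: D_def c_def z_def C_def S_def)
  have e2: "D * z * c = p * (b\<^sup>2 * S * c - a\<^sup>2 * C * z)"
    using crit by (simp add: snell_def D_def c_def z_def C_def S_def)
  \<comment> \<open>The wave vectors \<open>(p * C, p * S)\<close> at which a critical point
    degenerates trace a stretched astroid; the eccentricity condition keeps it strictly inside the
    circle of radius \<open>p\<close>.\<close>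
  have X: "a\<^sup>2 * (p * C) = - D * c^3"
  proof -
    have "a\<^sup>2 * (p * C) = a\<^sup>2 * (p * C) * (c\<^sup>2 + z\<^sup>2)" using u by simp
    also have "\<dots> = c * (D * (c\<^sup>2 - z\<^sup>2) + p * (a\<^sup>2 * c * C + b\<^sup>2 * z * S)) - D * c * (c\<^sup>2 - z\<^sup>2)
        - z * (p * (b\<^sup>2 * S * c - a\<^sup>2 * C * z))" by algebra
    also have "\<dots> = - D * c^3" unfolding e1 e2[symmetric] by algebra
    finally show ?thesis .
  qed
  have Y: "b\<^sup>2 * (p * S) = D * z^3"
  proof -
    have "b\<^sup>2 * (p * S) = b\<^sup>2 * (p * S) * (c\<^sup>2 + z\<^sup>2)" using u by simp
    also have "\<dots> = z * (D * (c\<^sup>2 - z\<^sup>2) + p * (a\<^sup>2 * c * C + b\<^sup>2 * z * S)) - D * z * (c\<^sup>2 - z\<^sup>2)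
        + c * (p * (b\<^sup>2 * S * c - a\<^sup>2 * C * z))" by algebra
    also have "\<dots> = D * z^3" unfolding e1 e2[symmetric] by algebra
    finally show ?thesis .
  qed
  have D: "D > 0" using assms by (simp add: D_def power_strict_mono)
  have "(p * b\<^sup>2)\<^sup>2 = (b\<^sup>2 * (p * C))\<^sup>2 + (b\<^sup>2 * (p * S))\<^sup>2" using u by algebra
  also have "(b\<^sup>2 * (p * C))\<^sup>2 \<le> (a\<^sup>2 * (p * C))\<^sup>2"
    unfolding power_mult_distrib[of "a\<^sup>2"] power_mult_distrib[of "b\<^sup>2"]
    using assms by (intro mult_right_mono power_mono) auto
  also have "(a\<^sup>2 * (p * C))\<^sup>2 + (b\<^sup>2 * (p * S))\<^sup>2 = D\<^sup>2 * (c^6 + z^6)"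
    unfolding X Y by algebra
  also have "\<dots> \<le> D\<^sup>2 * 1"
  proof (intro mult_left_mono)
    have "c^6 + z^6 = (c\<^sup>2 + z\<^sup>2)^3 - 3 * c\<^sup>2 * z\<^sup>2 * (c\<^sup>2 + z\<^sup>2)" by algebra
    also have "\<dots> = 1 - 3 * (c * z)\<^sup>2" unfolding u by (simp add: power_mult_distrib)
    also have "\<dots> \<le> 1" by simp
    finally show "c^6 + z^6 \<le> 1" .
  qed simp
  finally have "(p * b\<^sup>2)\<^sup>2 \<le> D\<^sup>2" by simp
  then have "p * b\<^sup>2 \<le> D" using D by (rule power2_le_imp_le[OF _ less_imp_le])
  then show False using assms by (simp add: D_def)
qed

text \<open>For fixed \<open>t\<close> the equation is linear in \<open>(cos s, sin s)\<close>. It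
  describes a line whose squared distance from the origin is \<open>w^2 / R\<close>, and the
  eccentricity condition makes this at most 1, so the line meets the unit circle.\<close>

lemma snell_exists:
  assumes "0 < b" "b < a" "0 < p" "a\<^sup>2 - b\<^sup>2 < p * b\<^sup>2"
  shows "\<exists>s\<in>{0..2*pi}. snell a b p t s"
proof -
  define c z where "c = cos t" and "z = sin t"
  have u: "c\<^sup>2 + z\<^sup>2 = 1" by (simp add: c_def z_def)
  define w where "w = (a\<^sup>2 - b\<^sup>2) * z * c / p"
  define R where "R = (b\<^sup>2 * c)\<^sup>2 + (a\<^sup>2 * z)\<^sup>2"
  have "R > 0"
  proof -
    have "R \<ge> 0" by (simp add: R_def)
    moreover have "R \<noteq> 0" using u assms by (auto simp: R_def add_nonneg_eq_0_iff)
    ultimately show ?thesis by simp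
  qed
  have "((a\<^sup>2 - b\<^sup>2) / p)\<^sup>2 \<le> (b\<^sup>2)\<^sup>2"
    using assms by (intro power_mono) (auto simp: divide_simps mult.commute power_mono)
  moreover have "(z * c)\<^sup>2 \<le> c\<^sup>2"
    unfolding power_mult_distrib using u by (intro mult_left_le_one_le) (auto simp: z_def abs_square_le_1)
  ultimately have "((a\<^sup>2 - b\<^sup>2) / p)\<^sup>2 * (z * c)\<^sup>2 \<le> (b\<^sup>2)\<^sup>2 * c\<^sup>2"
    by (intro mult_mono) auto
  moreover have "w\<^sup>2 = ((a\<^sup>2 - b\<^sup>2) / p)\<^sup>2 * (z * c)\<^sup>2" by (simp add: w_def power_mult_distrib power_divide)
  ultimately have "w\<^sup>2 \<le> (b\<^sup>2 * c)\<^sup>2" by (simp add: power_mult_distrib)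
  then have wR: "w\<^sup>2 \<le> R" by (simp add: R_def add_increasing2)
  define r where "r = sqrt ((1 - w\<^sup>2 / R) / R)"
  have r: "r\<^sup>2 * R = 1 - w\<^sup>2 / R"
  proof -
    have "w\<^sup>2 / R \<le> 1" using wR \<open>R > 0\<close> by simp
    then have "r\<^sup>2 = (1 - w\<^sup>2 / R) / R" unfolding r_def using \<open>R > 0\<close> by (intro real_sqrt_pow2) auto
    then show ?thesis using \<open>R > 0\<close> by simp
  qed
  \<comment> \<open>The intersection with the unit circle: foot point of the perpendicular from the
    origin, plus \<open>r\<close> times a direction vector of the line.\<close>
  define C S where "C = - (w / R) * (a\<^sup>2 * z) + r * (b\<^sup>2 * c)" and "S = (w / R) * (b\<^sup>2 * c) + r * (a\<^sup>2 * z)"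
  have "C\<^sup>2 + S\<^sup>2 = ((w / R)\<^sup>2 + r\<^sup>2) * R" unfolding C_def S_def R_def by algebra
  also have "\<dots> = 1" using r \<open>R > 0\<close> by (simp add: distrib_right power2_eq_square)
  finally obtain s where s: "0 \<le> s" "s \<le> 2 * pi" "C = cos s" "S = sin s"
    using sincos_total_2pi_le by metis
  have "b\<^sup>2 * c * S - a\<^sup>2 * z * C = (w / R) * R" unfolding C_def S_def R_def by algebra
  then have "b\<^sup>2 * c * S - a\<^sup>2 * z * C = w" using \<open>R > 0\<close> by simp
  then have "p * (b\<^sup>2 * S * c - a\<^sup>2 * C * z) = (a\<^sup>2 - b\<^sup>2) * z * c"
    using assms by (simp add: w_def field_simps)
  then show ?thesis
    using s by (intro bexI[of _ s]) (auto simp: snell_def c_def z_def mult_ac)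
qed

text \<open>Double angle coordinates on the ellipse: the relation below is the square of the
  critical point equation.\<close>

lemma snell_double_angle:
  fixes a b p c z C S :: real
  assumes ab: "0 < b" "0 < a" and u: "c\<^sup>2 + z\<^sup>2 = 1" "C\<^sup>2 + S\<^sup>2 = 1"
    and crit: "(a\<^sup>2 - b\<^sup>2) * z * c = p * (b\<^sup>2 * S * c - a\<^sup>2 * C * z)"
  defines "N \<equiv> b\<^sup>2 * c\<^sup>2 + a\<^sup>2 * z\<^sup>2" and "M \<equiv> b\<^sup>2 * C\<^sup>2 + a\<^sup>2 * S\<^sup>2"
    and "m \<equiv> (a\<^sup>2 + b\<^sup>2) / 2" and "d \<equiv> (a\<^sup>2 - b\<^sup>2) / 2"
  defines "x \<equiv> (b\<^sup>2 * c\<^sup>2 - a\<^sup>2 * z\<^sup>2) / N" and "y \<equiv> 2 * a * b * z * c / N"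
    and "g \<equiv> (b\<^sup>2 * C\<^sup>2 - a\<^sup>2 * S\<^sup>2) / M" and "h \<equiv> 2 * a * b * S * C / M"
  shows "N > 0" "M > 0" "x\<^sup>2 + y\<^sup>2 = 1" "g\<^sup>2 + h\<^sup>2 = 1"
    "(z * C - c * S)\<^sup>2 / N = M * (1 - (x * g + y * h)) / (2 * a\<^sup>2 * b\<^sup>2)"
    "4 * d\<^sup>2 * y\<^sup>2 * (m + d * g) = p\<^sup>2 * (m + d * x) *
       ((m - d)\<^sup>2 * (1 - g) * (1 + x) + (m + d)\<^sup>2 * (1 + g) * (1 - x) - 2 * (m\<^sup>2 - d\<^sup>2) * h * y)"
    "1 + x = 2 * b\<^sup>2 * c\<^sup>2 / N" "1 - x = 2 * a\<^sup>2 * z\<^sup>2 / N"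
proof -
  have pos: "b\<^sup>2 * c\<^sup>2 + a\<^sup>2 * z\<^sup>2 > 0" if "c\<^sup>2 + z\<^sup>2 = 1" for c z :: real
  proof -
    have "b\<^sup>2 * c\<^sup>2 + a\<^sup>2 * z\<^sup>2 \<ge> 0" by simp
    moreover have "b\<^sup>2 * c\<^sup>2 + a\<^sup>2 * z\<^sup>2 \<noteq> 0" using that ab by (auto simp: add_nonneg_eq_0_iff)
    ultimately show ?thesis by linarith
  qed
  show N: "N > 0" and M: "M > 0" unfolding N_def M_def using pos u by auto
  have x1: "x * N = b\<^sup>2 * c\<^sup>2 - a\<^sup>2 * z\<^sup>2" and y1: "y * N = 2 * a * b * z * c"
    and g1: "g * M = b\<^sup>2 * C\<^sup>2 - a\<^sup>2 * S\<^sup>2" and h1: "h * M = 2 * a * b * S * C"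
    using N M by (simp_all add: x_def y_def g_def h_def)
  have Nn: "N \<noteq> 0" "M \<noteq> 0" using N M by auto
  have "(x\<^sup>2 + y\<^sup>2) * N\<^sup>2 = 1 * N\<^sup>2"
    using x1 y1 N_def by algebra
  then show "x\<^sup>2 + y\<^sup>2 = 1" using Nn by simp
  have "(g\<^sup>2 + h\<^sup>2) * M\<^sup>2 = 1 * M\<^sup>2"
    using g1 h1 M_def by algebra
  then show "g\<^sup>2 + h\<^sup>2 = 1" using Nn by simp
  \<comment> \<open>The point \<open>(x, y)\<close> has twice the polar angle of
    \<open>(b * c, a * z)\<close>, and \<open>(g, h)\<close> twice that of
    \<open>(b * C, a * S)\<close>. The claim is the half angle formula for the squared sine of the
    difference of these angles.\<close>
  have "2 * a\<^sup>2 * b\<^sup>2 * (z * C - c * S)\<^sup>2 = (M * N - (x * N) * (g * M) - (y * N) * (h * M))"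
    unfolding x1 y1 g1 h1 unfolding N_def M_def by algebra
  also have "\<dots> = M * (1 - (x * g + y * h)) * N" by algebra
  finally show "(z * C - c * S)\<^sup>2 / N = M * (1 - (x * g + y * h)) / (2 * a\<^sup>2 * b\<^sup>2)"
    using N ab by (simp add: field_simps)
  have px: "(1 + x) * N = 2 * b\<^sup>2 * c\<^sup>2" and mx: "(1 - x) * N = 2 * a\<^sup>2 * z\<^sup>2"
    using x1 N_def by algebra+
  have pg: "(1 + g) * M = 2 * b\<^sup>2 * C\<^sup>2" and mg: "(1 - g) * M = 2 * a\<^sup>2 * S\<^sup>2"
    using g1 M_def by algebra+
  show "1 + x = 2 * b\<^sup>2 * c\<^sup>2 / N" "1 - x = 2 * a\<^sup>2 * z\<^sup>2 / N"
    using px mx N by (simp_all add: field_simps)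
  \<comment> \<open>In the new coordinates \<open>1 / N\<close> is affine in \<open>x\<close> and
    \<open>1 / M\<close> is affine in \<open>g\<close>, so the squared critical equation becomes
    polynomial.\<close>
  have md: "m - d = b\<^sup>2" "m + d = a\<^sup>2" by (simp_all add: m_def d_def field_simps)
  have dx: "(m + d * x) * N = a\<^sup>2 * b\<^sup>2"
  proof -
    have "2 * ((m + d * x) * N) = a\<^sup>2 * ((1 + x) * N) + b\<^sup>2 * ((1 - x) * N)"
      unfolding m_def d_def by (simp add: field_simps)
    also have "\<dots> = 2 * (a\<^sup>2 * b\<^sup>2 * (c\<^sup>2 + z\<^sup>2))" unfolding px mx by algebra
    finally show ?thesis unfolding u by simp
  qed
  have dg: "(m + d * g) * M = a\<^sup>2 * b\<^sup>2"
  proof -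
    have "2 * ((m + d * g) * M) = a\<^sup>2 * ((1 + g) * M) + b\<^sup>2 * ((1 - g) * M)"
      unfolding m_def d_def by (simp add: field_simps)
    also have "\<dots> = 2 * (a\<^sup>2 * b\<^sup>2 * (C\<^sup>2 + S\<^sup>2))" unfolding pg mg by algebra
    finally show ?thesis unfolding u by simp
  qed
  have "(4 * d\<^sup>2 * y\<^sup>2 * (m + d * g)) * (N\<^sup>2 * M) = (2 * d)\<^sup>2 * (y * N)\<^sup>2 * ((m + d * g) * M)" by algebra
  also have "\<dots> = 4 * a\<^sup>2 * b\<^sup>2 * (a\<^sup>2 * b\<^sup>2) * ((a\<^sup>2 - b\<^sup>2) * z * c)\<^sup>2"
  proof -
    have "2 * d = a\<^sup>2 - b\<^sup>2" by (simp add: d_def)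
    then show ?thesis unfolding y1 dg by algebra
  qed
  also have "\<dots> = p\<^sup>2 * (a\<^sup>2 * b\<^sup>2) * (4 * a\<^sup>2 * b\<^sup>2 * (b\<^sup>2 * S * c - a\<^sup>2 * C * z)\<^sup>2)"
    unfolding crit by algebra
  also have "\<dots> = p\<^sup>2 * (a\<^sup>2 * b\<^sup>2) * ((b\<^sup>2)\<^sup>2 * (2 * a\<^sup>2 * S\<^sup>2) * (2 * b\<^sup>2 * c\<^sup>2) + (a\<^sup>2)\<^sup>2 * (2 * b\<^sup>2 * C\<^sup>2) * (2 * a\<^sup>2 * z\<^sup>2)
       - 2 * (a\<^sup>2 * b\<^sup>2) * (2 * a * b * S * C) * (2 * a * b * z * c))" by algebra
  also have "\<dots> = p\<^sup>2 * ((m + d * x) * N) * ((m - d)\<^sup>2 * ((1 - g) * M) * ((1 + x) * N) + (m + d)\<^sup>2 * ((1 + g) * M) * ((1 - x) * N)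
       - 2 * ((m + d) * (m - d)) * (h * M) * (y * N))"
    unfolding dx md pg mg px mx h1 y1 ..
  also have "\<dots> = (p\<^sup>2 * (m + d * x) *
       ((m - d)\<^sup>2 * (1 - g) * (1 + x) + (m + d)\<^sup>2 * (1 + g) * (1 - x) - 2 * (m\<^sup>2 - d\<^sup>2) * h * y)) * (N\<^sup>2 * M)"
    by algebra
  finally show "4 * d\<^sup>2 * y\<^sup>2 * (m + d * g) = p\<^sup>2 * (m + d * x) *
       ((m - d)\<^sup>2 * (1 - g) * (1 + x) + (m + d)\<^sup>2 * (1 + g) * (1 - x) - 2 * (m\<^sup>2 - d\<^sup>2) * h * y)"
    using Nn by simp
qed

text \<open>Two critical points with the same impact parameter are reflections of each other in these
  coordinates.  The odd part of the relation is linear in the common cosine \<open>u\<close>, so \<open>u\<close> can be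
  eliminated from the even part, which leaves a polynomial equation for \<open>g\<close> alone.\<close>

definition elim_den :: "real \<Rightarrow> real \<Rightarrow> real \<Rightarrow> real poly" where
  "elim_den m d p = [: - p\<^sup>2 * (m\<^sup>2 - d\<^sup>2), 4 * d * m * (1 - p\<^sup>2), 4 * d\<^sup>2 * (1 - p\<^sup>2) :]"

text \<open>Write the even part as \<open>E0 + u * E1 + u^2 * E2\<close> with polynomials in
  \<open>g\<close>, and the odd part as \<open>u * Q = \<kappa>\<close>, where \<open>Q\<close> is
  \<open>elim_den\<close> and \<open>\<kappa> = p^2 * (m^2 - d^2)\<close>. The definition is
  \<open>Q^2 * E0 + \<kappa> * Q * E1 + \<kappa>^2 * E2\<close>, that is, \<open>Q^2\<close> times
  the even part. Clearing the denominator avoids a case distinction on the zeros of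
  \<open>Q\<close>.\<close>

definition elim_poly :: "real \<Rightarrow> real \<Rightarrow> real \<Rightarrow> real poly" where
  "elim_poly m d p =
     [: p\<^sup>2 * m * (d\<^sup>2 - m\<^sup>2), 2 * p\<^sup>2 * d * (d\<^sup>2 - m\<^sup>2), 2 * d\<^sup>2 * m * (1 - p\<^sup>2), 2 * d^3 * (1 - p\<^sup>2) :]
       * elim_den m d p ^ 2
     + smult (p\<^sup>2 * (m\<^sup>2 - d\<^sup>2)) ([: p\<^sup>2 * m * (m\<^sup>2 - d\<^sup>2), p\<^sup>2 * d * (m\<^sup>2 - d\<^sup>2), 0 :] * elim_den m d p)
     + smult ((p\<^sup>2 * (m\<^sup>2 - d\<^sup>2))\<^sup>2) [: 2 * d\<^sup>2 * m * (1 - p\<^sup>2), p\<^sup>2 * d * (m\<^sup>2 - d\<^sup>2) + 2 * d^3 * (1 - p\<^sup>2),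
          4 * p\<^sup>2 * d\<^sup>2 * m - 4 * d\<^sup>2 * m, 4 * p\<^sup>2 * d^3 - 4 * d^3 :]"

text \<open>Only the first summand reaches degree 7, with leading coefficient
  \<open>32 * d^7 * (1 - p^2)^3\<close>; the other two have degree at most 3. Both an actual ellipse
  and a contrast in the medium are thus required.\<close>

lemma elim_poly_nonzero:
  assumes "d \<noteq> 0" "p\<^sup>2 \<noteq> 1"
  shows "elim_poly m d p \<noteq> 0"
proof -
  let ?E0 = "[: p\<^sup>2 * m * (d\<^sup>2 - m\<^sup>2), 2 * p\<^sup>2 * d * (d\<^sup>2 - m\<^sup>2), 2 * d\<^sup>2 * m * (1 - p\<^sup>2), 2 * d^3 * (1 - p\<^sup>2) :]"
  have "degree (elim_den m d p) = 2" using assms by (simp add: elim_den_def)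
  moreover have "degree ?E0 = 3" using assms by simp
  ultimately have "degree (?E0 * elim_den m d p ^ 2) = 7"
    using assms by (subst degree_mult_eq) (auto simp: degree_power_eq elim_den_def)
  moreover have "degree (smult (p\<^sup>2 * (m\<^sup>2 - d\<^sup>2)) ([: p\<^sup>2 * m * (m\<^sup>2 - d\<^sup>2), p\<^sup>2 * d * (m\<^sup>2 - d\<^sup>2), 0 :] * elim_den m d p)) < 7"
    by (rule le_less_trans[OF degree_smult_le], rule le_less_trans[OF degree_mult_le]) (simp add: elim_den_def)
  moreover have "degree (smult ((p\<^sup>2 * (m\<^sup>2 - d\<^sup>2))\<^sup>2) [: 2 * d\<^sup>2 * m * (1 - p\<^sup>2), p\<^sup>2 * d * (m\<^sup>2 - d\<^sup>2) + 2 * d^3 * (1 - p\<^sup>2),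
          4 * p\<^sup>2 * d\<^sup>2 * m - 4 * d\<^sup>2 * m, 4 * p\<^sup>2 * d^3 - 4 * d^3 :]) < 7"
    by (rule le_less_trans[OF degree_smult_le]) simp
  ultimately have "degree (elim_poly m d p) = 7"
    unfolding elim_poly_def by (simp add: degree_add_eq_left)
  then show ?thesis by auto
qed

text \<open>With \<open>u\<close> and \<open>v\<close> the cosine and sine of an angle, the two
  points arise from \<open>(g, h)\<close> by rotation through this angle and its negative, so one
  relation turns into the other by \<open>v \<mapsto> - v\<close>. The squares of \<open>h\<close>
  and \<open>v\<close> are polynomials in \<open>g\<close> and \<open>u\<close>, hence only the
  product \<open>h * v\<close> remains, and the relations can be added and subtracted to isolate
  even and odd part.\<close>

lemma elim_poly_root:
  fixes m d p g h u v :: real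
  assumes gh: "g\<^sup>2 + h\<^sup>2 = 1" and uv: "u\<^sup>2 + v\<^sup>2 = 1" and nz: "h \<noteq> 0" "v \<noteq> 0" "d \<noteq> 0"
  assumes plus: "\<And>x y. x = u * g - v * h \<Longrightarrow> y = u * h + v * g \<Longrightarrow>
       4 * d\<^sup>2 * y\<^sup>2 * (m + d * g) = p\<^sup>2 * (m + d * x) *
       ((m - d)\<^sup>2 * (1 - g) * (1 + x) + (m + d)\<^sup>2 * (1 + g) * (1 - x) - 2 * (m\<^sup>2 - d\<^sup>2) * h * y)"
    and minus: "\<And>x y. x = u * g + v * h \<Longrightarrow> y = u * h - v * g \<Longrightarrow>
       4 * d\<^sup>2 * y\<^sup>2 * (m + d * g) = p\<^sup>2 * (m + d * x) *
       ((m - d)\<^sup>2 * (1 - g) * (1 + x) + (m + d)\<^sup>2 * (1 + g) * (1 - x) - 2 * (m\<^sup>2 - d\<^sup>2) * h * y)"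
  shows "poly (elim_poly m d p) g = 0"
proof -
  \<comment> \<open>The bracket of the relation equals \<open>2 * W + Wo * (h * v)\<close>: its even
    part is \<open>2 * W\<close> and its odd part has the coefficient \<open>Wo\<close>.\<close>
  define W where "W = m\<^sup>2 * (1 - u) + d\<^sup>2 * (1 + u - 2 * u * g\<^sup>2) + 2 * m * d * g * (1 - u)"
  define Wo where "Wo = 4 * d * (m + d * g)"
  have hh: "h\<^sup>2 = 1 - g\<^sup>2" and vv: "v\<^sup>2 = 1 - u\<^sup>2" using gh uv by auto
  have br: "(m - d)\<^sup>2 * (1 - g) * (1 + (u * g - v * h)) + (m + d)\<^sup>2 * (1 + g) * (1 - (u * g - v * h))
      - 2 * (m\<^sup>2 - d\<^sup>2) * h * (u * h + v * g) = 2 * W + Wo * (h * v)" if "v\<^sup>2 = 1 - u\<^sup>2" for v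
    unfolding W_def Wo_def using hh by algebra
  have y2: "(u * h + v * g)\<^sup>2 = u\<^sup>2 * (1 - g\<^sup>2) + (1 - u\<^sup>2) * g\<^sup>2 + 2 * u * g * (h * v)" if "v\<^sup>2 = 1 - u\<^sup>2" for v
    using hh that by algebra
  have p1: "4 * d\<^sup>2 * (u\<^sup>2 * (1 - g\<^sup>2) + (1 - u\<^sup>2) * g\<^sup>2 + 2 * u * g * (h * v)) * (m + d * g)
      = p\<^sup>2 * (m + d * u * g - d * (h * v)) * (2 * W + Wo * (h * v))"
    using plus[OF refl refl] unfolding br[OF vv] y2[OF vv] by (simp add: algebra_simps)
  have p2: "4 * d\<^sup>2 * (u\<^sup>2 * (1 - g\<^sup>2) + (1 - u\<^sup>2) * g\<^sup>2 - 2 * u * g * (h * v)) * (m + d * g)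
      = p\<^sup>2 * (m + d * u * g + d * (h * v)) * (2 * W - Wo * (h * v))"
  proof -
    have m': "4 * d\<^sup>2 * (u * h + (- v) * g)\<^sup>2 * (m + d * g) = p\<^sup>2 * (m + d * (u * g - (- v) * h)) *
       ((m - d)\<^sup>2 * (1 - g) * (1 + (u * g - (- v) * h)) + (m + d)\<^sup>2 * (1 + g) * (1 - (u * g - (- v) * h))
        - 2 * (m\<^sup>2 - d\<^sup>2) * h * (u * h + (- v) * g))"
      by (rule minus) simp_all
    have v2: "(- v)\<^sup>2 = 1 - u\<^sup>2" using vv by simp
    show ?thesis using m' unfolding br[OF v2] y2[OF v2] by (simp add: algebra_simps)
  qed
  \<comment> \<open>The difference of the two relations carries the nonzero factor
    \<open>2 * d * h * v\<close>. What is left is linear in \<open>u\<close>, because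
    \<open>W\<close> is.\<close>
  have "(2 * d * (h * v)) * (4 * d * u * g * (m + d * g)) = (2 * d * (h * v)) * (p\<^sup>2 * (2 * (m + d * u * g) * (m + d * g) - W))"
    using p1 p2 unfolding Wo_def by algebra
  then have odd: "4 * d * u * g * (m + d * g) = p\<^sup>2 * (2 * (m + d * u * g) * (m + d * g) - W)"
    using nz by (simp only: mult_cancel_left) auto
  have hv: "(h * v)\<^sup>2 = (1 - g\<^sup>2) * (1 - u\<^sup>2)" using hh vv by (simp add: power_mult_distrib)
  have even: "2 * d\<^sup>2 * (u\<^sup>2 * (1 - g\<^sup>2) + (1 - u\<^sup>2) * g\<^sup>2) * (m + d * g)
      - p\<^sup>2 * ((m + d * u * g) * W - 2 * d\<^sup>2 * ((1 - g\<^sup>2) * (1 - u\<^sup>2)) * (m + d * g)) = 0"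
    unfolding hv[symmetric] using p1 p2 unfolding Wo_def by algebra
  define Q where "Q = poly (elim_den m d p) g"
  have Q: "Q = 4 * d * g * (m + d * g) * (1 - p\<^sup>2) - p\<^sup>2 * (m\<^sup>2 - d\<^sup>2)"
    unfolding Q_def elim_den_def by (simp add: power2_eq_square algebra_simps)
  have Qu: "u * Q = p\<^sup>2 * (m\<^sup>2 - d\<^sup>2)"
    using odd unfolding Q W_def by algebra
  have R: "poly (elim_poly m d p) g =
      (p\<^sup>2 * m * (d\<^sup>2 - m\<^sup>2) + g * (2 * p\<^sup>2 * d * (d\<^sup>2 - m\<^sup>2)) + g\<^sup>2 * (2 * d\<^sup>2 * m * (1 - p\<^sup>2)) + g^3 * (2 * d^3 * (1 - p\<^sup>2))) * Q\<^sup>2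
      + (u * Q) * ((p\<^sup>2 * m * (m\<^sup>2 - d\<^sup>2) + g * (p\<^sup>2 * d * (m\<^sup>2 - d\<^sup>2))) * Q)
      + (u * Q)\<^sup>2 * (2 * d\<^sup>2 * m * (1 - p\<^sup>2) + g * (p\<^sup>2 * d * (m\<^sup>2 - d\<^sup>2) + 2 * d^3 * (1 - p\<^sup>2))
          + g\<^sup>2 * (4 * p\<^sup>2 * d\<^sup>2 * m - 4 * d\<^sup>2 * m) + g^3 * (4 * p\<^sup>2 * d^3 - 4 * d^3))"
    unfolding Qu elim_poly_def by (simp add: Q_def[symmetric] power2_eq_square power3_eq_cube algebra_simps)
  have "poly (elim_poly m d p) g = Q\<^sup>2 * (2 * d\<^sup>2 * (u\<^sup>2 * (1 - g\<^sup>2) + (1 - u\<^sup>2) * g\<^sup>2) * (m + d * g)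
      - p\<^sup>2 * ((m + d * u * g) * W - 2 * d\<^sup>2 * ((1 - g\<^sup>2) * (1 - u\<^sup>2)) * (m + d * g)))"
    unfolding R W_def by algebra
  then show ?thesis unfolding even by simp
qed

text \<open>The quotients are squared impact parameters up to a common constant. In double angle
  coordinates equality means that both points have the same cosine \<open>u\<close> relative to
  \<open>(g, h)\<close>, so they coincide or are mirror images. Mirror images make \<open>g\<close>
  a root of \<open>elim_poly\<close>, which leaves finitely many values of
  \<open>cos s\<close>.\<close>

lemma snell_separation:
  assumes ab: "0 < b" "b < a" and p: "0 < p" "p \<noteq> 1"
  defines "N \<equiv> \<lambda>t. b\<^sup>2 * (cos t)\<^sup>2 + a\<^sup>2 * (sin t)\<^sup>2"
  shows "\<exists>F. finite F \<and> (\<forall>s. cos s \<notin> F \<longrightarrow>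
     (\<forall>t. snell a b p t s \<longrightarrow> sin t * cos s - cos t * sin s \<noteq> 0) \<and>
     (\<forall>t t'. snell a b p t s \<longrightarrow> snell a b p t' s \<longrightarrow> (cos t, sin t) \<noteq> (cos t', sin t') \<longrightarrow>
        (sin t * cos s - cos t * sin s)\<^sup>2 / N t \<noteq> (sin t' * cos s - cos t' * sin s)\<^sup>2 / N t'))"
proof -
  define m d where "m = (a\<^sup>2 + b\<^sup>2) / 2" and "d = (a\<^sup>2 - b\<^sup>2) / 2"
  have D: "a\<^sup>2 - b\<^sup>2 > 0" using ab by (simp add: power_strict_mono)
  then have d: "d \<noteq> 0" by (simp add: d_def)
  have p2: "p\<^sup>2 \<noteq> 1" using p by (auto simp: power2_eq_1_iff)
  define G where "G = {g. poly (elim_poly m d p) g = 0}"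
  have finG: "finite G" unfolding G_def by (rule poly_roots_finite[OF elim_poly_nonzero[OF d p2]])
  \<comment> \<open>The map recovers \<open>(cos s)^2\<close> from \<open>g\<close>, inverting
    \<open>g = (b^2 * C^2 - a^2 * S^2) / M\<close>. The values 0, 1 and -1 are added to
    \<open>F\<close> to exclude the axis directions, where \<open>h = 0\<close> and the mirror image
    argument breaks down.\<close>
  define H where "H = (\<lambda>g. a\<^sup>2 * (1 + g) / (a\<^sup>2 * (1 + g) + b\<^sup>2 * (1 - g))) ` G"
  define F where "F = {0, 1, -1} \<union> (sqrt ` H) \<union> ((\<lambda>x. - sqrt x) ` H)"
  have "finite F" using finG by (simp add: F_def H_def)
  moreover have "(\<forall>t. snell a b p t s \<longrightarrow> sin t * cos s - cos t * sin s \<noteq> 0) \<and>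
     (\<forall>t t'. snell a b p t s \<longrightarrow> snell a b p t' s \<longrightarrow> (cos t, sin t) \<noteq> (cos t', sin t') \<longrightarrow>
        (sin t * cos s - cos t * sin s)\<^sup>2 / N t \<noteq> (sin t' * cos s - cos t' * sin s)\<^sup>2 / N t')"
    if sF: "cos s \<notin> F" for s
  proof -
    define C S where "C = cos s" and "S = sin s"
    have U: "C\<^sup>2 + S\<^sup>2 = 1" by (simp add: C_def S_def)
    have C0: "C \<noteq> 0" using sF by (auto simp: F_def C_def)
    have S0: "S \<noteq> 0"
    proof
      assume "S = 0" then have "C\<^sup>2 = 1" using U by simp
      then show False using sF by (auto simp: F_def C_def power2_eq_1_iff)
    qed
    define M g h where "M = b\<^sup>2 * C\<^sup>2 + a\<^sup>2 * S\<^sup>2" and "g = (b\<^sup>2 * C\<^sup>2 - a\<^sup>2 * S\<^sup>2) / M" and "h = 2 * a * b * S * C / M"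
    have a0: "0 < a" using ab by simp
    have crit: "(a\<^sup>2 - b\<^sup>2) * sin t * cos t = p * (b\<^sup>2 * S * cos t - a\<^sup>2 * C * sin t)" if "snell a b p t s" for t
      using that by (simp add: snell_def C_def S_def)
    \<comment> \<open>A zero means that \<open>t\<close> and \<open>s\<close> agree modulo \<pi>.
      The two sides of the critical equation then equal, up to sign,
      \<open>(a^2 - b^2) * S * C\<close> and \<open>p\<close> times the same quantity, which is
      impossible for \<open>p \<noteq> 1\<close>.\<close>
    have ne0: "sin t * C - cos t * S \<noteq> 0" if t: "snell a b p t s" for t
    proof
      assume 0: "sin t * C - cos t * S = 0"
      have u: "(cos t)\<^sup>2 + (sin t)\<^sup>2 = 1" by simp
      have "(p * (b\<^sup>2 - a\<^sup>2) * S * C)\<^sup>2 = ((a\<^sup>2 - b\<^sup>2) * S * C)\<^sup>2"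
      proof -
        have e: "sin t * C = cos t * S" using 0 by simp
        have c2: "(cos t)\<^sup>2 = C\<^sup>2" using e u U by algebra
        have z2: "(sin t)\<^sup>2 = S\<^sup>2" using c2 u U by algebra
        have "((a\<^sup>2 - b\<^sup>2) * S * C)\<^sup>2 = ((a\<^sup>2 - b\<^sup>2) * sin t * cos t)\<^sup>2"
          unfolding power_mult_distrib c2 z2 ..
        also have "\<dots> = (p * (b\<^sup>2 * S * cos t - a\<^sup>2 * C * sin t))\<^sup>2" unfolding crit[OF t] ..
        also have "b\<^sup>2 * S * cos t - a\<^sup>2 * C * sin t = (b\<^sup>2 - a\<^sup>2) * S * cos t" using e by algebra
        also have "(p * ((b\<^sup>2 - a\<^sup>2) * S * cos t))\<^sup>2 = (p * (b\<^sup>2 - a\<^sup>2) * S * C)\<^sup>2"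
          unfolding power_mult_distrib c2 by simp
        finally show ?thesis by simp
      qed
      then have "p\<^sup>2 * ((a\<^sup>2 - b\<^sup>2) * S * C)\<^sup>2 = 1 * ((a\<^sup>2 - b\<^sup>2) * S * C)\<^sup>2" by algebra
      then show False using p2 D C0 S0 by simp
    qed
    have ne1: "(sin t * C - cos t * S)\<^sup>2 / N t \<noteq> (sin t' * C - cos t' * S)\<^sup>2 / N t'"
      if t: "snell a b p t s" and t': "snell a b p t' s" and ne: "(cos t, sin t) \<noteq> (cos t', sin t')" for t t'
    proof
      assume eq: "(sin t * C - cos t * S)\<^sup>2 / N t = (sin t' * C - cos t' * S)\<^sup>2 / N t'"
      have ut: "(cos t)\<^sup>2 + (sin t)\<^sup>2 = 1" "(cos t')\<^sup>2 + (sin t')\<^sup>2 = 1" by simp_all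
      define x y where "x t = (b\<^sup>2 * (cos t)\<^sup>2 - a\<^sup>2 * (sin t)\<^sup>2) / N t" and "y t = 2 * a * b * sin t * cos t / N t" for t
      have Nf: "b\<^sup>2 * (cos t)\<^sup>2 + a\<^sup>2 * (sin t)\<^sup>2 = N t" "b\<^sup>2 * (cos t')\<^sup>2 + a\<^sup>2 * (sin t')\<^sup>2 = N t'" by (simp_all add: N_def)
      have x: "x t = (b\<^sup>2 * (cos t)\<^sup>2 - a\<^sup>2 * (sin t)\<^sup>2) / (b\<^sup>2 * (cos t)\<^sup>2 + a\<^sup>2 * (sin t)\<^sup>2)"
        and y: "y t = 2 * a * b * sin t * cos t / (b\<^sup>2 * (cos t)\<^sup>2 + a\<^sup>2 * (sin t)\<^sup>2)" for t by (simp_all add: x_def y_def N_def)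
      note e = snell_double_angle[OF ab(1) a0 ut(1) U crit[OF t], folded M_def m_def d_def, folded g_def h_def x y, unfolded Nf]
      note e' = snell_double_angle[OF ab(1) a0 ut(2) U crit[OF t'], folded M_def m_def d_def, folded g_def h_def x y, unfolded Nf]
      have N0: "N t > 0" "N t' > 0" and M0: "M > 0" using e(1,2) e'(1) by auto
      define u v where "u = x t * g + y t * h" and "v = y t * g - x t * h"
      define v' where "v' = y t' * g - x t' * h"
      have "M * (1 - (x t * g + y t * h)) / (2 * a\<^sup>2 * b\<^sup>2) = M * (1 - (x t' * g + y t' * h)) / (2 * a\<^sup>2 * b\<^sup>2)"
        using eq e(5) e'(5) by simp
      then have u': "u = x t' * g + y t' * h"
        using M0 a0 ab by (simp add: u_def)
      have gh: "g\<^sup>2 + h\<^sup>2 = 1" and xy: "(x t)\<^sup>2 + (y t)\<^sup>2 = 1" and xy': "(x t')\<^sup>2 + (y t')\<^sup>2 = 1" using e e' by auto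
      have uv: "u\<^sup>2 + v\<^sup>2 = 1" unfolding u_def v_def using gh xy by algebra
      have uv': "u\<^sup>2 + v'\<^sup>2 = 1" unfolding u' v'_def using gh xy' by algebra
      have X: "x t = u * g - v * h" "y t = u * h + v * g" unfolding u_def v_def using gh by algebra+
      have X': "x t' = u * g - v' * h" "y t' = u * h + v' * g" unfolding u' v'_def using gh by algebra+
      have "v\<^sup>2 = v'\<^sup>2" using uv uv' by simp
      then have "v = v' \<or> v = - v'" by (simp add: power2_eq_iff)
      then consider "v' = v" | "v' = - v" "v \<noteq> 0" by force
      then show False
      proof cases
        \<comment> \<open>The same double angle leaves only equal or antipodal directions. Passing
          to the antipode preserves the left side of the critical equation and reverses the right
          side, so both vanish; then \<open>t\<close> lies on an axis, which contradicts
          \<open>C \<noteq> 0\<close> and \<open>S \<noteq> 0\<close>.\<close>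
        case 1
        then have xx: "x t = x t'" "y t = y t'" using X X' by auto
        have "(cos t)\<^sup>2 / N t = (1 + x t) / (2 * b\<^sup>2)" "(cos t')\<^sup>2 / N t' = (1 + x t') / (2 * b\<^sup>2)"
          "(sin t)\<^sup>2 / N t = (1 - x t) / (2 * a\<^sup>2)" "(sin t')\<^sup>2 / N t' = (1 - x t') / (2 * a\<^sup>2)"
          unfolding e(7,8) e'(7,8) using ab a0 by simp_all
        then have cN: "(cos t)\<^sup>2 / N t = (cos t')\<^sup>2 / N t'" and sN: "(sin t)\<^sup>2 / N t = (sin t')\<^sup>2 / N t'"
          using xx by simp_all
        then have "((cos t)\<^sup>2 + (sin t)\<^sup>2) / N t = ((cos t')\<^sup>2 + (sin t')\<^sup>2) / N t'"
          by (simp only: add_divide_distrib)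
        then have NN: "N t = N t'" using N0 by (simp only: ut) simp
        then have cc: "(cos t)\<^sup>2 = (cos t')\<^sup>2" "(sin t)\<^sup>2 = (sin t')\<^sup>2"
          using cN sN N0 by auto
        have "2 * a * b * (sin t * cos t) / N t = 2 * a * b * (sin t' * cos t') / N t"
          using xx(2) NN by (simp add: y_def mult.assoc)
        then have sc: "sin t * cos t = sin t' * cos t'" using N0 a0 ab by simp
        have neg: "cos t' = - cos t \<and> sin t' = - sin t"
          using cc sc ne by (auto simp: power2_eq_iff)
        have "(a\<^sup>2 - b\<^sup>2) * sin t * cos t = - (p * (b\<^sup>2 * S * cos t - a\<^sup>2 * C * sin t))"
          using crit[OF t'] by (simp add: neg algebra_simps)
        then have 0: "p * (b\<^sup>2 * S * cos t - a\<^sup>2 * C * sin t) = 0"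
          using crit[OF t] by linarith
        then have "(a\<^sup>2 - b\<^sup>2) * sin t * cos t = 0" using crit[OF t] by simp
        moreover have z: "b\<^sup>2 * S * cos t = a\<^sup>2 * C * sin t"
          using 0 p by simp
        ultimately have "sin t = 0 \<or> cos t = 0" using D by auto
        then show False using z S0 C0 a0 ab sin_zero_norm_cos_one[of t] by auto
      next
        case 2
        have h0: "h \<noteq> 0" using M0 a0 ab C0 S0 by (simp add: h_def)
        have "poly (elim_poly m d p) g = 0"
        proof (rule elim_poly_root[OF gh uv h0 2(2) d])
          fix xa ya assume "xa = u * g - v * h" "ya = u * h + v * g"
          then have "xa = x t" "ya = y t" using X by auto
          then show "4 * d\<^sup>2 * ya\<^sup>2 * (m + d * g) = p\<^sup>2 * (m + d * xa) *
             ((m - d)\<^sup>2 * (1 - g) * (1 + xa) + (m + d)\<^sup>2 * (1 + g) * (1 - xa) - 2 * (m\<^sup>2 - d\<^sup>2) * h * ya)"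
            using e(6) by simp
        next
          fix xa ya assume "xa = u * g + v * h" "ya = u * h - v * g"
          then have "xa = x t'" "ya = y t'" using X' 2 by auto
          then show "4 * d\<^sup>2 * ya\<^sup>2 * (m + d * g) = p\<^sup>2 * (m + d * xa) *
             ((m - d)\<^sup>2 * (1 - g) * (1 + xa) + (m + d)\<^sup>2 * (1 + g) * (1 - xa) - 2 * (m\<^sup>2 - d\<^sup>2) * h * ya)"
            using e'(6) by simp
        qed
        then have gG: "g \<in> G" by (simp add: G_def)
        have eq: "a\<^sup>2 * (1 + g) / (a\<^sup>2 * (1 + g) + b\<^sup>2 * (1 - g)) = C\<^sup>2"
        proof -
          have "g * M = b\<^sup>2 * C\<^sup>2 - a\<^sup>2 * S\<^sup>2" using M0 by (simp add: g_def)
          then have "(1 + g) * M = 2 * b\<^sup>2 * C\<^sup>2" "(1 - g) * M = 2 * a\<^sup>2 * S\<^sup>2" unfolding M_def by algebra+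
          then have "1 + g = 2 * b\<^sup>2 * C\<^sup>2 / M" "1 - g = 2 * a\<^sup>2 * S\<^sup>2 / M" using M0 by (simp_all add: field_simps)
          then have "a\<^sup>2 * (1 + g) + b\<^sup>2 * (1 - g) = 2 * a\<^sup>2 * b\<^sup>2 * (C\<^sup>2 + S\<^sup>2) / M"
            by (simp add: distrib_left add_divide_distrib mult_ac)
          then show ?thesis using \<open>1 + g = _\<close> U M0 a0 ab by simp
        qed
        have "C\<^sup>2 \<in> H" unfolding H_def by (rule image_eqI[where x = g]) (simp_all add: eq gG)
        then have "\<bar>C\<bar> \<in> sqrt ` H" "- \<bar>C\<bar> \<in> (\<lambda>x. - sqrt x) ` H"
          by (auto intro: image_eqI[of _ _ "C\<^sup>2"])
        then have "C \<in> F" by (cases "C \<ge> 0") (simp_all add: F_def)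
        then show False using sF by (simp add: C_def)
      qed
    qed
    show ?thesis unfolding C_def[symmetric] S_def[symmetric] using ne0 ne1 by blast
  qed
  ultimately show ?thesis by blast
qed

lemma finite_cos_vimage:
  assumes "finite F" shows "finite {s \<in> {0..2*pi}. cos s \<in> F}"
proof (rule finite_subset)
  show "{s \<in> {0..2*pi}. cos s \<in> F} \<subseteq> arccos ` F \<union> (\<lambda>x. 2 * pi - arccos x) ` F"
  proof
    fix s assume s: "s \<in> {s \<in> {0..2*pi}. cos s \<in> F}"
    show "s \<in> arccos ` F \<union> (\<lambda>x. 2 * pi - arccos x) ` F"
    proof (cases "s \<le> pi")
      case True
      then have eq: "arccos (cos s) = s" using arccos_cos[of s] s by auto
      have "arccos (cos s) \<in> arccos ` F" using s by blast
      then show ?thesis unfolding eq by blast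
    next
      case False
      have "cos (2 * pi - s) = cos s" by (simp add: cos_diff)
      then have eq: "2 * pi - arccos (cos s) = s" using s False arccos_cos[of "2 * pi - s"] by auto
      have "2 * pi - arccos (cos s) \<in> (\<lambda>x. 2 * pi - arccos x) ` F" using s by blast
      then show ?thesis unfolding eq by blast
    qed
  qed
qed (use assms in auto)

section \<open>The Fourier transform of the disc\<close>

text \<open>The Fourier transform of the unit disc along one axis, with the disc sliced into chords
  of length \<open>2 * sqrt (1 - t^2)\<close>. In terms of the Bessel function it is
  \<open>2 \<pi> J_1(s) / s\<close>, extended continuously to \<open>s = 0\<close>.\<close>

definition disc_ft :: "real \<Rightarrow> real" where
  "disc_ft s = integral {-1..1} (\<lambda>t. 2 * sqrt (1 - t\<^sup>2) * cos (s * t))"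

definition disc_ft1 :: "real \<Rightarrow> real" where
  "disc_ft1 s = integral {-1..1} (\<lambda>t. - 2 * t * sqrt (1 - t\<^sup>2) * sin (s * t))"

definition disc_ft2 :: "real \<Rightarrow> real" where
  "disc_ft2 s = integral {-1..1} (\<lambda>t. - 2 * t\<^sup>2 * sqrt (1 - t\<^sup>2) * cos (s * t))"

lemma disc_ft_deriv: "(disc_ft has_real_derivative disc_ft1 s) (at s)"
proof -
  have "((\<lambda>s. integral (cbox (-1) 1) (\<lambda>t. 2 * sqrt (1 - t\<^sup>2) * cos (s * t))) has_real_derivative
     integral (cbox (-1) 1) (\<lambda>t. - 2 * t * sqrt (1 - t\<^sup>2) * sin (s * t))) (at s within UNIV)"
    by (rule leibniz_rule_field_derivative)
       (auto intro!: derivative_eq_intros integrable_continuous_real continuous_intros simp: case_prod_beta)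
  then show ?thesis by (simp add: disc_ft_def[abs_def] disc_ft1_def)
qed

lemma disc_ft1_deriv: "(disc_ft1 has_real_derivative disc_ft2 s) (at s)"
proof -
  have "((\<lambda>s. integral (cbox (-1) 1) (\<lambda>t. - 2 * t * sqrt (1 - t\<^sup>2) * sin (s * t))) has_real_derivative
     integral (cbox (-1) 1) (\<lambda>t. - 2 * t\<^sup>2 * sqrt (1 - t\<^sup>2) * cos (s * t))) (at s within UNIV)"
    by (rule leibniz_rule_field_derivative)
       (auto intro!: derivative_eq_intros integrable_continuous_real continuous_intros simp: case_prod_beta power2_eq_square)
  then show ?thesis by (simp add: disc_ft1_def[abs_def] disc_ft2_def)
qed

lemma continuous_on_disc_ft: "continuous_on S disc_ft"
  by (rule DERIV_continuous_on) (rule has_field_derivative_at_within[OF disc_ft_deriv])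

text \<open>Bessel's equation, obtained by integrating by parts.\<close>

lemma disc_ft_ode: "s * disc_ft2 s + 3 * disc_ft1 s + s * disc_ft s = 0"
proof -
  \<comment> \<open>\<open>?g\<close> is the derivative of \<open>?G\<close>, and the power 3/2 of
    \<open>1 - t^2\<close> makes \<open>?G\<close> vanish at both ends. The square root is not
    differentiable there, hence the interior form of the fundamental theorem.\<close>
  let ?G = "\<lambda>t. 2 * ((1 - t\<^sup>2) * sqrt (1 - t\<^sup>2)) * sin (s * t)"
  let ?g = "\<lambda>t. 3 * (- 2 * t * sqrt (1 - t\<^sup>2) * sin (s * t)) + s * (2 * sqrt (1 - t\<^sup>2) * cos (s * t))
               + s * (- 2 * t\<^sup>2 * sqrt (1 - t\<^sup>2) * cos (s * t))"
  have "(?g has_integral (?G 1 - ?G (-1))) {-1..1}"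
  proof (rule fundamental_theorem_of_calculus_interior)
    fix t :: real assume t: "t \<in> {-1<..<1}"
    then have "t\<^sup>2 < 1" by (auto simp: abs_square_less_1 abs_less_iff)
    define r where "r = sqrt (1 - t\<^sup>2)"
    have r: "r > 0" "r * r = 1 - t\<^sup>2" using \<open>t\<^sup>2 < 1\<close> by (simp_all add: r_def)
    have 1: "((\<lambda>t. sqrt (1 - t\<^sup>2)) has_real_derivative - t / r) (at t)"
      using r \<open>t\<^sup>2 < 1\<close> by (auto intro!: derivative_eq_intros simp: r_def divide_simps)
    have "(?G has_real_derivative (2 * ((- 2 * t) * r + (- t / r) * (1 - t\<^sup>2)) * sin (s * t) + (s * cos (s * t)) * (2 * ((1 - t\<^sup>2) * r)))) (at t)"
    proof -
      have "((\<lambda>t. 1 - t\<^sup>2) has_real_derivative - 2 * t) (at t)" by (auto intro!: derivative_eq_intros)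
      from DERIV_mult[OF this 1]
      have 2: "((\<lambda>t. (1 - t\<^sup>2) * sqrt (1 - t\<^sup>2)) has_real_derivative (- 2 * t) * r + (- t / r) * (1 - t\<^sup>2)) (at t)"
        by (simp only: r_def)
      have "((\<lambda>t. sin (s * t)) has_real_derivative s * cos (s * t)) (at t)" by (auto intro!: derivative_eq_intros)
      from DERIV_mult[OF DERIV_cmult[OF 2, of 2] this] show ?thesis by (simp only: r_def)
    qed
    also have "2 * ((- 2 * t) * r + (- t / r) * (1 - t\<^sup>2)) * sin (s * t) + (s * cos (s * t)) * (2 * ((1 - t\<^sup>2) * r)) = ?g t"
    proof -
      have e: "(- t / r) * (1 - t\<^sup>2) = - t * r" using r by (simp add: r(2)[symmetric])
      show ?thesis unfolding e unfolding r_def[symmetric] by (simp add: algebra_simps)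
    qed
    finally show "(?G has_vector_derivative ?g t) (at t)"
      by (simp add: has_real_derivative_iff_has_vector_derivative)
  qed (auto intro!: continuous_intros)
  then have 0: "integral {-1..1} ?g = 0" by (simp add: integral_unique)
  have i: "(\<lambda>t. - 2 * t * sqrt (1 - t\<^sup>2) * sin (s * t)) integrable_on {-1..1}"
    "(\<lambda>t. 2 * sqrt (1 - t\<^sup>2) * cos (s * t)) integrable_on {-1..1}"
    "(\<lambda>t. - 2 * t\<^sup>2 * sqrt (1 - t\<^sup>2) * cos (s * t)) integrable_on {-1..1}"
    by (auto intro!: integrable_continuous_real continuous_intros)
  have "(?g has_integral (3 * disc_ft1 s + s * disc_ft s + s * disc_ft2 s)) {-1..1}"
    unfolding disc_ft_def disc_ft1_def disc_ft2_def
    by (intro has_integral_add has_integral_mult_right integrable_integral i)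
  then show ?thesis using 0 by (simp add: integral_unique)
qed

text \<open>A single nonzero value shows that \<open>disc_ft\<close> is not the trivial solution of
  its differential equation, which keeps the asymptotic amplitude away from zero. On the interval,
  \<open>cos t \<ge> 1 / 2\<close> and \<open>sqrt (1 - t^2) \<ge> 1 - t^2\<close>, which gives at
  least 4/3.\<close>

lemma disc_ft_1_pos: "disc_ft 1 > 0"
proof -
  have "((\<lambda>t::real. 1 - t\<^sup>2) has_integral ((1 - 1^3 / 3) - ((-1) - (-1)^3 / 3))) {-1..1}"
    by (rule fundamental_theorem_of_calculus)
       (auto intro!: derivative_eq_intros simp: has_real_derivative_iff_has_vector_derivative[symmetric])
  then have "((\<lambda>t::real. 1 - t\<^sup>2) has_integral 4/3) {-1..1}" by simp
  moreover have "((\<lambda>t. 2 * sqrt (1 - t\<^sup>2) * cos (1 * t)) has_integral disc_ft 1) {-1..1}"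
    unfolding disc_ft_def by (intro integrable_integral integrable_continuous_real continuous_intros)
  moreover have "1 - t\<^sup>2 \<le> 2 * sqrt (1 - t\<^sup>2) * cos (1 * t)" if t: "t \<in> {-1..1}" for t :: real
  proof -
    have "t\<^sup>2 \<le> 1" using t by (auto simp: abs_square_le_1 abs_le_iff)
    then have 1: "1 - t\<^sup>2 \<le> sqrt (1 - t\<^sup>2)" by (intro real_le_rsqrt) (simp add: power2_eq_square mult_left_le)
    have "cos (pi / 3) \<le> cos \<bar>t\<bar>" using t pi_gt3 by (intro cos_monotone_0_pi_le) auto
    then have "1 / 2 \<le> cos t" by (simp add: cos_60)
    then have "(1 - t\<^sup>2) * 1 \<le> sqrt (1 - t\<^sup>2) * (2 * cos t)"
      using 1 \<open>t\<^sup>2 \<le> 1\<close> by (intro mult_mono) auto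
    then show ?thesis by (simp add: mult_ac)
  qed
  ultimately have "4/3 \<le> disc_ft 1" by (rule has_integral_le)
  then show ?thesis by simp
qed

text \<open>The function \<open>y s = s * sqrt s * disc_ft s\<close> satisfies
  \<open>y'' = (3 / (4 * s^2) - 1) * y\<close>, an integrable perturbation of the harmonic
  oscillator. Its energy stays between two positive bounds, and in a rotating frame the vector
  formed by \<open>y\<close> and its derivative moves with speed of order \<open>1 / s^2\<close>; it
  therefore converges at rate \<open>1 / s\<close>, to a nonzero limit.\<close>

theorem disc_ft_asymptotics:
  "\<exists>Z C. Z \<noteq> 0 \<and> (\<forall>s\<ge>1. \<bar>s * sqrt s * disc_ft s - Re (Z * cis (- s))\<bar> \<le> C / s)"
proof -
  define y where "y s = s * sqrt s * disc_ft s" for s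
  define y1 where "y1 s = 3 / 2 * sqrt s * disc_ft s + s * sqrt s * disc_ft1 s" for s
  have y: "(y has_real_derivative y1 s) (at s)" if "s > 0" for s
    unfolding y_def y1_def using that
    by (auto intro!: derivative_eq_intros disc_ft_deriv simp: field_simps) (simp add: field_simps flip: power2_eq_square)?
  have y1: "(y1 has_real_derivative (3 / (4 * s\<^sup>2) - 1) * y s) (at s)" if s: "s > 0" for s
  proof -
    define r where "r = sqrt s"
    have r: "r > 0" "s = r * r" using s by (simp_all add: r_def)
    have "(y1 has_real_derivative (3 / 2 * (1 / (2 * r)) * disc_ft s + 3 / 2 * r * disc_ft1 s
        + (r + s / (2 * r)) * disc_ft1 s + s * r * disc_ft2 s)) (at s)"
      unfolding y1_def[abs_def] r_def using s
      by (auto intro!: derivative_eq_intros disc_ft_deriv disc_ft1_deriv simp: field_simps)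
    also have "3 / 2 * (1 / (2 * r)) * disc_ft s + 3 / 2 * r * disc_ft1 s
        + (r + s / (2 * r)) * disc_ft1 s + s * r * disc_ft2 s = 3 / 4 / r * disc_ft s + r * (3 * disc_ft1 s + s * disc_ft2 s)"
      using r by (simp add: field_simps)
    also have "3 * disc_ft1 s + s * disc_ft2 s = - s * disc_ft s" using disc_ft_ode[of s] by simp
    also have "3 / 4 / r * disc_ft s + r * (- s * disc_ft s) = (3 / (4 * s\<^sup>2) - 1) * y s"
      unfolding y_def r_def[symmetric] using r by (simp add: field_simps power2_eq_square)
    finally show ?thesis .
  qed
  define E where "E s = (y s)\<^sup>2 + (y1 s)\<^sup>2" for s
  have E0: "E s \<ge> 0" for s by (simp add: E_def)
  have E: "(E has_real_derivative 3 / (2 * s\<^sup>2) * (y s * y1 s)) (at s)" if "s > 0" for s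
    unfolding E_def[abs_def]
    by (rule derivative_eq_intros y y1 that refl)+ (simp add: field_simps)
  have E': "\<bar>3 / (2 * s\<^sup>2) * (y s * y1 s)\<bar> \<le> 3 / (4 * s\<^sup>2) * E s" if "s > 0" for s
  proof -
    have "2 * \<bar>y s * y1 s\<bar> \<le> E s"
      using sum_squares_bound[of "\<bar>y s\<bar>" "\<bar>y1 s\<bar>"] by (simp add: E_def abs_mult mult.assoc)
    then have "3 / (4 * s\<^sup>2) * (2 * \<bar>y s * y1 s\<bar>) \<le> 3 / (4 * s\<^sup>2) * E s" by (intro mult_left_mono) auto
    then show ?thesis by (simp add: abs_mult mult.commute)
  qed
  have E'1: "3 / (2 * s\<^sup>2) * (y s * y1 s) - 3 / (4 * s\<^sup>2) * E s \<le> 0"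
    and E'2: "3 / (2 * s\<^sup>2) * (y s * y1 s) + 3 / (4 * s\<^sup>2) * E s \<ge> 0" if "s > 0" for s
    using E'[OF that] unfolding abs_le_iff by linarith+
  \<comment> \<open>The factor has logarithmic derivative \<open>- 3 / (4 * s^2)\<close>, which
    compensates the fastest growth of \<open>E\<close> that \<open>E'1\<close> permits;
    \<open>low\<close> uses the reciprocal factor against the fastest decay.\<close>
  have up: "E s * exp (3 / (4 * s)) \<le> E 1 * exp (3 / 4)" if "s \<ge> 1" for s
  proof -
    have "(\<lambda>s. E s * exp (3 / (4 * s))) s \<le> (\<lambda>s. E s * exp (3 / (4 * s))) 1"
    proof (rule DERIV_nonpos_imp_nonincreasing[OF that])
      fix x :: real assume x: "1 \<le> x" "x \<le> s"
      have "((\<lambda>s. E s * exp (3 / (4 * s))) has_real_derivative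
          (3 / (2 * x\<^sup>2) * (y x * y1 x) - 3 / (4 * x\<^sup>2) * E x) * exp (3 / (4 * x))) (at x)"
        using x by (auto intro!: derivative_eq_intros E simp: field_simps power2_eq_square)
      moreover have "(3 / (2 * x\<^sup>2) * (y x * y1 x) - 3 / (4 * x\<^sup>2) * E x) * exp (3 / (4 * x)) \<le> 0"
        using x by (intro mult_nonpos_nonneg E'1) auto
      ultimately show "\<exists>z. ((\<lambda>s. E s * exp (3 / (4 * s))) has_real_derivative z) (at x) \<and> z \<le> 0" by blast
    qed
    then show ?thesis by simp
  qed
  have low: "E s * exp (- 3 / (4 * s)) \<ge> E 1 * exp (- 3 / 4)" if "s \<ge> 1" for s
  proof -
    have "(\<lambda>s. E s * exp (- 3 / (4 * s))) 1 \<le> (\<lambda>s. E s * exp (- 3 / (4 * s))) s"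
    proof (rule DERIV_nonneg_imp_nondecreasing[OF that])
      fix x :: real assume x: "1 \<le> x" "x \<le> s"
      have "((\<lambda>s. E s * exp (- 3 / (4 * s))) has_real_derivative
          (3 / (2 * x\<^sup>2) * (y x * y1 x) + 3 / (4 * x\<^sup>2) * E x) * exp (- 3 / (4 * x))) (at x)"
        using x by (auto intro!: derivative_eq_intros E simp: field_simps power2_eq_square)
      moreover have "(3 / (2 * x\<^sup>2) * (y x * y1 x) + 3 / (4 * x\<^sup>2) * E x) * exp (- 3 / (4 * x)) \<ge> 0"
        using x by (intro mult_nonneg_nonneg E'2) auto
      ultimately show "\<exists>z. ((\<lambda>s. E s * exp (- 3 / (4 * s))) has_real_derivative z) (at x) \<and> z \<ge> 0" by blast
    qed
    then show ?thesis by simp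
  qed
  define U where "U = E 1 * exp (3 / 4)"
  define L where "L = E 1 * exp (- 3 / 4)"
  have EU: "E s \<le> U" if "s \<ge> 1" for s
  proof -
    have "E s * 1 \<le> E s * exp (3 / (4 * s))" using that E0[of s] by (intro mult_left_mono) auto
    then show ?thesis using up[OF that] by (simp add: U_def)
  qed
  have EL: "E s \<ge> L" if "s \<ge> 1" for s
  proof -
    have "E s * exp (- 3 / (4 * s)) \<le> E s * 1" using that E0[of s] by (intro mult_left_mono) auto
    then show ?thesis using low[OF that] by (simp add: L_def)
  qed
  have "E 1 > 0" using disc_ft_1_pos by (simp add: E_def y_def add_pos_nonneg)
  then have L0: "L > 0" by (simp add: L_def)
  \<comment> \<open>For the unperturbed oscillator \<open>y + \<i> * y1\<close> is a multiple of
    \<open>cis (- s)\<close>, and \<open>Z\<close> would be constant. Hence \<open>Z'\<close>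
    contains nothing but the perturbation.\<close>
  define Z where "Z s = (of_real (y s) + \<i> * of_real (y1 s)) * cis s" for s
  have nZ: "(norm (Z s))\<^sup>2 = E s" for s
    by (simp add: Z_def norm_mult cmod_power2 E_def)
  define Z' where "Z' s = \<i> * of_real (3 / (4 * s\<^sup>2) * y s) * cis s" for s
  have dZ: "(Z has_vector_derivative Z' s) (at s)" if s: "s > 0" for s
  proof -
    have "(Z has_vector_derivative ((of_real (y s) + \<i> * of_real (y1 s)) * (\<i> * cis s)
       + (of_real (y1 s) + \<i> * of_real ((3 / (4 * s\<^sup>2) - 1) * y s)) * cis s)) (at s)"
      unfolding Z_def[abs_def]
    proof (intro has_vector_derivative_mult has_vector_derivative_add has_vector_derivative_mult_right has_vector_derivative_of_real y y1 s)
      have "((\<lambda>s. Complex (cos s) (sin s)) has_vector_derivative Complex (- sin s) (cos s)) (at s)"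
        by (auto simp: has_vector_derivative_complex_iff intro!: derivative_eq_intros)
      then show "(cis has_vector_derivative \<i> * cis s) (at s)"
        by (simp add: cis.ctr[abs_def] Complex_eq algebra_simps)
    qed
    also have "(of_real (y s) + \<i> * of_real (y1 s)) * (\<i> * cis s)
       + (of_real (y1 s) + \<i> * of_real ((3 / (4 * s\<^sup>2) - 1) * y s)) * cis s = Z' s"
      by (simp add: Z'_def algebra_simps)
    finally show ?thesis .
  qed
  define C where "C = 3 / 4 * sqrt U"
  have bZ': "norm (Z' s) \<le> C / s\<^sup>2" if s: "s \<ge> 1" for s
  proof -
    have "(y s)\<^sup>2 \<le> U" using EU[OF s] by (simp add: E_def) (smt (verit) zero_le_power2)
    then have "\<bar>y s\<bar> \<le> sqrt U" by (intro real_le_rsqrt) simp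
    then have "3 / (4 * s\<^sup>2) * \<bar>y s\<bar> \<le> 3 / (4 * s\<^sup>2) * sqrt U" by (intro mult_left_mono) auto
    moreover have "norm (Z' s) = 3 / (4 * s\<^sup>2) * \<bar>y s\<bar>"
      unfolding Z'_def norm_mult norm_of_real by (simp add: abs_mult)
    ultimately show ?thesis by (simp add: C_def)
  qed
  have diff: "norm (Z t - Z s) \<le> C / s - C / t" if st: "1 \<le> s" "s < t" for s t
  proof -
    have "norm (Z t - Z s) \<le> - C / t - (- C / s)"
    proof (rule differentiable_bound_general[OF st(2)])
      show "continuous_on {s..t} Z"
        by (rule continuous_on_vector_derivative, rule has_vector_derivative_at_within, rule dZ) (use st in auto)
      show "continuous_on {s..t} (\<lambda>x. - C / x)" using st by (intro continuous_intros) auto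
      fix x assume x: "s < x" "x < t"
      show "(Z has_vector_derivative Z' x) (at x)" using x st by (intro dZ) auto
      show "((\<lambda>x. - C / x) has_vector_derivative C / x\<^sup>2) (at x)"
        unfolding has_real_derivative_iff_has_vector_derivative[symmetric]
        using x st by (auto intro!: derivative_eq_intros simp: power2_eq_square)
      show "norm (Z' x) \<le> C / x\<^sup>2" using x st by (intro bZ') auto
    qed
    then show ?thesis by simp
  qed
  have C0: "C \<ge> 0" using EU[of 1] E0[of 1] by (simp add: C_def)
  have diff': "norm (Z t - Z s) \<le> C / s" if st: "1 \<le> s" "s \<le> t" for s t
  proof (cases "s = t")
    case False
    have "C / t \<ge> 0" using C0 st by simp
    then show ?thesis using diff[of s t] st False by simp
  qed (use C0 st in auto)
  \<comment> \<open>The limit is taken along the integers; \<open>diff'\<close> then carries the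
    rate over to all real \<open>s \<ge> 1\<close>.\<close>
  have "Cauchy (\<lambda>n. Z (real (Suc n)))"
  proof (rule metric_CauchyI)
    fix e :: real assume e: "e > 0"
    obtain M :: nat where M: "C / e < real M" using reals_Archimedean2 by blast
    have *: "norm (Z (real (Suc m)) - Z (real (Suc n))) < e" if mn: "M \<le> n" "n \<le> m" for m n
    proof -
      have "norm (Z (real (Suc m)) - Z (real (Suc n))) \<le> C / real (Suc n)" using mn by (intro diff') auto
      also have "\<dots> < e"
      proof -
        have "C / e < real (Suc n)" using M mn by simp
        then show ?thesis using e by (simp add: field_simps)
      qed
      finally show ?thesis .
    qed
    have "dist (Z (real (Suc m))) (Z (real (Suc n))) < e" if "M \<le> m" "M \<le> n" for m n
      using *[of n m] *[of m n] that by (cases "n \<le> m") (auto simp: dist_norm norm_minus_commute)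
    then show "\<exists>M. \<forall>m\<ge>M. \<forall>n\<ge>M. dist (Z (real (Suc m))) (Z (real (Suc n))) < e" by blast
  qed
  then obtain W where W: "(\<lambda>n. Z (real (Suc n))) \<longlonglongrightarrow> W"
    using Cauchy_convergent_iff convergent_def by blast
  have ZW: "norm (Z s - W) \<le> C / s" if s: "s \<ge> 1" for s
  proof (rule LIMSEQ_le_const2)
    show "(\<lambda>n. norm (Z s - Z (real (Suc n)))) \<longlonglongrightarrow> norm (Z s - W)"
      by (intro tendsto_intros W)
    have "norm (Z s - Z (real (Suc n))) \<le> C / s" if "n \<ge> nat \<lceil>s\<rceil>" for n
      using diff'[of s "real (Suc n)"] s that by (simp add: norm_minus_commute)
    then show "\<exists>N. \<forall>n\<ge>N. norm (Z s - Z (real (Suc n))) \<le> C / s" by blast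
  qed
  have "(norm W)\<^sup>2 \<ge> L"
  proof (rule LIMSEQ_le_const)
    show "(\<lambda>n. (norm (Z (real (Suc n))))\<^sup>2) \<longlonglongrightarrow> (norm W)\<^sup>2" by (intro tendsto_intros W)
    show "\<exists>N. \<forall>n\<ge>N. L \<le> (norm (Z (real (Suc n))))\<^sup>2" using EL by (auto simp: nZ)
  qed
  then have "W \<noteq> 0" using L0 by auto
  moreover have "\<bar>s * sqrt s * disc_ft s - Re (W * cis (- s))\<bar> \<le> C / s" if s: "s \<ge> 1" for s
  proof -
    have "y s = Re (Z s * cis (- s))" by (simp add: Z_def mult.assoc cis_mult)
    then have "\<bar>y s - Re (W * cis (- s))\<bar> = \<bar>Re ((Z s - W) * cis (- s))\<bar>" by (simp add: algebra_simps)
    also have "\<dots> \<le> norm ((Z s - W) * cis (- s))" by (rule abs_Re_le_cmod)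
    also have "\<dots> \<le> C / s" using ZW[OF s] by (simp add: norm_mult)
    finally show ?thesis by (simp add: y_def)
  qed
  ultimately show ?thesis by blast
qed

section \<open>Entire extension of the transform and analyticity in the wave number\<close>

definition disc_ftc :: "complex \<Rightarrow> complex" where
  "disc_ftc z = integral {-1..1} (\<lambda>t. of_real (2 * sqrt (1 - t\<^sup>2)) * cos (z * of_real t))"

lemma disc_ftc_of_real: "disc_ftc (of_real x) = of_real (disc_ft x)"
proof -
  have "((\<lambda>t. 2 * sqrt (1 - t\<^sup>2) * cos (x * t)) has_integral disc_ft x) {-1..1}"
    unfolding disc_ft_def by (intro integrable_integral integrable_continuous_real continuous_intros)
  from has_integral_of_real[OF this, where 'b = complex]
  have "((\<lambda>t. of_real (2 * sqrt (1 - t\<^sup>2)) * cos (complex_of_real x * of_real t)) has_integral of_real (disc_ft x)) {-1..1}"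
    by (simp add: cos_of_real[symmetric] del: of_real_sqrt)
  then show ?thesis by (simp add: disc_ftc_def integral_unique)
qed

lemma disc_ftc_holomorphic: "disc_ftc holomorphic_on UNIV"
proof -
  have "((\<lambda>z. integral (cbox (-1) 1) (\<lambda>t. of_real (2 * sqrt (1 - t\<^sup>2)) * cos (z * of_real t))) has_field_derivative
     integral (cbox (-1) 1) (\<lambda>t. of_real (2 * sqrt (1 - t\<^sup>2)) * (- sin (z * of_real t) * of_real t))) (at z within UNIV)" for z
    by (rule leibniz_rule_field_derivative)
       (auto intro!: derivative_eq_intros integrable_continuous_real continuous_intros simp: case_prod_beta)
  then show ?thesis
    unfolding holomorphic_on_def field_differentiable_def disc_ftc_def[abs_def] by (auto intro: has_field_derivative_at_within)
qed

lemma disc_ftc_integral_holomorphic: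
  fixes \<phi> :: "real \<Rightarrow> complex" and f :: "real \<Rightarrow> real"
  assumes \<phi>: "continuous_on UNIV \<phi>" and f: "continuous_on UNIV f"
  shows "(\<lambda>z. integral {c..d} (\<lambda>t. \<phi> t * disc_ftc (z * of_real (f t)))) holomorphic_on UNIV"
proof -
  have d: "(disc_ftc has_field_derivative deriv disc_ftc z) (at z)" for z
    using disc_ftc_holomorphic by (intro holomorphic_derivI[OF _ open_UNIV]) auto
  have c: "continuous_on UNIV disc_ftc" "continuous_on UNIV (deriv disc_ftc)"
    using disc_ftc_holomorphic by (auto intro!: holomorphic_on_imp_continuous_on holomorphic_deriv)
  have "((\<lambda>z. integral (cbox c d) (\<lambda>t. \<phi> t * disc_ftc (z * of_real (f t)))) has_field_derivative
     integral (cbox c d) (\<lambda>t. \<phi> t * (deriv disc_ftc (z * of_real (f t)) * of_real (f t)))) (at z within UNIV)" for z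
  proof (rule leibniz_rule_field_derivative)
    show "((\<lambda>z. \<phi> t * disc_ftc (z * of_real (f t))) has_field_derivative \<phi> t * (deriv disc_ftc (z * of_real (f t)) * of_real (f t))) (at z within UNIV)" for z t
      by (intro DERIV_cmult DERIV_chain2[OF d]) (auto intro!: derivative_eq_intros)
    show "(\<lambda>t. \<phi> t * disc_ftc (z * of_real (f t))) integrable_on cbox c d" for z
      unfolding interval_cbox[symmetric]
      by (intro integrable_continuous_real continuous_intros continuous_on_compose2[OF c(1)]
          continuous_on_subset[OF \<phi>] continuous_on_subset[OF f]) auto
    show "continuous_on (UNIV \<times> cbox c d) (\<lambda>(z, t). \<phi> t * (deriv disc_ftc (z * of_real (f t)) * of_real (f t)))"
      unfolding case_prod_beta
      by (intro continuous_intros continuous_on_compose2[OF c(2)] continuous_on_compose2[OF \<phi>] continuous_on_compose2[OF f]) auto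
  qed auto
  then show ?thesis
    unfolding holomorphic_on_def field_differentiable_def by (auto intro: has_field_derivative_at_within)
qed

text \<open>An infinite bounded set of zeros has a limit point, so the identity theorem makes every wave
  number a zero.  Either way there are arbitrarily large zeros.\<close>

lemma unbounded_zeros:
  fixes \<phi> :: "real \<Rightarrow> complex" and f :: "'s \<Rightarrow> real \<Rightarrow> real"
  assumes \<phi>: "continuous_on UNIV \<phi>" and f: "\<And>s. continuous_on UNIV (f s)"
    and inf: "infinite K" and K: "\<And>k s. k \<in> K \<Longrightarrow> k > 0 \<and> integral {c..d} (\<lambda>t. \<phi> t * of_real (disc_ft (k * f s t))) = 0"
  shows "\<exists>k::nat \<Rightarrow> real. (\<forall>n. k n \<ge> 1) \<and> filterlim k at_top sequentially \<and>
    (\<forall>n s. integral {c..d} (\<lambda>t. \<phi> t * of_real (disc_ft (k n * f s t))) = 0)"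
proof -
  have "\<exists>x. x \<ge> real (Suc n) \<and> (\<forall>s. integral {c..d} (\<lambda>t. \<phi> t * of_real (disc_ft (x * f s t))) = 0)" for n
  proof (cases "bounded K")
    case True
    \<comment> \<open>The limit point may be 0, outside the range of wave numbers. This is harmless
      because the extended integral is holomorphic on the whole plane.\<close>
    obtain x where x: "x islimpt K" using bounded_infinite_imp_islimpt[OF order_refl True inf] by blast
    have xc: "of_real x islimpt (of_real ` K :: complex set)"
    proof (rule islimpt_approachable[THEN iffD2], intro allI impI)
      fix e :: real assume "e > 0"
      then obtain y where "y \<in> K" "y \<noteq> x" "dist y x < e" using x by (auto simp: islimpt_approachable)
      then show "\<exists>x'\<in>of_real ` K. x' \<noteq> complex_of_real x \<and> dist x' (complex_of_real x) < e"
        by (intro bexI[of _ "of_real y"]) auto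
    qed
    have "integral {c..d} (\<lambda>t. \<phi> t * of_real (disc_ft (real (Suc n) * f s t))) = 0" for s
    proof -
      let ?H = "\<lambda>z. integral {c..d} (\<lambda>t. \<phi> t * disc_ftc (z * of_real (f s t)))"
      have H: "?H (of_real k) = integral {c..d} (\<lambda>t. \<phi> t * of_real (disc_ft (k * f s t)))" for k
        by (simp only: of_real_mult[symmetric] disc_ftc_of_real)
      have "?H (of_real (real (Suc n))) = 0"
      proof (rule analytic_continuation[where f = "?H" and S = UNIV and U = "of_real ` K" and \<xi> = "of_real x"])
        show "?H holomorphic_on UNIV" by (rule disc_ftc_integral_holomorphic[OF \<phi> f])
        show "?H z = 0" if "z \<in> of_real ` K" for z using that K H by auto
      qed (use xc in auto)
      then show ?thesis by (simp only: H)
    qed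
    then show ?thesis by blast
  next
    case False
    then obtain k where k: "k \<in> K" "\<not> \<bar>k\<bar> \<le> real (Suc n)" unfolding bounded_real by blast
    moreover have "k > 0" using K[OF k(1)] by blast
    ultimately have "k \<ge> real (Suc n)" by simp
    then show ?thesis using K[OF k(1)] by blast
  qed
  then obtain k where k: "\<And>n. k n \<ge> real (Suc n)" "\<And>n s. integral {c..d} (\<lambda>t. \<phi> t * of_real (disc_ft (k n * f s t))) = 0"
    by metis
  have "filterlim k at_top sequentially"
  proof (rule filterlim_at_top_mono[OF filterlim_real_sequentially])
    have "real n \<le> k n" for n using k(1)[of n] by simp
    then show "\<forall>\<^sub>F n in sequentially. real n \<le> k n" by (intro always_eventually allI)
  qed
  moreover have "k n \<ge> 1" for n using k(1)[of n] by simp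
  ultimately show ?thesis using k(2) by blast
qed

section \<open>Weak solutions and plane waves\<close>

lemma pd_eqI: "(f has_derivative D) (at x) \<Longrightarrow> pd i f x = D (axis i 1)"
  unfolding pd_def using frechet_derivative_at by metis

text \<open>For \<open>P = 1\<close> this is the standard smooth function that vanishes on the
  negative half line. Carrying a polynomial along makes the family closed under differentiation: the
  derivative belongs to the polynomial \<open>X^2 * (P - P')\<close>.\<close>

definition flat :: "real poly \<Rightarrow> real \<Rightarrow> real" where
  "flat P t = (if t > 0 then poly P (1 / t) * exp (- 1 / t) else 0)"

lemma poly_exp_tendsto_0: "((\<lambda>y. poly P y / exp y) \<longlongrightarrow> 0) at_top" for P :: "real poly"
proof -
  have "((\<lambda>y. \<Sum>i\<le>degree P. coeff P i * (y ^ i / exp y)) \<longlongrightarrow> 0) at_top"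
    by (intro tendsto_null_sum tendsto_mult_right_zero tendsto_power_div_exp_0)
  then show ?thesis by (simp add: poly_altdef sum_divide_distrib)
qed

text \<open>Only \<open>t = 0\<close> is delicate. After the substitution \<open>y = 1 / t\<close>
  the difference quotient from the right is a polynomial in \<open>y\<close> divided by
  \<open>exp y\<close>.\<close>

lemma flat_deriv:
  "(flat P has_real_derivative flat ([:0, 0, 1:] * (P - pderiv P)) t) (at t)"
proof -
  consider "t > 0" | "t < 0" | "t = 0" by linarith
  then show ?thesis
  proof cases
    case 1
    have "((\<lambda>t. poly P (1 / t) * exp (- 1 / t)) has_real_derivative flat ([:0, 0, 1:] * (P - pderiv P)) t) (at t)"
      using 1 by (auto intro!: derivative_eq_intros simp: flat_def power2_eq_square field_simps)
    then show ?thesis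
    proof (rule DERIV_cong_ev[THEN iffD1, rotated -1])
      show "\<forall>\<^sub>F x in nhds t. poly P (1 / x) * exp (- 1 / x) = flat P x"
        using eventually_nhds_in_open[of "{0<..}" t] 1 by (auto elim!: eventually_mono simp: flat_def)
    qed auto
  next
    case 2
    have "((\<lambda>t. 0) has_real_derivative flat ([:0, 0, 1:] * (P - pderiv P)) t) (at t)"
      using 2 by (simp add: flat_def)
    then show ?thesis
    proof (rule DERIV_cong_ev[THEN iffD1, rotated -1])
      show "\<forall>\<^sub>F x in nhds t. 0 = flat P x"
        using eventually_nhds_in_open[of "{..<0}" t] 2 by (auto elim!: eventually_mono simp: flat_def)
    qed auto
  next
    case 3
    have "((\<lambda>h. flat P h / h) \<longlongrightarrow> 0) (at 0)"
    proof (rule filterlim_split_at)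
      have "((\<lambda>h. 0) \<longlongrightarrow> (0::real)) (at_left 0)" by simp
      then show "((\<lambda>h. flat P h / h) \<longlongrightarrow> 0) (at_left 0)"
        by (rule Lim_transform_eventually) (auto simp: eventually_at_filter flat_def)
      have "((\<lambda>y. poly ([:0, 1:] * P) y / exp y) \<longlongrightarrow> 0) at_top" by (rule poly_exp_tendsto_0)
      then have "((\<lambda>h. poly ([:0, 1:] * P) (inverse h) / exp (inverse h)) \<longlongrightarrow> 0) (at_right 0)"
        by (rule filterlim_compose[OF _ filterlim_inverse_at_top_right])
      then show "((\<lambda>h. flat P h / h) \<longlongrightarrow> 0) (at_right 0)"
        by (rule Lim_transform_eventually) (auto simp: eventually_at_filter flat_def exp_minus field_simps)
    qed
    then show ?thesis unfolding 3 by (simp add: has_field_derivative_iff flat_def)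
  qed
qed

text \<open>An algebra of real functions that is closed under partial derivatives and rich enough to
  contain plane waves and cut-off functions.\<close>

inductive_set smooth_alg :: "(real^2 \<Rightarrow> real) set" where
  const: "(\<lambda>x. c) \<in> smooth_alg"
| coord: "(\<lambda>x. x $ i) \<in> smooth_alg"
| add: "f \<in> smooth_alg \<Longrightarrow> g \<in> smooth_alg \<Longrightarrow> (\<lambda>x. f x + g x) \<in> smooth_alg"
| mult: "f \<in> smooth_alg \<Longrightarrow> g \<in> smooth_alg \<Longrightarrow> (\<lambda>x. f x * g x) \<in> smooth_alg"
| sin: "f \<in> smooth_alg \<Longrightarrow> (\<lambda>x. sin (f x)) \<in> smooth_alg"
| cos: "f \<in> smooth_alg \<Longrightarrow> (\<lambda>x. cos (f x)) \<in> smooth_alg"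
| flat: "f \<in> smooth_alg \<Longrightarrow> (\<lambda>x. flat P (f x)) \<in> smooth_alg"
| inverse: "f \<in> smooth_alg \<Longrightarrow> (\<And>x. f x \<noteq> 0) \<Longrightarrow> (\<lambda>x. inverse (f x)) \<in> smooth_alg"

lemma smooth_alg_minus: "f \<in> smooth_alg \<Longrightarrow> (\<lambda>x. - f x) \<in> smooth_alg"
  using smooth_alg.mult[OF smooth_alg.const[of "-1"]] by simp

lemma smooth_alg_diff: "f \<in> smooth_alg \<Longrightarrow> g \<in> smooth_alg \<Longrightarrow> (\<lambda>x. f x - g x) \<in> smooth_alg"
  using smooth_alg.add[OF _ smooth_alg_minus] by simp

lemma smooth_alg_power: "f \<in> smooth_alg \<Longrightarrow> (\<lambda>x. f x ^ n) \<in> smooth_alg"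
  by (induction n) (auto intro: smooth_alg.intros)

lemma smooth_alg_divide: "f \<in> smooth_alg \<Longrightarrow> (\<lambda>x. f x / c) \<in> smooth_alg"
  using smooth_alg.mult[OF _ smooth_alg.const[of "inverse c"]] by (simp add: divide_inverse)

lemmas smooth_alg_intros = smooth_alg.intros smooth_alg_minus smooth_alg_diff smooth_alg_power smooth_alg_divide

text \<open>The two claims are proved together: the product and chain rules describe the partial
  derivatives of a compound expression only once its parts are known to be differentiable. Iterating
  the result gives smoothness in the sense of \<open>iter_pd\<close>.\<close>

lemma smooth_alg_pd:
  assumes "f \<in> smooth_alg"
  shows "(\<forall>x. f differentiable (at x)) \<and> (\<forall>i. pd i f \<in> smooth_alg)"
proof -
  have *: "(\<forall>x. f differentiable (at x)) \<and> (\<forall>i. pd i f \<in> smooth_alg)"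
    if D: "\<And>x. (f has_derivative D x) (at x)" and alg: "\<And>i. (\<lambda>x. D x (axis i 1)) \<in> smooth_alg" for f :: "real^2 \<Rightarrow> real" and D
  proof (intro conjI allI)
    show "f differentiable (at x)" for x using D differentiableI by blast
    have "pd i f = (\<lambda>x. D x (axis i 1))" for i using D pd_eqI by blast
    then show "pd i f \<in> smooth_alg" for i using alg by simp
  qed
  have d: "(f has_derivative frechet_derivative f (at x)) (at x)" if "\<forall>x. f differentiable (at x)" for f :: "real^2 \<Rightarrow> real" and x
    using that frechet_derivative_works by blast
  show ?thesis
    using assms
  proof induction
    case (const c)
    show ?case by (rule *[where D = "\<lambda>x h. 0"]) (auto intro: smooth_alg.const)
  next
    case (coord i)
    show ?case by (rule *[where D = "\<lambda>x h. h $ i"])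
        (auto intro: smooth_alg.const bounded_linear_imp_has_derivative bounded_linear_vec_nth)
  next
    case (add f g)
    show ?case
    proof (rule *)
      show "((\<lambda>x. f x + g x) has_derivative (\<lambda>h. frechet_derivative f (at x) h + frechet_derivative g (at x) h)) (at x)" for x
        using add d by (intro has_derivative_add) auto
      show "(\<lambda>x. frechet_derivative f (at x) (axis i 1) + frechet_derivative g (at x) (axis i 1)) \<in> smooth_alg" for i
        using add smooth_alg.add[of "pd i f" "pd i g"] by (simp add: pd_def[abs_def])
    qed
  next
    case (mult f g)
    show ?case
    proof (rule *)
      show "((\<lambda>x. f x * g x) has_derivative (\<lambda>h. f x * frechet_derivative g (at x) h + frechet_derivative f (at x) h * g x)) (at x)" for x
        using mult d by (intro has_derivative_mult) auto
      show "(\<lambda>x. f x * frechet_derivative g (at x) (axis i 1) + frechet_derivative f (at x) (axis i 1) * g x) \<in> smooth_alg" for i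
        using mult smooth_alg.add[OF smooth_alg.mult[of f "pd i g"] smooth_alg.mult[of "pd i f" g]] by (simp add: pd_def[abs_def])
    qed
  next
    case (sin f)
    show ?case
    proof (rule *)
      show "((\<lambda>x. sin (f x)) has_derivative (\<lambda>h. frechet_derivative f (at x) h * cos (f x))) (at x)" for x
        using sin d by (intro has_derivative_sin) auto
      show "(\<lambda>x. frechet_derivative f (at x) (axis i 1) * cos (f x)) \<in> smooth_alg" for i
        using sin smooth_alg.mult[OF _ smooth_alg.cos, of "pd i f" f] by (simp add: pd_def[abs_def])
    qed
  next
    case (cos f)
    show ?case
    proof (rule *)
      show "((\<lambda>x. cos (f x)) has_derivative (\<lambda>h. frechet_derivative f (at x) h * - sin (f x))) (at x)" for x
        using cos d by (intro has_derivative_cos) auto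
      show "(\<lambda>x. frechet_derivative f (at x) (axis i 1) * - sin (f x)) \<in> smooth_alg" for i
        using cos smooth_alg.mult[OF _ smooth_alg_minus[OF smooth_alg.sin], of "pd i f" f] by (simp add: pd_def[abs_def])
    qed
  next
    case (flat f P)
    let ?P = "[:0, 0, 1:] * (P - pderiv P)"
    show ?case
    proof (rule *)
      show "((\<lambda>x. flat P (f x)) has_derivative (\<lambda>h. frechet_derivative f (at x) h * flat ?P (f x))) (at x)" for x
        using flat d has_derivative_compose[of f "frechet_derivative f (at x)" x UNIV "flat P" "\<lambda>h. h * flat ?P (f x)"] flat_deriv[of P "f x"]
        by (simp add: has_field_derivative_def mult_commute_abs)
      show "(\<lambda>x. frechet_derivative f (at x) (axis i 1) * flat ?P (f x)) \<in> smooth_alg" for i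
        using flat smooth_alg.mult[OF _ smooth_alg.flat, of "pd i f" f ?P] by (simp add: pd_def[abs_def])
    qed
  next
    case (inverse f)
    show ?case
    proof (rule *)
      show "((\<lambda>x. inverse (f x)) has_derivative (\<lambda>h. - (inverse (f x) * frechet_derivative f (at x) h * inverse (f x)))) (at x)" for x
        using inverse d by (intro Deriv.has_derivative_inverse) auto
      show "(\<lambda>x. - (inverse (f x) * frechet_derivative f (at x) (axis i 1) * inverse (f x))) \<in> smooth_alg" for i
        using inverse smooth_alg_minus[OF smooth_alg.mult[OF smooth_alg.mult[OF smooth_alg.inverse _] smooth_alg.inverse], of f "pd i f" f]
        by (simp add: pd_def[abs_def])
    qed
  qed
qed

lemma smooth_alg_differentiable: "f \<in> smooth_alg \<Longrightarrow> f differentiable (at x)"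
  and smooth_alg_pd_in: "f \<in> smooth_alg \<Longrightarrow> pd i f \<in> smooth_alg"
  using smooth_alg_pd by blast+

lemma smooth_alg_continuous: "f \<in> smooth_alg \<Longrightarrow> continuous_on S f"
  by (simp add: continuous_at_imp_continuous_on differentiable_imp_continuous_within smooth_alg_differentiable)

lemma smooth_alg_smooth: assumes "f \<in> smooth_alg" shows "smooth f"
proof -
  have "iter_pd is f \<in> smooth_alg" for "is" using assms by (induction "is") (auto intro: smooth_alg_pd_in)
  then show ?thesis
    unfolding smooth_def by (meson differentiable_at_imp_differentiable_on smooth_alg_differentiable)
qed

lemma smooth_differentiable:
  assumes "smooth f" shows "f differentiable (at x)" "pd i f differentiable (at x)"
proof -
  have "iter_pd is f differentiable (at x)" for "is"
    using assms unfolding smooth_def differentiable_on_def by auto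
  from this[of "[]"] this[of "[i]"] show "f differentiable (at x)" "pd i f differentiable (at x)" by auto
qed

lemma pd_mult_of_real:
  fixes f :: "real^2 \<Rightarrow> complex" and g :: "real^2 \<Rightarrow> real"
  assumes "f differentiable (at x)" "g differentiable (at x)"
  shows "((\<lambda>x. f x * of_real (g x)) differentiable (at x))"
    "pd i (\<lambda>x. f x * of_real (g x)) x = f x * of_real (pd i g x) + pd i f x * of_real (g x)"
proof -
  have "((\<lambda>x. f x * of_real (g x)) has_derivative
      (\<lambda>h. f x * of_real (frechet_derivative g (at x) h) + frechet_derivative f (at x) h * of_real (g x))) (at x)"
    using assms by (intro has_derivative_mult has_derivative_of_real) (simp_all add: frechet_derivative_works)
  then show "((\<lambda>x. f x * of_real (g x)) differentiable (at x))"
    "pd i (\<lambda>x. f x * of_real (g x)) x = f x * of_real (pd i g x) + pd i f x * of_real (g x)"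
    by (auto intro: differentiableI simp: pd_eqI pd_def[symmetric])
qed

text \<open>The difference quotients have integral zero by translation invariance, so no iterated
  integration is needed.\<close>

lemma integral_pd_eq_0:
  fixes \<Psi> :: "real^2 \<Rightarrow> complex"
  assumes diff: "\<And>x. \<Psi> differentiable (at x)" and cont: "continuous_on UNIV (pd i \<Psi>)"
    and K: "compact K" "\<And>x. x \<notin> K \<Longrightarrow> \<Psi> x = 0"
  shows "integral\<^sup>L lborel (pd i \<Psi>) = 0"
proof -
  define e :: "real^2" where "e = axis i 1"
  have ne: "norm e = 1" by (simp add: e_def)
  have c\<Psi>: "continuous_on UNIV \<Psi>"
    using diff by (simp add: continuous_at_imp_continuous_on differentiable_imp_continuous_within)
  have pd0: "pd i \<Psi> x = 0" if "x \<notin> K" for x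
  proof -
    have "((\<lambda>x. 0) has_derivative (\<lambda>h. 0)) (at x)" by simp
    then have "(\<Psi> has_derivative (\<lambda>h. 0)) (at x)"
      by (rule has_derivative_transform_within_open[of _ _ _ _ "- K"])
         (use that K compact_imp_closed in auto)
    then show ?thesis by (rule pd_eqI)
  qed
  obtain M where M: "M > 0" "\<And>x. norm (pd i \<Psi> x) \<le> M"
  proof -
    have "bounded (pd i \<Psi> ` K)" using K cont by (intro compact_imp_bounded compact_continuous_image) (auto intro: continuous_on_subset)
    then obtain M where "M > 0" "\<And>x. x \<in> K \<Longrightarrow> norm (pd i \<Psi> x) \<le> M" by (auto simp: bounded_pos)
    then show ?thesis using that[of M] pd0 by (metis less_imp_le norm_zero)
  qed
  obtain R where R: "R > 0" "\<And>x. x \<in> K \<Longrightarrow> norm x \<le> R" using compact_imp_bounded[OF K(1)] by (auto simp: bounded_pos)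
  have dline: "((\<lambda>t. \<Psi> (x + t *\<^sub>R e)) has_vector_derivative pd i \<Psi> (x + t *\<^sub>R e)) (at t)" for x t
  proof -
    have "((\<lambda>t. x + t *\<^sub>R e) has_vector_derivative e) (at t)"
      by (auto intro!: derivative_eq_intros)
    moreover have "(\<Psi> has_derivative frechet_derivative \<Psi> (at (x + t *\<^sub>R e))) (at (x + t *\<^sub>R e))"
      using diff frechet_derivative_works by blast
    ultimately show ?thesis
      using vector_derivative_diff_chain_within[of "\<lambda>t. x + t *\<^sub>R e" e t UNIV \<Psi> "frechet_derivative \<Psi> (at (x + t *\<^sub>R e))"]
      by (simp add: o_def pd_def e_def has_derivative_at_withinI)
  qed
  define Q where "Q n x = real (Suc n) *\<^sub>R (\<Psi> (x + (1 / real (Suc n)) *\<^sub>R e) - \<Psi> x)" for n x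
  have bQ: "norm (Q n x) \<le> M" for n x
  proof -
    have "norm (\<Psi> (x + (1 / real (Suc n)) *\<^sub>R e) - \<Psi> (x + 0 *\<^sub>R e)) \<le> M * (1 / real (Suc n)) - M * 0"
    proof (rule differentiable_bound_general[where f = "\<lambda>t. \<Psi> (x + t *\<^sub>R e)" and f' = "\<lambda>t. pd i \<Psi> (x + t *\<^sub>R e)" and \<phi>' = "\<lambda>t. M"])
      show "continuous_on {0..1 / real (Suc n)} (\<lambda>t. \<Psi> (x + t *\<^sub>R e))"
        by (rule continuous_on_vector_derivative) (rule has_vector_derivative_at_within[OF dline])
      show "((*) M has_vector_derivative M) (at y)" for y
        unfolding has_real_derivative_iff_has_vector_derivative[symmetric] by (auto intro!: derivative_eq_intros)
    qed (auto intro!: continuous_intros dline M)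
    then have "norm (\<Psi> (x + (1 / real (Suc n)) *\<^sub>R e) - \<Psi> x) \<le> M / real (Suc n)" by simp
    then show ?thesis unfolding Q_def norm_scaleR by (simp add: pos_le_divide_eq mult.commute)
  qed
  \<comment> \<open>A shift by at most 1 keeps the support inside the ball of radius
    \<open>R + 1\<close>, independently of \<open>n\<close>; this ball carries the dominating
    function.\<close>
  have zQ: "Q n x = 0" if "norm x > R + 1" for n x
  proof -
    have "x \<notin> K" using R(2)[of x] that by auto
    moreover have "x + (1 / real (Suc n)) *\<^sub>R e \<notin> K"
    proof
      assume "x + (1 / real (Suc n)) *\<^sub>R e \<in> K"
      then have "norm (x + (1 / real (Suc n)) *\<^sub>R e) \<le> R" by (rule R(2))
      moreover have "norm x \<le> norm (x + (1 / real (Suc n)) *\<^sub>R e) + norm ((1 / real (Suc n)) *\<^sub>R e)"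
        using norm_triangle_ineq4[of "x + (1 / real (Suc n)) *\<^sub>R e" "(1 / real (Suc n)) *\<^sub>R e"] by simp
      moreover have "norm ((1 / real (Suc n)) *\<^sub>R e) \<le> 1" using ne by simp
      ultimately show False using that by linarith
    qed
    ultimately show ?thesis using K(2) by (simp add: Q_def)
  qed
  have "(\<lambda>n. integral\<^sup>L lborel (Q n)) \<longlonglongrightarrow> integral\<^sup>L lborel (pd i \<Psi>)"
  proof (rule integral_dominated_convergence[where w = "\<lambda>x. indicator (cball 0 (R + 1)) x * M"])
    show "pd i \<Psi> \<in> borel_measurable lborel" using cont borel_measurable_continuous_onI by auto
    show "Q n \<in> borel_measurable lborel" for n
      unfolding Q_def[abs_def] using c\<Psi>
      by (auto intro!: borel_measurable_continuous_onI continuous_intros continuous_on_compose2[OF c\<Psi>])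
    show "integrable lborel (\<lambda>x::real^2. indicator (cball 0 (R + 1)) x * M)"
      by (intro integrable_mult_left integrable_real_indicator) (use emeasure_bounded_finite[OF bounded_cball, of "0::real^2" "R + 1"] in auto)
    show "AE x in lborel. norm (Q n x) \<le> indicator (cball 0 (R + 1)) x * M" for n
      using bQ zQ by (intro AE_I2) (auto simp: indicator_def not_le)
    show "AE x in lborel. (\<lambda>n. Q n x) \<longlonglongrightarrow> pd i \<Psi> x"
    proof (rule AE_I2)
      fix x
      have "((\<lambda>h. norm (\<Psi> (x + h *\<^sub>R e) - \<Psi> x - h *\<^sub>R pd i \<Psi> x) / norm h) \<longlongrightarrow> 0) (at 0)"
        using dline[of x 0] by (simp add: has_vector_derivative_def has_derivative_at)
      moreover have "filterlim (\<lambda>n. 1 / real (Suc n)) (at 0) sequentially"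
        using LIMSEQ_Suc[OF lim_1_over_n] by (simp add: filterlim_at)
      ultimately have "(\<lambda>n. norm (\<Psi> (x + (1 / real (Suc n)) *\<^sub>R e) - \<Psi> x - (1 / real (Suc n)) *\<^sub>R pd i \<Psi> x)
          / norm (1 / real (Suc n))) \<longlonglongrightarrow> 0"
        by (rule filterlim_compose)
      moreover have "norm (\<Psi> (x + (1 / real (Suc n)) *\<^sub>R e) - \<Psi> x - (1 / real (Suc n)) *\<^sub>R pd i \<Psi> x)
          / norm (1 / real (Suc n)) = norm (Q n x - pd i \<Psi> x)" for n
      proof -
        have "Q n x - pd i \<Psi> x = real (Suc n) *\<^sub>R (\<Psi> (x + (1 / real (Suc n)) *\<^sub>R e) - \<Psi> x - (1 / real (Suc n)) *\<^sub>R pd i \<Psi> x)"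
          unfolding Q_def scaleR_diff_right by simp
        then show ?thesis by (simp only: norm_scaleR) (simp add: divide_simps)
      qed
      ultimately have "(\<lambda>n. norm (Q n x - pd i \<Psi> x)) \<longlonglongrightarrow> 0" by (simp only:)
      from LIM_zero_cancel[OF tendsto_norm_zero_cancel[OF this]] show "(\<lambda>n. Q n x) \<longlonglongrightarrow> pd i \<Psi> x" .
    qed
  qed
  moreover have "integral\<^sup>L lborel (Q n) = 0" for n
  proof -
    let ?c = "(1 / real (Suc n)) *\<^sub>R e"
    have i: "integrable lborel \<Psi>"
    proof -
      have "integrable lborel (\<lambda>x. indicator K x *\<^sub>R \<Psi> x)"
        by (rule borel_integrable_compact[OF K(1) continuous_on_subset[OF c\<Psi> subset_UNIV]])
      moreover have "(\<lambda>x. indicator K x *\<^sub>R \<Psi> x) = \<Psi>" using K(2) by (auto simp: indicator_def)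
      ultimately show ?thesis by simp
    qed
    have eq: "distr lborel borel ((+) ?c) = lborel" by (rule lborel_distr_plus)
    have m: "\<Psi> \<in> borel_measurable borel" using c\<Psi> by (rule borel_measurable_continuous_onI)
    have i': "integrable lborel (\<lambda>x. \<Psi> (?c + x))"
      using i integrable_distr_eq[of "(+) ?c" lborel borel \<Psi>] m eq by simp
    have "integral\<^sup>L lborel (\<lambda>x. \<Psi> (?c + x)) = integral\<^sup>L lborel \<Psi>"
      using integral_distr[of "(+) ?c" lborel borel \<Psi>] m eq by simp
    then show ?thesis
      unfolding Q_def using i i' by (simp add: add.commute)
  qed
  ultimately show ?thesis by (simp add: LIMSEQ_const_iff)
qed

section \<open>Cut-off functions adapted to the ellipse\<close>

definition ell_form :: "real \<Rightarrow> real \<Rightarrow> real \<Rightarrow> real^2 \<Rightarrow> real" where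
  "ell_form a b \<alpha> x = ((cos \<alpha> * x$1 + sin \<alpha> * x$2) / a)\<^sup>2 + ((- sin \<alpha> * x$1 + cos \<alpha> * x$2) / b)\<^sup>2"

lemma ellipse_eq: "ellipse a b \<alpha> = {x. ell_form a b \<alpha> x < 1}"
  by (simp add: ellipse_def ell_form_def)

lemma ell_form_smooth_alg: "ell_form a b \<alpha> \<in> smooth_alg"
  unfolding ell_form_def[abs_def] by (intro smooth_alg_intros)

lemma continuous_ell_form: "continuous_on S (ell_form a b \<alpha>)"
  by (rule smooth_alg_continuous[OF ell_form_smooth_alg])

lemma compact_ell_form_le:
  assumes "0 < a" "0 < b" shows "compact {x. ell_form a b \<alpha> x \<le> r}"
proof -
  have "norm x \<le> sqrt ((a\<^sup>2 + b\<^sup>2) * r)" if "ell_form a b \<alpha> x \<le> r" for x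
  proof -
    define s t where "s = cos \<alpha> * x$1 + sin \<alpha> * x$2" and "t = - sin \<alpha> * x$1 + cos \<alpha> * x$2"
    have "(norm x)\<^sup>2 = (x$1)\<^sup>2 + (x$2)\<^sup>2"
      by (simp add: norm_vec_def L2_set_def sum_2)
    also have "\<dots> = ((x$1)\<^sup>2 + (x$2)\<^sup>2) * ((cos \<alpha>)\<^sup>2 + (sin \<alpha>)\<^sup>2)" by simp
    also have "\<dots> = s\<^sup>2 + t\<^sup>2" unfolding s_def t_def by algebra
    also have "\<dots> = a\<^sup>2 * (s / a)\<^sup>2 + b\<^sup>2 * (t / b)\<^sup>2" using assms by (simp add: power_divide)
    also have "\<dots> \<le> (a\<^sup>2 + b\<^sup>2) * (s / a)\<^sup>2 + (a\<^sup>2 + b\<^sup>2) * (t / b)\<^sup>2"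
      by (intro add_mono mult_right_mono) auto
    also have "\<dots> = (a\<^sup>2 + b\<^sup>2) * ell_form a b \<alpha> x" by (simp add: ell_form_def s_def t_def distrib_left)
    also have "\<dots> \<le> (a\<^sup>2 + b\<^sup>2) * r" using that by (intro mult_left_mono) auto
    finally show ?thesis by (rule real_le_rsqrt)
  qed
  then have "bounded {x. ell_form a b \<alpha> x \<le> r}" by (auto simp: bounded_iff)
  moreover have "closed {x. ell_form a b \<alpha> x \<le> r}"
    by (intro closed_Collect_le continuous_ell_form continuous_on_const)
  ultimately show ?thesis by (simp add: compact_eq_bounded_closed)
qed

lemma open_ellipse: "open (ellipse a b \<alpha>)"
  unfolding ellipse_eq by (intro open_Collect_less continuous_ell_form continuous_on_const)

lemma test_fun_smooth_alg:
  assumes "0 < a" "0 < b" "f \<in> smooth_alg" "\<And>x. f x \<noteq> 0 \<Longrightarrow> ell_form a b \<alpha> x \<le> r"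
    and "{x. ell_form a b \<alpha> x \<le> r} \<subseteq> S"
  shows "test_fun S f"
proof -
  have "closure {x. f x \<noteq> 0} \<subseteq> {x. ell_form a b \<alpha> x \<le> r}"
    using compact_ell_form_le[OF assms(1,2)] assms(4) by (intro closure_minimal) (auto simp: compact_imp_closed)
  moreover from this have "compact (closure {x. f x \<noteq> 0})"
    using compact_ell_form_le[OF assms(1,2)] by (metis closed_closure compact_Int_closed inf.absorb_iff2)
  ultimately show ?thesis
    using assms(3,5) smooth_alg_smooth by (auto simp: test_fun_def)
qed

text \<open>The values are below 1 and approach 1 at each point of the ellipse as \<open>n\<close>
  grows; with the uniform bound this suits dominated convergence. The summand -1 keeps the support
  inside the sublevel set at \<open>1 - 1 / Suc n\<close>, a compact subset of the open
  ellipse.\<close>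

definition inner_cutoff :: "real \<Rightarrow> real \<Rightarrow> real \<Rightarrow> nat \<Rightarrow> real^2 \<Rightarrow> real" where
  "inner_cutoff a b \<alpha> n x = flat 1 (real (Suc n) * (1 - ell_form a b \<alpha> x) - 1)"

lemma inner_cutoff_smooth_alg: "inner_cutoff a b \<alpha> n \<in> smooth_alg"
  unfolding inner_cutoff_def[abs_def] by (intro smooth_alg_intros ell_form_smooth_alg)

lemma inner_cutoff_support:
  assumes "inner_cutoff a b \<alpha> n x \<noteq> 0" shows "ell_form a b \<alpha> x \<le> 1 - 1 / real (Suc n)"
proof -
  have "1 < real (Suc n) * (1 - ell_form a b \<alpha> x)"
    using assms by (simp add: inner_cutoff_def flat_def split: if_splits)
  then have "1 / real (Suc n) < 1 - ell_form a b \<alpha> x" by (simp add: pos_divide_less_eq mult.commute del: of_nat_Suc)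
  then show ?thesis by simp
qed

lemma inner_cutoff_le_1: "\<bar>inner_cutoff a b \<alpha> n x\<bar> \<le> 1"
  by (simp add: inner_cutoff_def flat_def)

lemma inner_cutoff_tendsto:
  assumes "x \<in> ellipse a b \<alpha>" shows "(\<lambda>n. inner_cutoff a b \<alpha> n x) \<longlonglongrightarrow> 1"
proof -
  define d where "d = 1 - ell_form a b \<alpha> x"
  have d: "d > 0" using assms by (simp add: d_def ellipse_eq)
  have "filterlim (\<lambda>n. real (Suc n)) at_top sequentially"
    by (rule filterlim_compose[OF filterlim_real_sequentially filterlim_Suc])
  from filterlim_at_top_mult_tendsto_pos[OF tendsto_const d this]
  have "filterlim (\<lambda>n. real (Suc n) * d) at_top sequentially" by simp
  from filterlim_tendsto_add_at_top[OF tendsto_const[of "-1"] this]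
  have t: "filterlim (\<lambda>n. real (Suc n) * d - 1) at_top sequentially" by simp
  have "(\<lambda>n. exp (- 1 / (real (Suc n) * d - 1))) \<longlonglongrightarrow> exp 0"
    by (intro tendsto_exp tendsto_divide_0[OF tendsto_const] filterlim_at_top_imp_at_infinity t)
  moreover have "\<forall>\<^sub>F n in sequentially. exp (- 1 / (real (Suc n) * d - 1)) = inner_cutoff a b \<alpha> n x"
    using t unfolding filterlim_at_top_dense
    by (auto elim!: eventually_mono[OF spec[of _ 0]] simp: inner_cutoff_def flat_def d_def[symmetric])
  ultimately show ?thesis by (simp add: Lim_transform_eventually)
qed

text \<open>The quotient form makes the function identically 1 on the closed ellipse, where the
  second summand of the denominator vanishes. It gives plane waves compact support, so that they can
  be inserted into the weak Neumann condition, which is tested on the whole plane.\<close>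

definition outer_cutoff :: "real \<Rightarrow> real \<Rightarrow> real \<Rightarrow> real^2 \<Rightarrow> real" where
  "outer_cutoff a b \<alpha> x = flat 1 (2 - ell_form a b \<alpha> x)
     * inverse (flat 1 (2 - ell_form a b \<alpha> x) + flat 1 (ell_form a b \<alpha> x - 1))"

lemma outer_cutoff_smooth_alg: "outer_cutoff a b \<alpha> \<in> smooth_alg"
proof -
  have "flat 1 (2 - t) + flat 1 (t - 1) \<noteq> 0" for t
    by (auto simp: flat_def add_nonneg_eq_0_iff)
  then show ?thesis
    unfolding outer_cutoff_def[abs_def] by (intro smooth_alg_intros ell_form_smooth_alg)
qed

lemma outer_cutoff_eq_1: "ell_form a b \<alpha> x \<le> 1 \<Longrightarrow> outer_cutoff a b \<alpha> x = 1"
  by (simp add: outer_cutoff_def flat_def)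

lemma outer_cutoff_support: "outer_cutoff a b \<alpha> x \<noteq> 0 \<Longrightarrow> ell_form a b \<alpha> x \<le> 2"
  by (rule ccontr) (simp add: outer_cutoff_def flat_def)

section \<open>Square integrable functions on the ellipse\<close>

lemma L2_imp_integrable:
  assumes "finite_measure (lebesgue_on \<Omega>)" "L2 \<Omega> u" shows "integrable (lebesgue_on \<Omega>) u"
proof (rule Bochner_Integration.integrable_bound[where f = "\<lambda>x. 1 + (norm (u x))\<^sup>2"])
  show "integrable (lebesgue_on \<Omega>) (\<lambda>x. 1 + (norm (u x))\<^sup>2)"
    using assms by (intro Bochner_Integration.integrable_add finite_measure.integrable_const) (auto simp: L2_def)
  have "norm (u x) \<le> 1 + (norm (u x))\<^sup>2" for x
  proof (cases "norm (u x) \<le> 1")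
    case False
    then have "norm (u x) * 1 \<le> norm (u x) * norm (u x)" by (intro mult_left_mono) auto
    then show ?thesis by (simp add: power2_eq_square)
  qed (simp add: add_increasing2)
  then show "AE x in lebesgue_on \<Omega>. norm (u x) \<le> norm (1 + (norm (u x))\<^sup>2)"
    by (auto intro!: AE_I2 intro: order_trans[OF _ abs_ge_self])
qed (use assms in \<open>auto simp: L2_def\<close>)

lemma L2_diff:
  assumes "L2 \<Omega> u" "L2 \<Omega> v" shows "L2 \<Omega> (\<lambda>x. u x - v x)"
  unfolding L2_def
proof
  show m: "(\<lambda>x. u x - v x) \<in> borel_measurable (lebesgue_on \<Omega>)"
    using assms by (intro borel_measurable_diff) (auto simp: L2_def)
  show "integrable (lebesgue_on \<Omega>) (\<lambda>x. (norm (u x - v x))\<^sup>2)"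
  proof (rule Bochner_Integration.integrable_bound[where f = "\<lambda>x. 2 * (norm (u x))\<^sup>2 + 2 * (norm (v x))\<^sup>2"])
    show "integrable (lebesgue_on \<Omega>) (\<lambda>x. 2 * (norm (u x))\<^sup>2 + 2 * (norm (v x))\<^sup>2)"
      using assms by (intro Bochner_Integration.integrable_add integrable_mult_right) (auto simp: L2_def)
    have "(norm (u x - v x))\<^sup>2 \<le> 2 * (norm (u x))\<^sup>2 + 2 * (norm (v x))\<^sup>2" for x
    proof -
      have "(norm (u x - v x))\<^sup>2 \<le> (norm (u x) + norm (v x))\<^sup>2"
        by (intro power_mono norm_triangle_ineq4) auto
      also have "\<dots> \<le> 2 * (norm (u x))\<^sup>2 + 2 * (norm (v x))\<^sup>2"
        using sum_squares_bound[of "norm (u x)" "norm (v x)"] by (simp add: power2_sum)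
      finally show ?thesis .
    qed
    then show "AE x in lebesgue_on \<Omega>. norm ((norm (u x - v x))\<^sup>2) \<le> norm (2 * (norm (u x))\<^sup>2 + 2 * (norm (v x))\<^sup>2)"
      by (auto intro!: AE_I2 intro: order_trans[OF _ abs_ge_self])
  qed (use m in measurable)
qed

text \<open>The inequality \<open>r \<le> e + r^2 / e\<close> for \<open>e > 0\<close>, integrated
  over a set of finite measure, plays the part of the Cauchy-Schwarz inequality. The error is a
  constant times \<open>e\<close> plus a constant times \<open>A n / e\<close>, and \<open>e\<close>
  is fixed before \<open>n\<close>.\<close>

lemma L2_tendsto_integral:
  fixes w :: "real^2 \<Rightarrow> complex" and \<psi> :: "nat \<Rightarrow> real^2 \<Rightarrow> complex" and f :: "real^2 \<Rightarrow> real"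
  assumes fin: "finite_measure (lebesgue_on \<Omega>)" and w: "L2 \<Omega> w" and \<psi>: "\<And>n. L2 \<Omega> (\<psi> n)"
    and A: "\<And>n. integral\<^sup>L (lebesgue_on \<Omega>) (\<lambda>x. (norm (w x - \<psi> n x))\<^sup>2) \<le> A n" "A \<longlonglongrightarrow> 0"
    and f: "f \<in> borel_measurable (lebesgue_on \<Omega>)" "\<And>x. x \<in> space (lebesgue_on \<Omega>) \<Longrightarrow> \<bar>f x\<bar> \<le> B"
  shows "(\<lambda>n. integral\<^sup>L (lebesgue_on \<Omega>) (\<lambda>x. \<psi> n x * of_real (f x)))
     \<longlonglongrightarrow> integral\<^sup>L (lebesgue_on \<Omega>) (\<lambda>x. w x * of_real (f x))"
proof -
  let ?M = "lebesgue_on \<Omega>"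
  interpret finite_measure ?M by (rule fin)
  define B' where "B' = max B 1"
  have B': "B' > 0" "\<And>x. x \<in> space ?M \<Longrightarrow> \<bar>f x\<bar> \<le> B'" using f(2) by (force simp: B'_def)+
  have int: "integrable ?M (\<lambda>x. u x * of_real (f x))" if u: "L2 \<Omega> u" for u
  proof (rule Bochner_Integration.integrable_bound[where f = "\<lambda>x. B' *\<^sub>R u x"])
    show "integrable ?M (\<lambda>x. B' *\<^sub>R u x)" using L2_imp_integrable[OF fin u] by simp
    show "(\<lambda>x. u x * of_real (f x)) \<in> borel_measurable ?M" using u f by (auto simp: L2_def)
    show "AE x in ?M. norm (u x * of_real (f x)) \<le> norm (B' *\<^sub>R u x)"
      using B' by (auto intro!: AE_I2 simp: norm_mult mult.commute[of B'] intro!: mult_left_mono)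
  qed
  have bound: "norm (integral\<^sup>L ?M (\<lambda>x. \<psi> n x * of_real (f x)) - integral\<^sup>L ?M (\<lambda>x. w x * of_real (f x)))
     \<le> B' * (e * measure ?M (space ?M) + A n / e)" if e: "e > 0" for n e
  proof -
    have d: "L2 \<Omega> (\<lambda>x. w x - \<psi> n x)" by (rule L2_diff[OF w \<psi>])
    have "norm (integral\<^sup>L ?M (\<lambda>x. \<psi> n x * of_real (f x)) - integral\<^sup>L ?M (\<lambda>x. w x * of_real (f x)))
       = norm (integral\<^sup>L ?M (\<lambda>x. w x * of_real (f x)) - integral\<^sup>L ?M (\<lambda>x. \<psi> n x * of_real (f x)))"
      by (rule norm_minus_commute)
    also have "integral\<^sup>L ?M (\<lambda>x. w x * of_real (f x)) - integral\<^sup>L ?M (\<lambda>x. \<psi> n x * of_real (f x))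
       = integral\<^sup>L ?M (\<lambda>x. (w x - \<psi> n x) * of_real (f x))"
      using int[OF w] int[OF \<psi>[of n]] by (simp add: left_diff_distrib)
    also have "norm (integral\<^sup>L ?M (\<lambda>x. (w x - \<psi> n x) * of_real (f x)))
        \<le> integral\<^sup>L ?M (\<lambda>x. B' * (e + (norm (w x - \<psi> n x))\<^sup>2 / e))"
    proof (rule Bochner_Integration.integral_norm_bound_integral)
      show "integrable ?M (\<lambda>x. (w x - \<psi> n x) * of_real (f x))" by (rule int[OF d])
      show "integrable ?M (\<lambda>x. B' * (e + (norm (w x - \<psi> n x))\<^sup>2 / e))"
        using d by (auto simp: L2_def)
      fix x assume x: "x \<in> space ?M"
      let ?t = "norm (w x - \<psi> n x)"
      have "?t \<le> e + ?t\<^sup>2 / e"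
      proof (cases "?t \<le> e")
        case False
        then have "?t * e \<le> ?t * ?t" by (intro mult_left_mono) auto
        then have "?t \<le> ?t\<^sup>2 / e" using e by (simp add: pos_le_divide_eq power2_eq_square)
        then show ?thesis using e by simp
      qed (use e in \<open>simp add: add_increasing2\<close>)
      then have "?t * \<bar>f x\<bar> \<le> (e + ?t\<^sup>2 / e) * B'"
        using B'(2)[OF x] by (intro mult_mono) (use e in auto)
      then show "norm ((w x - \<psi> n x) * of_real (f x)) \<le> B' * (e + ?t\<^sup>2 / e)"
        by (simp add: norm_mult mult.commute)
    qed
    also have "integral\<^sup>L ?M (\<lambda>x. B' * (e + (norm (w x - \<psi> n x))\<^sup>2 / e))
        = B' * (e * measure ?M (space ?M) + integral\<^sup>L ?M (\<lambda>x. (norm (w x - \<psi> n x))\<^sup>2) / e)"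
      using d by (simp add: L2_def mult.commute)
    also have "\<dots> \<le> B' * (e * measure ?M (space ?M) + A n / e)"
      using A(1)[of n] B' e by (intro mult_left_mono add_left_mono divide_right_mono) auto
    finally show ?thesis .
  qed
  show ?thesis
  proof (rule LIMSEQ_I)
    fix r :: real assume r: "r > 0"
    define m where "m = measure ?M (space ?M)"
    have m: "m \<ge> 0" by (simp add: m_def)
    \<comment> \<open>Makes the first error term smaller than \<open>r / 2\<close>; the summand 1 in
      the denominator covers the case of measure zero.\<close>
    define e where "e = r / 2 / (m + 1) / B'"
    have e: "e > 0" using r B' m by (simp add: e_def)
    have 1: "B' * (e * m) < r / 2"
    proof -
      have "B' * (e * m) = r / 2 * (m / (m + 1))" using B' by (simp add: e_def)
      also have "\<dots> < r / 2 * 1" using r m by (intro mult_strict_left_mono) auto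
      finally show ?thesis by simp
    qed
    have "r * e / (2 * B') > 0" using r e B' by simp
    then have "\<forall>\<^sub>F n in sequentially. A n < r * e / (2 * B')" using A(2) by (rule order_tendstoD(2)[rotated])
    then obtain N where N: "\<And>n. n \<ge> N \<Longrightarrow> A n < r * e / (2 * B')" by (auto simp: eventually_sequentially)
    have "norm (integral\<^sup>L ?M (\<lambda>x. \<psi> n x * of_real (f x)) - integral\<^sup>L ?M (\<lambda>x. w x * of_real (f x))) < r" if n: "n \<ge> N" for n
    proof -
      have "B' * (A n / e) < r / 2" using N[OF n] B' e by (simp add: field_simps)
      then show ?thesis using bound[OF e, of n, folded m_def] 1 unfolding distrib_left by linarith
    qed
    then show "\<exists>N. \<forall>n\<ge>N. norm (integral\<^sup>L ?M (\<lambda>x. \<psi> n x * of_real (f x)) - integral\<^sup>L ?M (\<lambda>x. w x * of_real (f x))) < r" by blast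
  qed
qed

lemma pd_eq_0_outside:
  assumes "closed K" "\<And>x. x \<notin> K \<Longrightarrow> f x = 0" "x \<notin> K" shows "pd i f x = 0"
proof -
  have "((\<lambda>x. 0) has_derivative (\<lambda>h. 0)) (at x)" by simp
  then have "(f has_derivative (\<lambda>h. 0)) (at x)"
    by (rule has_derivative_transform_within_open[of _ _ _ _ "- K"]) (use assms in auto)
  then show ?thesis by (rule pd_eqI)
qed

lemma pd_cong_open:
  assumes "open S" "x \<in> S" "\<And>y. y \<in> S \<Longrightarrow> f y = g y" "g differentiable (at x)"
  shows "pd i f x = pd i g x"
proof -
  have g: "(g has_derivative frechet_derivative g (at x)) (at x)" using assms(4) frechet_derivative_works by blast
  then have "(f has_derivative frechet_derivative g (at x)) (at x)"
    by (rule has_derivative_transform_within_open[OF _ assms(1,2)]) (use assms(3) in auto)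
  then have "pd i f x = frechet_derivative g (at x) (axis i 1)" by (rule pd_eqI)
  then show ?thesis unfolding pd_def[of i g] .
qed

text \<open>A solution of the Helmholtz equation with wave number \<open>k * sqrt q\<close> is a test function for both
  sides of the transmission problem; subtracting the two Green identities leaves the incident wave.\<close>

lemma non_scattering_orthogonal:
  fixes a b \<alpha> q k :: real and W :: "real^2 \<Rightarrow> real"
  assumes ab: "0 < a" "0 < b" and ns: "non_scattering (ellipse a b \<alpha>) q k v"
    and W: "W \<in> smooth_alg" and helm: "\<And>x. (\<Sum>i\<in>UNIV. pd i (pd i W) x) = - (k\<^sup>2 * q) * W x"
  shows "of_real (k\<^sup>2 * (q - 1)) * integral\<^sup>L (lebesgue_on (ellipse a b \<alpha>)) (\<lambda>x. v x * of_real (W x)) = 0"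
proof -
  define \<Omega> where "\<Omega> = ellipse a b \<alpha>"
  let ?M = "lebesgue_on \<Omega>"
  have op: "open \<Omega>" unfolding \<Omega>_def by (rule open_ellipse)
  have meas: "\<Omega> \<in> sets lebesgue" using op by auto
  have sub: "\<Omega> \<subseteq> {x. ell_form a b \<alpha> x \<le> 1}" by (auto simp: \<Omega>_def ellipse_eq)
  have cpt: "compact {x. ell_form a b \<alpha> x \<le> 1}" by (rule compact_ell_form_le[OF ab])
  have "bounded \<Omega>" using sub cpt bounded_subset compact_imp_bounded by blast
  then have fin: "finite_measure ?M"
    by (intro finite_measure_lebesgue_on bounded_set_imp_lmeasurable meas)
  interpret finite_measure ?M by (rule fin)
  have bd: "\<exists>B>0. \<forall>x\<in>\<Omega>. norm (f x) \<le> B" if "continuous_on UNIV f" for f :: "real^2 \<Rightarrow> 'b::real_normed_vector"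
  proof -
    have "bounded (f ` {x. ell_form a b \<alpha> x \<le> 1})"
      using that by (intro compact_imp_bounded compact_continuous_image cpt) (auto intro: continuous_on_subset)
    then show ?thesis using sub by (fastforce simp: bounded_pos)
  qed
  have mc: "f \<in> borel_measurable ?M" if "continuous_on UNIV f" for f :: "real^2 \<Rightarrow> 'b::{real_normed_vector, second_countable_topology}"
    using that meas by (intro continuous_imp_measurable_on_sets_lebesgue) (auto intro: continuous_on_subset)
  have cSA: "continuous_on UNIV f" if "f \<in> smooth_alg" for f using that by (rule smooth_alg_continuous)
  have int: "integrable ?M (\<lambda>x. u x * of_real (f x))" if u: "L2 \<Omega> u" and f: "continuous_on UNIV f" for u and f :: "real^2 \<Rightarrow> real"
  proof -
    obtain B where B: "B > 0" "\<And>x. x \<in> \<Omega> \<Longrightarrow> norm (f x) \<le> B" using bd[OF f] by blast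
    show ?thesis
    proof (rule Bochner_Integration.integrable_bound[where f = "\<lambda>x. B *\<^sub>R u x"])
      show "integrable ?M (\<lambda>x. B *\<^sub>R u x)" using L2_imp_integrable[OF fin u] by simp
      show "(\<lambda>x. u x * of_real (f x)) \<in> borel_measurable ?M" using u mc[OF f] by (auto simp: L2_def)
      show "AE x in ?M. norm (u x * of_real (f x)) \<le> norm (B *\<^sub>R u x)"
        using B by (intro AE_I2) (simp add: norm_mult mult.commute[of B] mult_left_mono)
    qed
  qed
  have L2c: "L2 \<Omega> f" if f: "continuous_on UNIV f" for f :: "real^2 \<Rightarrow> complex"
    unfolding L2_def
  proof
    show "f \<in> borel_measurable ?M" by (rule mc[OF f])
    obtain B where B: "B > 0" "\<And>x. x \<in> \<Omega> \<Longrightarrow> norm (f x) \<le> B" using bd[OF f] by blast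
    show "integrable ?M (\<lambda>x. (norm (f x))\<^sup>2)"
      using B mc[OF f] by (intro integrable_const_bound[where B = "B\<^sup>2"]) (auto intro!: AE_I2 power_mono)
  qed
  from ns obtain u gu gv where u: "H1 \<Omega> u gu" and v: "H1 \<Omega> v gv" and w: "H10 \<Omega> (\<lambda>x. u x - v x)"
    and green: "\<And>\<phi>::real^2 \<Rightarrow> real. test_fun UNIV \<phi> \<Longrightarrow>
        integral\<^sup>L ?M (\<lambda>x. (\<Sum>i\<in>UNIV. gu x $ i * of_real (pd i \<phi> x)) - of_real (k\<^sup>2 * q) * u x * of_real (\<phi> x))
        = integral\<^sup>L ?M (\<lambda>x. (\<Sum>i\<in>UNIV. gv x $ i * of_real (pd i \<phi> x)) - of_real (k\<^sup>2) * v x * of_real (\<phi> x))"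
    unfolding non_scattering_def \<Omega>_def by blast
  from w obtain g0 and \<psi> :: "nat \<Rightarrow> real^2 \<Rightarrow> complex" where g0: "H1 \<Omega> (\<lambda>x. u x - v x) g0" and \<psi>: "\<And>n. test_fun \<Omega> (\<psi> n)"
    and lim: "(\<lambda>n. integral\<^sup>L ?M (\<lambda>x. (norm (u x - v x - \<psi> n x))\<^sup>2 + (\<Sum>i\<in>UNIV. (norm (g0 x $ i - pd i (\<psi> n) x))\<^sup>2))) \<longlonglongrightarrow> 0"
    unfolding H10_def by blast
  have Lu: "L2 \<Omega> u" "\<And>i. L2 \<Omega> (\<lambda>x. gu x $ i)" and Lv: "L2 \<Omega> v" "\<And>i. L2 \<Omega> (\<lambda>x. gv x $ i)"
    and Lw: "L2 \<Omega> (\<lambda>x. u x - v x)" "\<And>i. L2 \<Omega> (\<lambda>x. g0 x $ i)"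
    using u v g0 by (simp_all add: H1_def)
  define pW where "pW i = pd i W" for i
  have pW: "pW i \<in> smooth_alg" for i unfolding pW_def using W by (rule smooth_alg_pd_in)
  define Gu Gv G0 where "Gu i = integral\<^sup>L ?M (\<lambda>x. gu x $ i * of_real (pW i x))"
    and "Gv i = integral\<^sup>L ?M (\<lambda>x. gv x $ i * of_real (pW i x))"
    and "G0 i = integral\<^sup>L ?M (\<lambda>x. g0 x $ i * of_real (pW i x))" for i
  define Iu Iv where "Iu = integral\<^sup>L ?M (\<lambda>x. u x * of_real (W x))" and "Iv = integral\<^sup>L ?M (\<lambda>x. v x * of_real (W x))"

  \<comment> \<open>The gradient \<open>g0\<close> comes from the definition of \<open>H10\<close>
    and is not given as \<open>gu - gv\<close>. Since all three are weak gradients,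
    \<open>gu - gv - g0\<close> annihilates \<open>pW i\<close> times each inner cut-off, and in the
    limit \<open>pW i\<close> itself.\<close>
  have i: "Gu i - Gv i - G0 i = 0" for i
  proof -
    define h where "h x = gu x $ i - gv x $ i - g0 x $ i" for x
    have Lh: "L2 \<Omega> h" unfolding h_def[abs_def] by (intro L2_diff Lu Lv Lw)
    define \<phi> where "\<phi> n x = inner_cutoff a b \<alpha> n x * pW i x" for n x
    have \<phi>: "\<phi> n \<in> smooth_alg" for n
      unfolding \<phi>_def[abs_def] by (intro smooth_alg.mult inner_cutoff_smooth_alg pW)
    have tf: "test_fun \<Omega> (\<phi> n)" for n
    proof (rule test_fun_smooth_alg[OF ab \<phi>])
      show "ell_form a b \<alpha> x \<le> 1 - 1 / real (Suc n)" if "\<phi> n x \<noteq> 0" for x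
        using that by (intro inner_cutoff_support) (auto simp: \<phi>_def)
      have p: "1 - 1 / real (Suc n) < 1" by simp
      show "{x. ell_form a b \<alpha> x \<le> 1 - 1 / real (Suc n)} \<subseteq> \<Omega>"
        unfolding \<Omega>_def ellipse_eq using le_less_trans[OF _ p] by blast
    qed
    have "integral\<^sup>L ?M (\<lambda>x. h x * of_real (\<phi> n x)) = 0" for n
    proof -
      have c1: "continuous_on UNIV (\<phi> n)" "continuous_on UNIV (pd i (\<phi> n))"
        using \<phi> smooth_alg_pd_in[OF \<phi>] cSA by auto
      have "integral\<^sup>L ?M (\<lambda>x. u x * of_real (pd i (\<phi> n) x)) = - integral\<^sup>L ?M (\<lambda>x. gu x $ i * of_real (\<phi> n x))"
        "integral\<^sup>L ?M (\<lambda>x. v x * of_real (pd i (\<phi> n) x)) = - integral\<^sup>L ?M (\<lambda>x. gv x $ i * of_real (\<phi> n x))"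
        "integral\<^sup>L ?M (\<lambda>x. (u x - v x) * of_real (pd i (\<phi> n) x)) = - integral\<^sup>L ?M (\<lambda>x. g0 x $ i * of_real (\<phi> n x))"
        using u v g0 tf[of n] by (simp_all add: H1_def)
      moreover have "integral\<^sup>L ?M (\<lambda>x. (u x - v x) * of_real (pd i (\<phi> n) x))
          = integral\<^sup>L ?M (\<lambda>x. u x * of_real (pd i (\<phi> n) x)) - integral\<^sup>L ?M (\<lambda>x. v x * of_real (pd i (\<phi> n) x))"
        using int[OF Lu(1) c1(2)] int[OF Lv(1) c1(2)] by (simp add: left_diff_distrib)
      moreover have "integral\<^sup>L ?M (\<lambda>x. h x * of_real (\<phi> n x)) = integral\<^sup>L ?M (\<lambda>x. gu x $ i * of_real (\<phi> n x))
          - integral\<^sup>L ?M (\<lambda>x. gv x $ i * of_real (\<phi> n x)) - integral\<^sup>L ?M (\<lambda>x. g0 x $ i * of_real (\<phi> n x))"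
        unfolding h_def using int[OF Lu(2)[of i] c1(1)] int[OF Lv(2)[of i] c1(1)] int[OF Lw(2)[of i] c1(1)] by (simp add: left_diff_distrib)
      ultimately show ?thesis by (simp add: algebra_simps)
    qed
    moreover have "(\<lambda>n. integral\<^sup>L ?M (\<lambda>x. h x * of_real (\<phi> n x))) \<longlonglongrightarrow> integral\<^sup>L ?M (\<lambda>x. h x * of_real (pW i x))"
    proof (rule integral_dominated_convergence[where w = "\<lambda>x. norm (h x * of_real (pW i x))"])
      show "(\<lambda>x. h x * complex_of_real (pW i x)) \<in> borel_measurable ?M" "integrable ?M (\<lambda>x. norm (h x * complex_of_real (pW i x)))"
        using int[OF Lh cSA[OF pW[of i]]] by auto
      show "(\<lambda>x. h x * complex_of_real (\<phi> n x)) \<in> borel_measurable ?M" for n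
        using int[OF Lh cSA[OF \<phi>[of n]]] by auto
      show "AE x in ?M. (\<lambda>n. h x * complex_of_real (\<phi> n x)) \<longlonglongrightarrow> h x * complex_of_real (pW i x)"
      proof (rule AE_I2)
        fix x assume "x \<in> space ?M"
        then have "(\<lambda>n. inner_cutoff a b \<alpha> n x) \<longlonglongrightarrow> 1" by (intro inner_cutoff_tendsto) (simp add: \<Omega>_def)
        then have "(\<lambda>n. h x * complex_of_real (inner_cutoff a b \<alpha> n x * pW i x)) \<longlonglongrightarrow> h x * complex_of_real (1 * pW i x)"
          by (intro tendsto_intros)
        then show "(\<lambda>n. h x * complex_of_real (\<phi> n x)) \<longlonglongrightarrow> h x * complex_of_real (pW i x)" by (simp add: \<phi>_def)
      qed
      show "AE x in ?M. norm (h x * complex_of_real (\<phi> n x)) \<le> norm (h x * complex_of_real (pW i x))" for n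
        using inner_cutoff_le_1[of a b \<alpha> n]
        by (intro AE_I2) (auto simp: norm_mult \<phi>_def abs_mult intro!: mult_left_mono mult_left_le_one_le)
    qed
    ultimately have "integral\<^sup>L ?M (\<lambda>x. h x * of_real (pW i x)) = 0" by (simp add: LIMSEQ_const_iff)
    moreover have "integral\<^sup>L ?M (\<lambda>x. h x * of_real (pW i x)) = Gu i - Gv i - G0 i"
      unfolding h_def Gu_def Gv_def G0_def
      using int[OF Lu(2)[of i] cSA[OF pW[of i]]] int[OF Lv(2)[of i] cSA[OF pW[of i]]] int[OF Lw(2)[of i] cSA[OF pW[of i]]]
      by (simp add: left_diff_distrib)
    ultimately show ?thesis by simp
  qed

  \<comment> \<open>The weak Neumann condition, tested with \<open>W\<close> cut off outside the
    ellipse. On the ellipse the test function and its derivatives are those of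
    \<open>W\<close>.\<close>
  have ii: "(\<Sum>i\<in>UNIV. Gu i) - of_real (k\<^sup>2 * q) * Iu = (\<Sum>i\<in>UNIV. Gv i) - of_real (k\<^sup>2) * Iv"
  proof -
    define \<phi> where "\<phi> x = outer_cutoff a b \<alpha> x * W x" for x
    have \<phi>: "\<phi> \<in> smooth_alg"
      unfolding \<phi>_def[abs_def] by (intro smooth_alg.mult outer_cutoff_smooth_alg W)
    have "test_fun UNIV \<phi>"
      by (rule test_fun_smooth_alg[OF ab \<phi>, of \<alpha> 2]) (auto simp: \<phi>_def intro: outer_cutoff_support)
    note gr = green[OF this]
    have eq: "\<phi> x = W x" "pd i \<phi> x = pW i x" if "x \<in> \<Omega>" for x i
    proof -
      have *: "\<phi> y = W y" if "y \<in> \<Omega>" for y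
        using that sub outer_cutoff_eq_1[of a b \<alpha> y] by (auto simp: \<phi>_def)
      show "\<phi> x = W x" by (rule *[OF that])
      show "pd i \<phi> x = pW i x" unfolding pW_def
        by (rule pd_cong_open[OF op that * smooth_alg_differentiable[OF W]])
    qed
    have "integral\<^sup>L ?M (\<lambda>x. (\<Sum>i\<in>UNIV. g x $ i * of_real (pd i \<phi> x)) - of_real c * z x * of_real (\<phi> x))
       = (\<Sum>i\<in>UNIV. integral\<^sup>L ?M (\<lambda>x. g x $ i * of_real (pW i x))) - of_real c * integral\<^sup>L ?M (\<lambda>x. z x * of_real (W x))"
      if g: "\<And>i. L2 \<Omega> (\<lambda>x. g x $ i)" and z: "L2 \<Omega> z" for g :: "real^2 \<Rightarrow> complex^2" and z and c
    proof -
      have "integral\<^sup>L ?M (\<lambda>x. (\<Sum>i\<in>UNIV. g x $ i * of_real (pd i \<phi> x)) - of_real c * z x * of_real (\<phi> x))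
         = integral\<^sup>L ?M (\<lambda>x. (\<Sum>i\<in>UNIV. g x $ i * of_real (pW i x)) - of_real c * (z x * of_real (W x)))"
        by (rule Bochner_Integration.integral_cong) (auto simp: eq)
      then show ?thesis
        using int[OF g cSA[OF pW]] int[OF z cSA[OF W]] by (simp add: Bochner_Integration.integral_diff Bochner_Integration.integral_sum)
    qed
    note r = this[OF Lu(2,1), of "k\<^sup>2 * q"] this[OF Lv(2,1), of "k\<^sup>2"]
    show ?thesis using gr unfolding r by (simp only: Gu_def Gv_def Iu_def Iv_def)
  qed

  \<comment> \<open>The Dirichlet condition: \<open>u - v\<close> is approximated by test functions
    supported in \<Omega>, for which integration by parts against \<open>W\<close> has no boundary
    term. The Helmholtz equation for \<open>W\<close> then produces the factor
    \<open>k^2 * q\<close>.\<close>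
  have iii: "(\<Sum>i\<in>UNIV. G0 i) - of_real (k\<^sup>2 * q) * (Iu - Iv) = 0"
  proof -
    have sm: "smooth (\<psi> n)" for n using \<psi>[of n] by (simp add: test_fun_def)
    have c\<psi>: "continuous_on UNIV (\<psi> n)" "continuous_on UNIV (pd i (\<psi> n))" for n i
      using smooth_differentiable[OF sm[of n]] by (simp_all add: continuous_at_imp_continuous_on differentiable_imp_continuous_within)
    define A where "A n = integral\<^sup>L ?M (\<lambda>x. (norm (u x - v x - \<psi> n x))\<^sup>2 + (\<Sum>i\<in>UNIV. (norm (g0 x $ i - pd i (\<psi> n) x))\<^sup>2))" for n
    have A: "A \<longlonglongrightarrow> 0" using lim by (simp add: A_def[abs_def])
    have I1: "integrable ?M (\<lambda>x. (norm (u x - v x - \<psi> n x))\<^sup>2)" for n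
      using L2_diff[OF Lw(1) L2c[OF c\<psi>(1)]] by (simp add: L2_def)
    have I2: "integrable ?M (\<lambda>x. (norm (g0 x $ i - pd i (\<psi> n) x))\<^sup>2)" for n i
      using L2_diff[OF Lw(2) L2c[OF c\<psi>(2)]] by (simp add: L2_def)
    have A1: "integral\<^sup>L ?M (\<lambda>x. (norm (u x - v x - \<psi> n x))\<^sup>2) \<le> A n" for n
      unfolding A_def by (intro integral_mono I1 Bochner_Integration.integrable_add Bochner_Integration.integrable_sum I2)
        (simp add: sum_nonneg)
    have A2: "integral\<^sup>L ?M (\<lambda>x. (norm (g0 x $ i - pd i (\<psi> n) x))\<^sup>2) \<le> A n" for n i
      unfolding A_def
    proof (intro integral_mono I1 Bochner_Integration.integrable_add Bochner_Integration.integrable_sum I2)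
      fix x
      have "(norm (g0 x $ i - pd i (\<psi> n) x))\<^sup>2 \<le> (\<Sum>i\<in>UNIV. (norm (g0 x $ i - pd i (\<psi> n) x))\<^sup>2)"
        by (rule member_le_sum) auto
      then show "(norm (g0 x $ i - pd i (\<psi> n) x))\<^sup>2 \<le> (norm (u x - v x - \<psi> n x))\<^sup>2 + (\<Sum>i\<in>UNIV. (norm (g0 x $ i - pd i (\<psi> n) x))\<^sup>2)"
        by (simp add: add_increasing)
    qed
    have l1: "(\<lambda>n. integral\<^sup>L ?M (\<lambda>x. \<psi> n x * of_real (f x))) \<longlonglongrightarrow> integral\<^sup>L ?M (\<lambda>x. (u x - v x) * of_real (f x))"
      if f: "f \<in> smooth_alg" for f
    proof -
      obtain B where B: "B > 0" "\<And>x. x \<in> \<Omega> \<Longrightarrow> norm (f x) \<le> B" using bd[OF cSA[OF f]] by blast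
      show ?thesis
        by (rule L2_tendsto_integral[OF fin Lw(1) L2c[OF c\<psi>(1)] A1 A mc[OF cSA[OF f]], where B = B])
           (use B in auto)
    qed
    have l2: "(\<lambda>n. integral\<^sup>L ?M (\<lambda>x. pd i (\<psi> n) x * of_real (f x))) \<longlonglongrightarrow> integral\<^sup>L ?M (\<lambda>x. g0 x $ i * of_real (f x))"
      if f: "f \<in> smooth_alg" for f i
    proof -
      obtain B where B: "B > 0" "\<And>x. x \<in> \<Omega> \<Longrightarrow> norm (f x) \<le> B" using bd[OF cSA[OF f]] by blast
      show ?thesis
        by (rule L2_tendsto_integral[OF fin Lw(2) L2c[OF c\<psi>(2)] A2 A mc[OF cSA[OF f]], where B = B])
           (use B in auto)
    qed
    have parts: "integral\<^sup>L ?M (\<lambda>x. \<psi> n x * of_real (pd i (pW i) x)) + integral\<^sup>L ?M (\<lambda>x. pd i (\<psi> n) x * of_real (pW i x)) = 0" for n i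
    proof -
      define P where "P x = \<psi> n x * of_real (pd i (pW i) x) + pd i (\<psi> n) x * of_real (pW i x)" for x
      define K where "K = closure {x. \<psi> n x \<noteq> 0}"
      have K: "compact K" "K \<subseteq> \<Omega>" using \<psi>[of n] by (auto simp: test_fun_def K_def)
      have K0: "\<psi> n x = 0" if "x \<notin> K" for x using that closure_subset[of "{x. \<psi> n x \<noteq> 0}"] by (auto simp: K_def)
      have pdP: "pd i (\<lambda>x. \<psi> n x * of_real (pW i x)) = P"
        unfolding P_def[abs_def] by (rule ext, rule pd_mult_of_real(2)[OF smooth_differentiable(1)[OF sm] smooth_alg_differentiable[OF pW]])
      have cP: "continuous_on UNIV P"
        unfolding P_def[abs_def] by (intro continuous_intros c\<psi> cSA pW smooth_alg_pd_in)
      have "integral\<^sup>L lborel P = 0"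
        unfolding pdP[symmetric]
      proof (rule integral_pd_eq_0[OF _ _ K(1)])
        show "(\<lambda>x. \<psi> n x * of_real (pW i x)) differentiable (at x)" for x
          by (rule pd_mult_of_real(1)[OF smooth_differentiable(1)[OF sm] smooth_alg_differentiable[OF pW]])
      qed (use cP K0 in \<open>simp_all add: pdP\<close>)
      moreover have "integral\<^sup>L ?M P = integral\<^sup>L lborel P"
      proof -
        have P0: "P x = 0" if "x \<notin> \<Omega>" for x
        proof -
          have "x \<notin> K" using that K by auto
          then show ?thesis using K0 pd_eq_0_outside[OF compact_imp_closed[OF K(1)] K0] by (simp add: P_def)
        qed
        have "integral\<^sup>L ?M P = integral\<^sup>L lebesgue (\<lambda>x. indicator \<Omega> x *\<^sub>R P x)"
          using meas by (intro integral_restrict_space) auto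
        also have "(\<lambda>x. indicator \<Omega> x *\<^sub>R P x) = P" using P0 by (auto simp: indicator_def)
        also have "integral\<^sup>L lebesgue P = integral\<^sup>L lborel P"
          using cP by (intro integral_completion) (auto intro: borel_measurable_continuous_onI)
        finally show ?thesis .
      qed
      moreover have "integral\<^sup>L ?M P = integral\<^sup>L ?M (\<lambda>x. \<psi> n x * of_real (pd i (pW i) x)) + integral\<^sup>L ?M (\<lambda>x. pd i (\<psi> n) x * of_real (pW i x))"
        unfolding P_def[abs_def]
        by (intro Bochner_Integration.integral_add int L2c c\<psi> cSA pW smooth_alg_pd_in)
      ultimately show ?thesis by simp
    qed
    have "integral\<^sup>L ?M (\<lambda>x. (u x - v x) * of_real (pd i (pW i) x)) + G0 i = 0" for i
    proof -
      have "(\<lambda>n. integral\<^sup>L ?M (\<lambda>x. \<psi> n x * of_real (pd i (pW i) x)) + integral\<^sup>L ?M (\<lambda>x. pd i (\<psi> n) x * of_real (pW i x)))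
         \<longlonglongrightarrow> integral\<^sup>L ?M (\<lambda>x. (u x - v x) * of_real (pd i (pW i) x)) + G0 i"
        unfolding G0_def by (intro tendsto_add l1 l2 pW smooth_alg_pd_in)
      then show ?thesis unfolding parts by (simp add: LIMSEQ_const_iff)
    qed
    then have "(\<Sum>i\<in>UNIV. integral\<^sup>L ?M (\<lambda>x. (u x - v x) * of_real (pd i (pW i) x)) + G0 i) = 0" by simp
    moreover have "(\<Sum>i\<in>UNIV. integral\<^sup>L ?M (\<lambda>x. (u x - v x) * of_real (pd i (pW i) x))) = - of_real (k\<^sup>2 * q) * (Iu - Iv)"
    proof -
      have "(\<Sum>i\<in>UNIV. integral\<^sup>L ?M (\<lambda>x. (u x - v x) * of_real (pd i (pW i) x)))
         = integral\<^sup>L ?M (\<lambda>x. \<Sum>i\<in>UNIV. (u x - v x) * of_real (pd i (pW i) x))"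
        by (rule Bochner_Integration.integral_sum[symmetric]) (intro int Lw cSA pW smooth_alg_pd_in)
      also have "\<dots> = integral\<^sup>L ?M (\<lambda>x. - of_real (k\<^sup>2 * q) * (u x * of_real (W x) - v x * of_real (W x)))"
      proof (intro Bochner_Integration.integral_cong refl)
        fix x
        have "(\<Sum>i\<in>UNIV. (u x - v x) * of_real (pd i (pW i) x)) = (u x - v x) * of_real (\<Sum>i\<in>UNIV. pd i (pd i W) x)"
          by (simp add: sum_distrib_left pW_def)
        then show "(\<Sum>i\<in>UNIV. (u x - v x) * of_real (pd i (pW i) x)) = - of_real (k\<^sup>2 * q) * (u x * of_real (W x) - v x * of_real (W x))"
          unfolding helm by (simp add: algebra_simps)
      qed
      also have "\<dots> = - of_real (k\<^sup>2 * q) * (Iu - Iv)"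
        unfolding Iu_def Iv_def using int[OF Lu(1) cSA[OF W]] int[OF Lv(1) cSA[OF W]] by simp
      finally show ?thesis .
    qed
    ultimately show ?thesis by (simp add: sum.distrib)
  qed
  \<comment> \<open>Once the gradient terms are eliminated, the multiples of \<open>Iu\<close>
    cancel, because \<open>W\<close> satisfies the same equation as \<open>u\<close>.\<close>
  have "(\<Sum>i\<in>UNIV. G0 i) = (\<Sum>i\<in>UNIV. Gu i) - (\<Sum>i\<in>UNIV. Gv i)"
    unfolding sum_subtractf[symmetric] by (rule sum.cong) (use i in \<open>auto simp: algebra_simps\<close>)
  then have "(of_real (k\<^sup>2 * q) - of_real (k\<^sup>2)) * Iv = 0"
    using ii iii by algebra
  then have "of_real (k\<^sup>2 * (q - 1)) * Iv = 0"
    by (simp add: right_diff_distrib)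
  then show ?thesis by (simp add: Iv_def \<Omega>_def)
qed

section \<open>The Fourier transform of the ellipse\<close>

text \<open>The change of variables is reduced to an identity of measures: Lebesgue measure is its
  own image under \<open>g\<close> with a constant density. This is checked on boxes, whose
  preimages are linear images of boxes under \<open>h\<close>.\<close>

lemma lborel_integral_linear:
  fixes g h :: "real^2 \<Rightarrow> real^2" and f :: "real^2 \<Rightarrow> complex"
  assumes g: "linear g" and h: "linear h" and gh: "\<And>x. g (h x) = x" and hg: "\<And>x. h (g x) = x"
    and f: "f \<in> borel_measurable borel"
  shows "integral\<^sup>L lborel f = of_real \<bar>det (matrix g)\<bar> * integral\<^sup>L lborel (\<lambda>x. f (g x))"
proof -
  define d where "d = \<bar>det (matrix g)\<bar>"
  have "matrix g ** matrix h = mat 1"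
    using matrix_compose[OF h g] gh by (simp add: o_def matrix_id_mat_1[unfolded id_def])
  then have "det (matrix g) * det (matrix h) = 1" by (metis det_I det_mul)
  then have dh: "d * \<bar>det (matrix h)\<bar> = 1" by (simp add: d_def abs_mult[symmetric])
  have mg: "g \<in> borel_measurable borel"
    by (intro borel_measurable_continuous_onI linear_continuous_on) (simp add: g linear_conv_bounded_linear[symmetric])
  have "lborel = density (distr lborel borel g) (\<lambda>_. ennreal d)"
  proof (rule lborel_eqI)
    fix l u :: "real^2" assume lu: "\<And>b. b \<in> Basis \<Longrightarrow> l \<bullet> b \<le> u \<bullet> b"
    have img: "g -` box l u = h ` box l u" using gh hg by (auto simp: image_iff) (metis gh)
    have hb: "h ` box l u \<in> sets borel" unfolding img[symmetric] using measurable_sets[OF mg, of "box l u"] by simp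
    have "emeasure (density (distr lborel borel g) (\<lambda>_. ennreal d)) (box l u) = ennreal d * emeasure lborel (h ` box l u)"
      using mg by (simp add: emeasure_density_const emeasure_distr img)
    also have "emeasure lborel (h ` box l u) = emeasure lebesgue (h ` box l u)" using hb by simp
    also have "\<dots> = ennreal (measure lebesgue (h ` box l u))"
      by (rule emeasure_eq_measure2[OF measurable_linear_image[OF h lmeasurable_box]])
    also have "measure lebesgue (h ` box l u) = \<bar>det (matrix h)\<bar> * measure lebesgue (box l u)"
      by (rule measure_linear_image[OF h]) simp
    also have "ennreal d * ennreal (\<bar>det (matrix h)\<bar> * measure lebesgue (box l u)) = ennreal (measure lebesgue (box l u))"
      using dh by (simp add: ennreal_mult[symmetric] d_def mult.assoc[symmetric])
    also have "\<dots> = ennreal (\<Prod>b\<in>Basis. (u - l) \<bullet> b)"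
      using lu by (simp add: measure_lborel_box_eq)
    finally show "emeasure (density (distr lborel borel g) (\<lambda>_. ennreal d)) (box l u) = ennreal (\<Prod>b\<in>Basis. (u - l) \<bullet> b)" .
  qed simp
  then have "integral\<^sup>L lborel f = integral\<^sup>L (density (distr lborel borel g) (\<lambda>_. ennreal d)) f" by simp
  also have "\<dots> = integral\<^sup>L (distr lborel borel g) (\<lambda>x. d *\<^sub>R f x)"
    using f by (intro integral_density) (auto simp: d_def)
  also have "\<dots> = d *\<^sub>R integral\<^sup>L (distr lborel borel g) f" by simp
  also have "integral\<^sup>L (distr lborel borel g) f = integral\<^sup>L lborel (\<lambda>x. f (g x))"
    using mg f by (intro integral_distr) auto
  finally show ?thesis by (simp add: d_def scaleR_conv_of_real)
qed

lemma continuous_on_vector_pair: "continuous_on S (\<lambda>z::real \<times> real. vector [fst z, snd z] :: real^2)"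
proof -
  have eq: "(\<lambda>z::real \<times> real. vector [fst z, snd z] :: real^2) = (\<lambda>z. \<chi> i. if i = 1 then fst z else snd z)"
    by (auto simp: fun_eq_iff vec_eq_iff forall_2)
  show ?thesis
    unfolding eq
  proof (rule continuous_on_vec_lambda)
    show "continuous_on S (\<lambda>z::real \<times> real. if i = 1 then fst z else snd z)" for i :: 2
      by (cases "i = 1") (auto intro!: continuous_intros)
  qed
qed

text \<open>Identifies the plane of vectors with a product of two lines, so that integrals over the
  disc can be computed by slices.\<close>

lemma lborel_real2_eq: "lborel = distr lborel borel (\<lambda>z::real \<times> real. vector [fst z, snd z] :: real^2)"
proof (rule lborel_eqI)
  let ?T = "\<lambda>z::real \<times> real. vector [fst z, snd z] :: real^2"
  have mT: "?T \<in> borel_measurable borel"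
    by (rule borel_measurable_continuous_onI[OF continuous_on_vector_pair])
  fix l u :: "real^2" assume lu: "\<And>b. b \<in> Basis \<Longrightarrow> l \<bullet> b \<le> u \<bullet> b"
  have le: "l $ i \<le> u $ i" for i using lu[of "axis i 1"] by (simp add: inner_axis)
  have "?T -` box l u = box (l$1, l$2) (u$1, u$2)"
    by (auto simp: mem_box_cart forall_2 mem_box Basis_prod_def)
  then have "emeasure (distr lborel borel ?T) (box l u) = emeasure lborel (box (l$1, l$2) (u$1, u$2))"
    using mT by (simp add: emeasure_distr)
  also have "\<dots> = ennreal ((u$1 - l$1) * (u$2 - l$2))"
    using le by (subst emeasure_lborel_box) (auto simp: Basis_prod_def prod.union_disjoint)
  also have "(u$1 - l$1) * (u$2 - l$2) = (\<Prod>b\<in>Basis. (u - l) \<bullet> b)"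
  proof -
    have "(\<Prod>b\<in>Basis. (u - l) \<bullet> b) = (\<Prod>i\<in>UNIV. (u - l) $ i)"
      unfolding Basis_vec_def
      by (simp add: prod.UNION_disjoint axis_eq_axis cart_eq_inner_axis)
    then show ?thesis by (simp add: UNIV_2)
  qed
  finally show "emeasure (distr lborel borel ?T) (box l u) = ennreal (\<Prod>b\<in>Basis. (u - l) \<bullet> b)" .
qed simp

text \<open>Vertical slices of the disc have length \<open>2 * sqrt (1 - x^2)\<close>, and the sine
  part of the remaining integrand is odd.\<close>

lemma disc_integral:
  "integral\<^sup>L lborel (\<lambda>y::real^2. indicator {y. (y$1)\<^sup>2 + (y$2)\<^sup>2 < 1} y *\<^sub>R cis (r * y$1)) = of_real (disc_ft r)"
proof -
  let ?D = "{y::real^2. (y$1)\<^sup>2 + (y$2)\<^sup>2 < 1}"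
  let ?T = "\<lambda>z::real \<times> real. vector [fst z, snd z] :: real^2"
  let ?f = "\<lambda>y::real^2. indicator ?D y *\<^sub>R cis (r * y$1)"
  have mD: "?D \<in> sets borel" by (intro borel_open open_Collect_less continuous_intros)
  have mT: "?T \<in> borel_measurable borel"
    by (rule borel_measurable_continuous_onI[OF continuous_on_vector_pair])
  have mf: "?f \<in> borel_measurable borel"
    using mD by (intro borel_measurable_scaleR borel_measurable_indicator borel_measurable_continuous_onI)
       (auto simp: cis.ctr Complex_eq intro!: continuous_intros)
  define F where "F x y = indicator {z. (fst z)\<^sup>2 + (snd z)\<^sup>2 < (1::real)} (x, y) *\<^sub>R cis (r * x)" for x y :: real
  have D2: "{z::real \<times> real. (fst z)\<^sup>2 + (snd z)\<^sup>2 < 1} \<in> sets borel"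
    by (intro borel_open open_Collect_less continuous_intros)
  have FT: "?f (?T z) = case_prod F z" for z by (cases z) (simp add: F_def indicator_def)
  have "integral\<^sup>L lborel ?f = integral\<^sup>L lborel (\<lambda>z. ?f (?T z))"
    using mT mf by (subst lborel_real2_eq) (intro integral_distr, auto)
  also have "\<dots> = integral\<^sup>L (lborel \<Otimes>\<^sub>M lborel) (case_prod F)"
    by (simp only: FT lborel_prod)
  also have "\<dots> = (\<integral>x. (\<integral>y. F x y \<partial>lborel) \<partial>lborel)"
  proof (rule lborel_pair.integral_fst[symmetric])
    have "integrable lborel (case_prod F)"
    proof (rule Bochner_Integration.integrable_bound[where f = "\<lambda>z::real \<times> real. indicator (cball 0 1) z :: real"])
      show "integrable lborel (\<lambda>z::real \<times> real. indicator (cball 0 1) z :: real)"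
        using emeasure_bounded_finite[OF bounded_cball, of "0::real \<times> real" 1] by (intro integrable_real_indicator) auto
      show "case_prod F \<in> borel_measurable lborel"
      proof -
        have "(\<lambda>z. indicator {z. (fst z)\<^sup>2 + (snd z)\<^sup>2 < (1::real)} z *\<^sub>R cis (r * fst z)) \<in> borel_measurable borel"
          using D2 by (intro borel_measurable_scaleR borel_measurable_indicator borel_measurable_continuous_onI)
             (auto simp: cis.ctr Complex_eq intro!: continuous_intros)
        moreover have "case_prod F = (\<lambda>z. indicator {z. (fst z)\<^sup>2 + (snd z)\<^sup>2 < (1::real)} z *\<^sub>R cis (r * fst z))"
          by (auto simp: F_def fun_eq_iff)
        ultimately show ?thesis by simp
      qed
      have "norm z \<le> 1" if "(fst z)\<^sup>2 + (snd z)\<^sup>2 < 1" for z :: "real \<times> real"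
        using that by (simp add: norm_prod_def)
      then show "AE z in lborel. norm (case_prod F z) \<le> norm (indicator (cball 0 1) z :: real)"
        by (intro AE_I2) (auto simp: F_def indicator_def)
    qed
    then show "integrable (lborel \<Otimes>\<^sub>M lborel) (case_prod F)" by (simp only: lborel_prod)
  qed
  also have "(\<lambda>x. \<integral>y. F x y \<partial>lborel) = (\<lambda>x. indicator {-1..1} x *\<^sub>R (2 * sqrt (1 - x\<^sup>2) *\<^sub>R cis (r * x)))"
  proof
    fix x :: real
    show "(\<integral>y. F x y \<partial>lborel) = indicator {-1..1} x *\<^sub>R (2 * sqrt (1 - x\<^sup>2) *\<^sub>R cis (r * x))"
    proof (cases "\<bar>x\<bar> < 1")
      case True
      then have x2: "x\<^sup>2 < 1" by (simp add: abs_square_less_1)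
      have "F x y = indicator {-sqrt (1 - x\<^sup>2)<..<sqrt (1 - x\<^sup>2)} y *\<^sub>R cis (r * x)" for y
      proof -
        have "x\<^sup>2 + y\<^sup>2 < 1 \<longleftrightarrow> \<bar>y\<bar> < sqrt (1 - x\<^sup>2)"
          using x2 real_sqrt_less_iff[of "y\<^sup>2" "1 - x\<^sup>2"] by auto
        then show ?thesis by (auto simp: F_def indicator_def abs_less_iff)
      qed
      then have "(\<integral>y. F x y \<partial>lborel) = (\<integral>y. indicator {-sqrt (1 - x\<^sup>2)<..<sqrt (1 - x\<^sup>2)} y *\<^sub>R cis (r * x) \<partial>lborel)"
        by simp
      also have "\<dots> = (\<integral>y. indicator {-sqrt (1 - x\<^sup>2)<..<sqrt (1 - x\<^sup>2)} y \<partial>lborel) *\<^sub>R cis (r * x)"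
        by (rule integral_scaleR_left) (use x2 in \<open>auto intro!: integrable_real_indicator\<close>)
      also have "(\<integral>y. indicator {-sqrt (1 - x\<^sup>2)<..<sqrt (1 - x\<^sup>2)} y \<partial>lborel) = 2 * sqrt (1 - x\<^sup>2)"
        using x2 by simp
      finally show ?thesis using True by (simp add: abs_less_iff scaleR_conv_of_real)
    next
      case False
      then have "x\<^sup>2 \<ge> 1" by (simp add: abs_square_less_1 not_less[symmetric])
      then have "F x y = 0" for y using zero_le_power2[of y] by (simp add: F_def indicator_def not_less add_increasing2)
      \<comment> \<open>The points 1 and -1 belong to the closed interval, but there the square root
        vanishes, in agreement with the empty slice.\<close>
      moreover have "x = 1 \<or> x = -1 \<or> x \<notin> {-1..1}" using False by auto
      ultimately show ?thesis by auto
    qed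
  qed
  also have "integral\<^sup>L lborel \<dots> = integral {-1..1} (\<lambda>x. 2 * sqrt (1 - x\<^sup>2) *\<^sub>R cis (r * x))"
  proof -
    have "set_integrable lborel {-1..1} (\<lambda>x. 2 * sqrt (1 - x\<^sup>2) *\<^sub>R cis (r * x))"
      by (intro borel_integrable_atLeastAtMost') (auto simp: cis.ctr Complex_eq intro!: continuous_intros)
    from set_borel_integral_eq_integral(2)[OF this] show ?thesis by (simp add: set_lebesgue_integral_def)
  qed
  also have "\<dots> = of_real (disc_ft r)"
  proof -
    let ?c = "\<lambda>x. 2 * sqrt (1 - x\<^sup>2) * cos (r * x)" and ?s = "\<lambda>x. 2 * sqrt (1 - x\<^sup>2) * sin (r * x)"
    have ic: "(?c has_integral disc_ft r) {-1..1}" unfolding disc_ft_def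
      by (intro integrable_integral integrable_continuous_real continuous_intros)
    have isn: "?s integrable_on {-1..1}" by (intro integrable_continuous_real continuous_intros)
    have "integral {-1..1} ?s = - integral {-1..1} ?s"
      using Henstock_Kurzweil_Integration.integral_reflect_real[of 1 "-1" ?s] by simp
    then have "(?s has_integral 0) {-1..1}" using integrable_integral[OF isn] by simp
    from has_integral_add[OF has_integral_of_real[OF ic] has_integral_mult_right[OF has_integral_of_real[OF this], of \<i>]]
    have "((\<lambda>x. of_real (?c x) + \<i> * of_real (?s x)) has_integral of_real (disc_ft r)) {-1..1}" by simp
    moreover have "of_real (?c x) + \<i> * of_real (?s x) = 2 * sqrt (1 - x\<^sup>2) *\<^sub>R cis (r * x)" for x
      by (simp add: complex_eq_iff)
    ultimately show ?thesis by (simp add: integral_unique)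
  qed
  finally show ?thesis .
qed

text \<open>The substitution \<open>g\<close> is a rotation, followed by the stretching by
  \<open>a\<close> and \<open>b\<close>, followed by the rotation through \<alpha>. The first
  rotation is chosen so that the transformed frequency points along the first axis, where
  \<open>disc_integral\<close> applies.\<close>

lemma ellipse_fourier:
  fixes a b \<alpha> :: real and z1 z2 :: real
  assumes ab: "0 < a" "0 < b"
  defines "u \<equiv> a * (cos \<alpha> * z1 + sin \<alpha> * z2)" and "w \<equiv> b * (- sin \<alpha> * z1 + cos \<alpha> * z2)"
  shows "integral\<^sup>L lborel (\<lambda>x::real^2. indicator (ellipse a b \<alpha>) x *\<^sub>R cis (z1 * x$1 + z2 * x$2))
    = of_real (a * b) * of_real (disc_ft (sqrt (u\<^sup>2 + w\<^sup>2)))"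
proof -
  define r where "r = sqrt (u\<^sup>2 + w\<^sup>2)"
  \<comment> \<open>The unit vector in the direction of \<open>(u, w)\<close>; for frequency zero an
    arbitrary one.\<close>
  obtain C S where CS: "C\<^sup>2 + S\<^sup>2 = 1" "u = r * C" "w = r * S"
  proof (cases "r = 0")
    case True
    then have "u = 0 \<and> w = 0" by (simp add: r_def add_nonneg_eq_0_iff)
    then show ?thesis using True that[of 1 0] by simp
  next
    case False
    have "r\<^sup>2 = u\<^sup>2 + w\<^sup>2" by (simp add: r_def)
    have "(u / r)\<^sup>2 + (w / r)\<^sup>2 = (u\<^sup>2 + w\<^sup>2) / r\<^sup>2" by (simp add: power_divide add_divide_distrib)
    also have "\<dots> = 1" unfolding \<open>r\<^sup>2 = _\<close>[symmetric] using False by simp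
    finally have "(u / r)\<^sup>2 + (w / r)\<^sup>2 = 1" .
    then show ?thesis using that[of "u / r" "w / r"] False by simp
  qed
  define c s where "c = cos \<alpha>" and "s = sin \<alpha>"
  have cs: "c\<^sup>2 + s\<^sup>2 = 1" by (simp add: c_def s_def)
  define g :: "real^2 \<Rightarrow> real^2" where "g y = vector [(c * a * C - s * b * S) * y$1 + (- c * a * S - s * b * C) * y$2,
      (s * a * C + c * b * S) * y$1 + (- s * a * S + c * b * C) * y$2]" for y
  \<comment> \<open>The reciprocals get names of their own, so that the identities below are
    polynomial consequences of \<open>ia\<close>, \<open>cs\<close> and
    \<open>CS(1)\<close>.\<close>
  define a' b' where "a' = 1 / a" and "b' = 1 / b"
  have ia: "a * a' = 1" "b * b' = 1" using ab by (simp_all add: a'_def b'_def)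
  have da: "t / a = t * a'" "t / b = t * b'" for t by (simp_all add: a'_def b'_def)
  define h :: "real^2 \<Rightarrow> real^2" where "h x = vector [(C * (c * a') - S * (s * b')) * x$1 + (C * (s * a') + S * (c * b')) * x$2,
      (- S * (c * a') - C * (s * b')) * x$1 + (- S * (s * a') + C * (c * b')) * x$2]" for x
  have lin: "linear g" "linear h"
    unfolding g_def h_def by (auto intro!: linearI simp: vec_eq_iff forall_2 algebra_simps)
  have g1: "g y $ 1 = (c * a * C - s * b * S) * y$1 + (- c * a * S - s * b * C) * y$2"
    and g2: "g y $ 2 = (s * a * C + c * b * S) * y$1 + (- s * a * S + c * b * C) * y$2" for y
    by (simp_all add: g_def)
  have h1: "h x $ 1 = (C * (c * a') - S * (s * b')) * x$1 + (C * (s * a') + S * (c * b')) * x$2"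
    and h2: "h x $ 2 = (- S * (c * a') - C * (s * b')) * x$1 + (- S * (s * a') + C * (c * b')) * x$2" for x
    by (simp_all add: h_def)
  have gh: "g (h x) = x" for x
    unfolding vec_eq_iff forall_2 g1 g2 h1 h2 using ia cs CS(1) by algebra
  have hg: "h (g x) = x" for x
    unfolding vec_eq_iff forall_2 h1 h2 g1 g2 using ia cs CS(1) by algebra
  have det: "det (matrix g) = a * b"
  proof -
    have "det (matrix g) = (c * a * C - s * b * S) * (- s * a * S + c * b * C) - (- c * a * S - s * b * C) * (s * a * C + c * b * S)"
      unfolding det_2 matrix_def by (simp add: g1 g2 axis_def)
    also have "\<dots> = a * b * (c\<^sup>2 + s\<^sup>2) * (C\<^sup>2 + S\<^sup>2)" by algebra
    finally show ?thesis using cs CS by simp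
  qed
  have form: "ell_form a b \<alpha> (g y) = (y$1)\<^sup>2 + (y$2)\<^sup>2" for y
  proof -
    have "ell_form a b \<alpha> (g y) = ((c * g y $ 1 + s * g y $ 2) * a')\<^sup>2 + ((- s * g y $ 1 + c * g y $ 2) * b')\<^sup>2"
      by (simp add: ell_form_def c_def s_def da)
    also have "c * g y $ 1 + s * g y $ 2 = a * (C * y$1 - S * y$2)" unfolding g1 g2 using cs by algebra
    also have "- s * g y $ 1 + c * g y $ 2 = b * (S * y$1 + C * y$2)" unfolding g1 g2 using cs by algebra
    also have "(a * (C * y$1 - S * y$2) * a')\<^sup>2 + (b * (S * y$1 + C * y$2) * b')\<^sup>2 = (y$1)\<^sup>2 + (y$2)\<^sup>2"
      using ia CS(1) by algebra
    finally show ?thesis .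
  qed
  have ph: "z1 * g y $ 1 + z2 * g y $ 2 = r * y$1" for y
  proof -
    have "z1 * g y $ 1 + z2 * g y $ 2 = (C * y$1 - S * y$2) * u + (S * y$1 + C * y$2) * w"
      unfolding g1 g2 u_def w_def c_def[symmetric] s_def[symmetric] by algebra
    also have "\<dots> = r * y$1" unfolding CS(2,3) using CS(1) by algebra
    finally show ?thesis .
  qed
  have "ellipse a b \<alpha> \<in> sets borel" using open_ellipse by auto
  then have m: "(\<lambda>x::real^2. indicator (ellipse a b \<alpha>) x *\<^sub>R cis (z1 * x$1 + z2 * x$2)) \<in> borel_measurable borel"
    by (intro borel_measurable_scaleR borel_measurable_indicator borel_measurable_continuous_onI)
       (auto simp: cis.ctr Complex_eq intro!: continuous_intros)
  have "integral\<^sup>L lborel (\<lambda>x::real^2. indicator (ellipse a b \<alpha>) x *\<^sub>R cis (z1 * x$1 + z2 * x$2))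
     = of_real \<bar>a * b\<bar> * integral\<^sup>L lborel (\<lambda>y. indicator (ellipse a b \<alpha>) (g y) *\<^sub>R cis (z1 * g y $ 1 + z2 * g y $ 2))"
    unfolding det[symmetric] by (rule lborel_integral_linear[OF lin gh hg m])
  also have "(\<lambda>y. indicator (ellipse a b \<alpha>) (g y) *\<^sub>R cis (z1 * g y $ 1 + z2 * g y $ 2))
     = (\<lambda>y::real^2. indicator {y. (y$1)\<^sup>2 + (y$2)\<^sup>2 < 1} y *\<^sub>R cis (r * y$1))"
    by (simp add: ph ellipse_eq form indicator_def)
  also have "integral\<^sup>L lborel \<dots> = of_real (disc_ft r)" by (rule disc_integral)
  finally show ?thesis using ab by (simp add: r_def)
qed

text \<open>Equivalently, the support function of the axis-parallel ellipse at the vector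
  \<open>(cos t + p * cos s, sin t + p * sin s)\<close>. This is why its derivatives can be read in
  terms of boundary points and normals.\<close>

definition phase :: "real \<Rightarrow> real \<Rightarrow> real \<Rightarrow> real \<Rightarrow> real \<Rightarrow> real" where
  "phase a b p t s = sqrt (a\<^sup>2 * (cos t + p * cos s)\<^sup>2 + b\<^sup>2 * (sin t + p * sin s)\<^sup>2)"

text \<open>The integrand is bounded and supported in the bounded set
  \<open>\<Omega> \<times> {-pi..pi}\<close>, so a single integrability statement on the product
  yields both the integrability over \<Omega> and the exchange of the integrals.\<close>

lemma herglotz_fubini:
  fixes \<Omega> :: "(real^2) set" and W :: "real^2 \<Rightarrow> complex" and k :: real
  assumes op: "open \<Omega>" and bdd: "bounded \<Omega>" and \<phi>: "continuous_on UNIV \<phi>"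
    and W: "continuous_on UNIV W" and W1: "\<And>x. norm (W x) \<le> 1"
  defines "G \<equiv> \<lambda>t. integral\<^sup>L lborel (\<lambda>x. indicator \<Omega> x *\<^sub>R (cis (k * (cos t * x$1 + sin t * x$2)) * W x))"
  shows "integrable (lebesgue_on \<Omega>) (\<lambda>x. herglotz k \<phi> x * W x)"
    "((\<lambda>t. \<phi> t * G t) has_integral integral\<^sup>L (lebesgue_on \<Omega>) (\<lambda>x. herglotz k \<phi> x * W x)) {-pi..pi}"
proof -
  define c where "c t x = cis (k * (cos t * x$1 + sin t * x$2))" for t and x :: "real^2"
  define F where "F x t = indicator (\<Omega> \<times> {-pi..pi}) (x, t) *\<^sub>R (\<phi> t * (c t x * W x))" for x t
  have Om: "\<Omega> \<in> sets borel" "\<Omega> \<in> sets lebesgue" using op by auto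
  have prod_sets: "\<Omega> \<times> {-pi..pi} \<in> sets borel"
    using Om(1) by (simp add: borel_prod[symmetric])
  have cc: "continuous_on UNIV (\<lambda>z::(real^2) \<times> real. \<phi> (snd z) * (c (snd z) (fst z) * W (fst z)))"
    unfolding c_def cis.ctr Complex_eq
    by (intro continuous_intros continuous_on_compose2[OF \<phi>] continuous_on_compose2[OF W]) auto
  have mF: "case_prod F \<in> borel_measurable borel"
  proof -
    have "(\<lambda>z. indicator (\<Omega> \<times> {-pi..pi}) z *\<^sub>R (\<phi> (snd z) * (c (snd z) (fst z) * W (fst z)))) \<in> borel_measurable borel"
      by (intro borel_measurable_scaleR borel_measurable_indicator borel_measurable_continuous_onI prod_sets cc)
    moreover have "case_prod F = (\<lambda>z. indicator (\<Omega> \<times> {-pi..pi}) z *\<^sub>R (\<phi> (snd z) * (c (snd z) (fst z) * W (fst z))))"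
      by (auto simp: F_def fun_eq_iff)
    ultimately show ?thesis by simp
  qed
  obtain B where "\<forall>t\<in>{-pi..pi}. norm (\<phi> t) \<le> B"
    using compact_imp_bounded[OF compact_continuous_image[OF continuous_on_subset[OF \<phi>] compact_Icc], of "-pi" pi]
    by (auto simp: bounded_iff)
  then have B: "\<And>t. t \<in> {-pi..pi} \<Longrightarrow> norm (\<phi> t) \<le> B" by blast
  have intF: "integrable (lborel \<Otimes>\<^sub>M lborel) (case_prod F)"
    unfolding lborel_prod
  proof (rule Bochner_Integration.integrable_bound[where f = "\<lambda>z. indicator (\<Omega> \<times> {-pi..pi}) z * B"])
    have "bounded (\<Omega> \<times> {-pi..pi})" using bdd by (intro bounded_Times) auto
    then show "integrable lborel (\<lambda>z. indicator (\<Omega> \<times> {-pi..pi}) z * B)"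
      using prod_sets by (intro integrable_mult_left integrable_real_indicator emeasure_bounded_finite) auto
    show "AE z in lborel. norm (case_prod F z) \<le> norm (indicator (\<Omega> \<times> {-pi..pi}) z * B)"
    proof (rule AE_I2)
      fix z :: "(real^2) \<times> real"
      have "norm (\<phi> (snd z) * (c (snd z) (fst z) * W (fst z))) \<le> \<bar>B\<bar>" if "z \<in> \<Omega> \<times> {-pi..pi}"
      proof -
        have "norm (\<phi> (snd z)) * norm (W (fst z)) \<le> \<bar>B\<bar> * 1"
          using B[of "snd z"] W1 that by (intro mult_mono) auto
        then show ?thesis by (simp add: norm_mult c_def)
      qed
      then show "norm (case_prod F z) \<le> norm (indicator (\<Omega> \<times> {-pi..pi}) z * B)"
        by (auto simp: F_def indicator_def case_prod_beta)
    qed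
  qed (use mF in simp)
  have inner: "(\<integral>t. F x t \<partial>lborel) = indicator \<Omega> x *\<^sub>R (herglotz k \<phi> x * W x)" for x
  proof -
    have "continuous_on {-pi..pi} (\<lambda>t. \<phi> t * (c t x * W x))"
      unfolding c_def cis.ctr Complex_eq by (intro continuous_intros continuous_on_subset[OF \<phi>]) auto
    from borel_integrable_atLeastAtMost'[OF this]
    have si: "set_integrable lborel {-pi..pi} (\<lambda>t. \<phi> t * (c t x * W x))" .
    have "(\<integral>t. F x t \<partial>lborel) = (\<integral>t. indicator \<Omega> x *\<^sub>R (indicator {-pi..pi} t *\<^sub>R (\<phi> t * (c t x * W x))) \<partial>lborel)"
      by (rule Bochner_Integration.integral_cong) (auto simp: F_def indicator_def)
    also have "\<dots> = indicator \<Omega> x *\<^sub>R (\<integral>t. indicator {-pi..pi} t *\<^sub>R (\<phi> t * (c t x * W x)) \<partial>lborel)"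
      by (rule integral_scaleR_right)
    also have "(\<integral>t. indicator {-pi..pi} t *\<^sub>R (\<phi> t * (c t x * W x)) \<partial>lborel) = integral {-pi..pi} (\<lambda>t. \<phi> t * (c t x * W x))"
      using set_borel_integral_eq_integral(2)[OF si] by (simp add: set_lebesgue_integral_def)
    also have "integral {-pi..pi} (\<lambda>t. \<phi> t * (c t x * W x)) = integral {-pi..pi} (\<lambda>t. \<phi> t * c t x * W x)"
      by (simp only: mult.assoc)
    also have "\<dots> = herglotz k \<phi> x * W x"
      by (simp add: herglotz_def c_def cis_conv_exp)
    finally show ?thesis .
  qed
  have outer: "(\<integral>x. F x t \<partial>lborel) = indicator {-pi..pi} t *\<^sub>R (\<phi> t * G t)" for t
  proof -
    have "(\<integral>x. F x t \<partial>lborel) = (\<integral>x. (indicator {-pi..pi} t *\<^sub>R \<phi> t) * (indicator \<Omega> x *\<^sub>R (c t x * W x)) \<partial>lborel)"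
      by (rule Bochner_Integration.integral_cong) (auto simp: F_def indicator_def)
    also have "\<dots> = (indicator {-pi..pi} t *\<^sub>R \<phi> t) * (\<integral>x. indicator \<Omega> x *\<^sub>R (c t x * W x) \<partial>lborel)"
      by (rule integral_mult_right_zero)
    also have "(\<integral>x. indicator \<Omega> x *\<^sub>R (c t x * W x) \<partial>lborel) = G t" by (simp only: G_def c_def)
    finally show ?thesis by simp
  qed
  have i1: "integrable lborel (\<lambda>x. indicator \<Omega> x *\<^sub>R (herglotz k \<phi> x * W x))"
    using lborel_pair.integrable_fst[OF intF] by (simp add: inner)
  then have m1: "(\<lambda>x. indicator \<Omega> x *\<^sub>R (herglotz k \<phi> x * W x)) \<in> borel_measurable lborel" by auto
  show "integrable (lebesgue_on \<Omega>) (\<lambda>x. herglotz k \<phi> x * W x)"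
    using i1 m1 Om by (subst integrable_restrict_space) (auto simp: integrable_completion)
  have "integral\<^sup>L (lebesgue_on \<Omega>) (\<lambda>x. herglotz k \<phi> x * W x) = integral\<^sup>L lebesgue (\<lambda>x. indicator \<Omega> x *\<^sub>R (herglotz k \<phi> x * W x))"
    using Om by (intro integral_restrict_space) auto
  also have "\<dots> = (\<integral>x. (\<integral>t. F x t \<partial>lborel) \<partial>lborel)" using m1 by (simp add: integral_completion inner)
  also have "\<dots> = (\<integral>t. (\<integral>x. F x t \<partial>lborel) \<partial>lborel)" by (rule lborel_pair.Fubini_integral[OF intF, symmetric])
  also have "\<dots> = (\<integral>t. indicator {-pi..pi} t *\<^sub>R (\<phi> t * G t) \<partial>lborel)" by (simp only: outer)
  finally have eq: "integral\<^sup>L (lebesgue_on \<Omega>) (\<lambda>x. herglotz k \<phi> x * W x) = (LINT t:{-pi..pi}|lborel. \<phi> t * G t)"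
    by (simp add: set_lebesgue_integral_def)
  have "set_integrable lborel {-pi..pi} (\<lambda>t. \<phi> t * G t)"
    using lborel_pair.integrable_snd[OF intF] by (simp only: outer set_integrable_def)
  from set_borel_integral_eq_integral[OF this]
  show "((\<lambda>t. \<phi> t * G t) has_integral integral\<^sup>L (lebesgue_on \<Omega>) (\<lambda>x. herglotz k \<phi> x * W x)) {-pi..pi}"
    unfolding eq by (simp add: integrable_integral)
qed

section \<open>Plane waves as test functions\<close>

lemma pd_cos_linear: "pd i (\<lambda>x::real^2. cos (c1 * x$1 + c2 * x$2)) = (\<lambda>x. - (if i = 1 then c1 else c2) * sin (c1 * x$1 + c2 * x$2))"
  and pd_sin_linear: "pd i (\<lambda>x::real^2. sin (c1 * x$1 + c2 * x$2)) = (\<lambda>x. (if i = 1 then c1 else c2) * cos (c1 * x$1 + c2 * x$2))"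
proof -
  have L: "((\<lambda>x::real^2. c1 * x$1 + c2 * x$2) has_derivative (\<lambda>h. c1 * h$1 + c2 * h$2)) (at x)" for x
    by (intro bounded_linear_imp_has_derivative bounded_linear_add bounded_linear_const_mult bounded_linear_vec_nth)
  have e: "c1 * axis i 1 $ 1 + c2 * axis i 1 $ 2 = (if i = 1 then c1 else c2)"
    using exhaust_2[of i] by (auto simp: axis_def)
  show "pd i (\<lambda>x::real^2. cos (c1 * x$1 + c2 * x$2)) = (\<lambda>x. - (if i = 1 then c1 else c2) * sin (c1 * x$1 + c2 * x$2))"
    using pd_eqI[OF has_derivative_cos[OF L], of i] by (simp add: e fun_eq_iff)
  show "pd i (\<lambda>x::real^2. sin (c1 * x$1 + c2 * x$2)) = (\<lambda>x. (if i = 1 then c1 else c2) * cos (c1 * x$1 + c2 * x$2))"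
    using pd_eqI[OF has_derivative_sin[OF L], of i] by (simp add: e fun_eq_iff)
qed

lemma pd_cmult:
  fixes f :: "real^2 \<Rightarrow> real"
  assumes "f differentiable (at x)" shows "pd i (\<lambda>x. c * f x) x = c * pd i f x"
  using pd_eqI[OF has_derivative_mult_right[of f "frechet_derivative f (at x)" "at x" c], of i] assms
  by (simp add: frechet_derivative_works pd_def)

text \<open>The refracted plane waves with direction \<open>s + \<alpha>\<close> serve as test functions.\<close>

lemma herglotz_pairing:
  fixes a b \<alpha> q k s :: real
  assumes ab: "0 < a" "0 < b" and q: "q > 0" "q \<noteq> 1" and k: "k > 0" and \<phi>: "continuous_on UNIV \<phi>"
    and ns: "non_scattering (ellipse a b \<alpha>) q k (herglotz k \<phi>)"
  shows "integral {-pi..pi} (\<lambda>t. \<phi> t * of_real (disc_ft (k * phase a b (sqrt q) (t - \<alpha>) s))) = 0"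
proof -
  define p where "p = sqrt q"
  have p2: "p\<^sup>2 = q" using q by (simp add: p_def)
  \<comment> \<open>The wave vector has length \<open>k * p\<close>, so the plane wave solves the
    Helmholtz equation with factor \<open>k^2 * q\<close>. The summand \<alpha> in the angle cancels
    the rotation of the ellipse.\<close>
  define c1 c2 where "c1 = k * p * cos (s + \<alpha>)" and "c2 = k * p * sin (s + \<alpha>)"
  define L where "L x = c1 * x$1 + c2 * x$2" for x :: "real^2"
  have c12: "c1\<^sup>2 + c2\<^sup>2 = k\<^sup>2 * q"
    unfolding c1_def c2_def power_mult_distrib p2 distrib_left[symmetric] by simp
  let ?O = "ellipse a b \<alpha>"
  have Lsa: "L \<in> smooth_alg" unfolding L_def[abs_def] by (intro smooth_alg_intros)
  have cosA: "(\<lambda>x. cos (L x)) \<in> smooth_alg" and sinA: "(\<lambda>x. sin (L x)) \<in> smooth_alg"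
    using Lsa by (auto intro: smooth_alg.intros)
  have pc: "pd i (\<lambda>x. cos (L x)) = (\<lambda>x. - (if i = 1 then c1 else c2) * sin (L x))"
    and ps: "pd i (\<lambda>x. sin (L x)) = (\<lambda>x. (if i = 1 then c1 else c2) * cos (L x))" for i
    unfolding L_def by (rule pd_cos_linear pd_sin_linear)+
  have h1: "(\<Sum>i\<in>UNIV. pd i (pd i (\<lambda>x. cos (L x))) x) = - (k\<^sup>2 * q) * cos (L x)" for x
  proof -
    have "(\<Sum>i\<in>UNIV. pd i (pd i (\<lambda>x. cos (L x))) x) = - (c1\<^sup>2 + c2\<^sup>2) * cos (L x)"
      unfolding pc sum_2 pd_cmult[OF smooth_alg_differentiable[OF sinA]] ps
      by (simp add: power2_eq_square algebra_simps)
    then show ?thesis by (simp add: c12)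
  qed
  have h2: "(\<Sum>i\<in>UNIV. pd i (pd i (\<lambda>x. sin (L x))) x) = - (k\<^sup>2 * q) * sin (L x)" for x
  proof -
    have "(\<Sum>i\<in>UNIV. pd i (pd i (\<lambda>x. sin (L x))) x) = - (c1\<^sup>2 + c2\<^sup>2) * sin (L x)"
      unfolding ps sum_2 pd_cmult[OF smooth_alg_differentiable[OF cosA]] pc
      by (simp add: power2_eq_square algebra_simps)
    then show ?thesis by (simp add: c12)
  qed
  have kq: "complex_of_real (k\<^sup>2 * (q - 1)) \<noteq> 0" using k q by simp
  let ?v = "herglotz k \<phi>"
  \<comment> \<open>The orthogonality relation is stated for real \<open>W\<close>; cosine and sine
    are treated separately and recombined into \<open>cis (L x)\<close>.\<close>
  have o1: "integral\<^sup>L (lebesgue_on ?O) (\<lambda>x. ?v x * of_real (cos (L x))) = 0"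
    using non_scattering_orthogonal[OF ab ns cosA h1] kq by simp
  have o2: "integral\<^sup>L (lebesgue_on ?O) (\<lambda>x. ?v x * of_real (sin (L x))) = 0"
    using non_scattering_orthogonal[OF ab ns sinA h2] kq by simp
  have bdd: "bounded ?O"
    by (rule bounded_subset[OF compact_imp_bounded[OF compact_ell_form_le[OF ab, of \<alpha> 1]]]) (auto simp: ellipse_eq)
  have cL: "continuous_on UNIV L" by (rule smooth_alg_continuous[OF Lsa])
  note fub = herglotz_fubini[OF open_ellipse bdd \<phi>, where k = k]
  have f1: "integrable (lebesgue_on ?O) (\<lambda>x. ?v x * of_real (cos (L x)))"
    by (rule fub(1)) (auto intro!: continuous_intros cL)
  have f2: "integrable (lebesgue_on ?O) (\<lambda>x. ?v x * of_real (sin (L x)))"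
    by (rule fub(1)) (auto intro!: continuous_intros cL)
  have "integral\<^sup>L (lebesgue_on ?O) (\<lambda>x. ?v x * cis (L x))
     = integral\<^sup>L (lebesgue_on ?O) (\<lambda>x. ?v x * of_real (cos (L x)) + \<i> * (?v x * of_real (sin (L x))))"
    by (rule Bochner_Integration.integral_cong) (auto simp: complex_eq_iff algebra_simps)
  also have "\<dots> = 0" using f1 f2 o1 o2 by simp
  finally have 0: "integral\<^sup>L (lebesgue_on ?O) (\<lambda>x. ?v x * cis (L x)) = 0" .
  have "continuous_on UNIV (\<lambda>x. cis (L x))" unfolding cis.ctr Complex_eq by (intro continuous_intros cL)
  from fub(2)[OF this] 0 have hi: "((\<lambda>t. \<phi> t * integral\<^sup>L lborel (\<lambda>x. indicator ?O x *\<^sub>R (cis (k * (cos t * x$1 + sin t * x$2)) * cis (L x)))) has_integral 0) {-pi..pi}"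
    by simp
  have G: "integral\<^sup>L lborel (\<lambda>x. indicator ?O x *\<^sub>R (cis (k * (cos t * x$1 + sin t * x$2)) * cis (L x)))
     = of_real (a * b) * of_real (disc_ft (k * phase a b p (t - \<alpha>) s))" for t
  proof -
    define z1 z2 where "z1 = k * (cos t + p * cos (s + \<alpha>))" and "z2 = k * (sin t + p * sin (s + \<alpha>))"
    have e1: "cos \<alpha> * z1 + sin \<alpha> * z2 = k * (cos (t - \<alpha>) + p * cos s)"
    proof -
      have "cos \<alpha> * z1 + sin \<alpha> * z2 = k * (cos (t - \<alpha>) + p * cos (s + \<alpha> - \<alpha>))"
        unfolding cos_diff z1_def z2_def by algebra
      then show ?thesis by simp
    qed
    have e2: "- sin \<alpha> * z1 + cos \<alpha> * z2 = k * (sin (t - \<alpha>) + p * sin s)"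
    proof -
      have "- sin \<alpha> * z1 + cos \<alpha> * z2 = k * (sin (t - \<alpha>) + p * sin (s + \<alpha> - \<alpha>))"
        unfolding sin_diff z1_def z2_def by algebra
      then show ?thesis by simp
    qed
    have "sqrt ((a * (cos \<alpha> * z1 + sin \<alpha> * z2))\<^sup>2 + (b * (- sin \<alpha> * z1 + cos \<alpha> * z2))\<^sup>2)
       = sqrt (k\<^sup>2 * (a\<^sup>2 * (cos (t - \<alpha>) + p * cos s)\<^sup>2 + b\<^sup>2 * (sin (t - \<alpha>) + p * sin s)\<^sup>2))"
      unfolding e1 e2 by (rule arg_cong[where f = sqrt]) algebra
    also have "\<dots> = k * phase a b p (t - \<alpha>) s"
      using k by (simp add: real_sqrt_mult phase_def)
    finally have r: "sqrt ((a * (cos \<alpha> * z1 + sin \<alpha> * z2))\<^sup>2 + (b * (- sin \<alpha> * z1 + cos \<alpha> * z2))\<^sup>2) = k * phase a b p (t - \<alpha>) s" .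
    have ce: "cis (k * (cos t * x$1 + sin t * x$2)) * cis (L x) = cis (z1 * x$1 + z2 * x$2)" for x
      unfolding cis_mult L_def z1_def z2_def c1_def c2_def by (rule arg_cong[where f = cis]) algebra
    show ?thesis unfolding ce using ellipse_fourier[OF ab, of \<alpha> z1 z2] unfolding r .
  qed
  have "((\<lambda>t. \<phi> t * (of_real (a * b) * of_real (disc_ft (k * phase a b p (t - \<alpha>) s)))) has_integral 0) {-pi..pi}"
    using hi unfolding G .
  from has_integral_mult_right[OF this, of "inverse (of_real (a * b))"]
  have "((\<lambda>t. inverse (of_real (a * b)) * (\<phi> t * (of_real (a * b) * of_real (disc_ft (k * phase a b p (t - \<alpha>) s))))) has_integral 0) {-pi..pi}"
    by simp
  moreover have "inverse (of_real (a * b)) * (\<phi> t * (of_real (a * b) * of_real (disc_ft (k * phase a b p (t - \<alpha>) s))))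
     = \<phi> t * of_real (disc_ft (k * phase a b p (t - \<alpha>) s))" for t
    using ab by (simp add: field_simps)
  ultimately have "((\<lambda>t. \<phi> t * of_real (disc_ft (k * phase a b p (t - \<alpha>) s))) has_integral 0) {-pi..pi}"
    by (simp only:)
  then show ?thesis by (simp add: integral_unique p_def)
qed

section \<open>Vanishing of the density\<close>

lemma sqrt_has_derivative:
  fixes Q F :: "real \<Rightarrow> real"
  assumes Q: "(Q has_real_derivative 2 * A) (at x)" and pos: "\<And>x. F x > 0" and sq: "\<And>x. (F x)\<^sup>2 = Q x"
  shows "(F has_real_derivative A / F x) (at x)"
proof -
  have F: "(\<lambda>x. sqrt (Q x)) = F"
    using real_sqrt_unique[OF sq less_imp_le[OF pos]] by auto
  have Qx: "Q x > 0" by (metis pos sq zero_less_power)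
  have "((\<lambda>x. sqrt (Q x)) has_real_derivative inverse (sqrt (Q x)) / 2 * (2 * A)) (at x)"
    by (rule DERIV_chain2[where f = sqrt and g = Q, OF DERIV_real_sqrt[OF Qx] Q])
  moreover have "inverse (sqrt (Q x)) / 2 * (2 * A) = A / F x"
    unfolding fun_cong[OF F, of x] using pos[of x] by (simp add: field_simps)
  ultimately show ?thesis unfolding F by (simp only:)
qed

definition phase_t :: "real \<Rightarrow> real \<Rightarrow> real \<Rightarrow> real \<Rightarrow> real \<Rightarrow> real" where
  "phase_t a b p t s = (b\<^sup>2 * cos t * (sin t + p * sin s) - a\<^sup>2 * sin t * (cos t + p * cos s)) / phase a b p t s"

definition phase_s :: "real \<Rightarrow> real \<Rightarrow> real \<Rightarrow> real \<Rightarrow> real \<Rightarrow> real" where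
  "phase_s a b p t s = p * (b\<^sup>2 * cos s * (sin t + p * sin s) - a\<^sup>2 * sin s * (cos t + p * cos s)) / phase a b p t s"

text \<open>If \<open>phase_t\<close> is \<open>A\<close> divided by \<Phi>, its derivative is the
  derivative of \<open>A\<close> minus the square of \<open>phase_t\<close>, divided by \<Phi>.
  Keeping the square apart makes it drop out at critical points. The other second derivatives have
  the same shape.\<close>

definition phase_tt :: "real \<Rightarrow> real \<Rightarrow> real \<Rightarrow> real \<Rightarrow> real \<Rightarrow> real" where
  "phase_tt a b p t s = ((b\<^sup>2 * ((cos t)\<^sup>2 - (sin t)\<^sup>2 - p * sin t * sin s) - a\<^sup>2 * ((cos t)\<^sup>2 - (sin t)\<^sup>2 + p * cos t * cos s))
     - (phase_t a b p t s)\<^sup>2) / phase a b p t s"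

definition phase_ss :: "real \<Rightarrow> real \<Rightarrow> real \<Rightarrow> real \<Rightarrow> real \<Rightarrow> real" where
  "phase_ss a b p t s = (p * (b\<^sup>2 * (p * ((cos s)\<^sup>2 - (sin s)\<^sup>2) - sin t * sin s) - a\<^sup>2 * (p * ((cos s)\<^sup>2 - (sin s)\<^sup>2) + cos t * cos s))
     - (phase_s a b p t s)\<^sup>2) / phase a b p t s"

definition phase_st :: "real \<Rightarrow> real \<Rightarrow> real \<Rightarrow> real \<Rightarrow> real \<Rightarrow> real" where
  "phase_st a b p t s = (p * (b\<^sup>2 * cos s * cos t + a\<^sup>2 * sin s * sin t)
     - phase_s a b p t s * phase_t a b p t s) / phase a b p t s"

locale ellipse_phase =
  fixes a b p :: real
  assumes b0: "0 < b" and ba: "b < a" and p0: "0 < p" and p1: "p \<noteq> 1"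
begin

abbreviation "\<Phi> \<equiv> phase a b p"

definition "phase_min = b * \<bar>1 - p\<bar>"

lemma phase_min_pos: "phase_min > 0"
  using b0 p1 by (simp add: phase_min_def)

text \<open>The sum of a unit vector and a vector of length \<open>p\<close> has length at least
  \<open>\<bar>1 - p\<bar>\<close>, and the stretching is by at least \<open>b\<close>. The bound is
  uniform, so for large \<open>K\<close> the argument \<open>K * \<Phi> t s\<close> lies in the
  range of the asymptotics of \<open>disc_ft\<close> for all \<open>t\<close> at once.\<close>

lemma phase_ge: "phase_min \<le> \<Phi> t s"
proof -
  have "(b * (1 - p))\<^sup>2 = b\<^sup>2 * (1 + p\<^sup>2 - 2 * p)" by algebra
  also have "\<dots> \<le> b\<^sup>2 * (1 + p\<^sup>2 + 2 * p * cos (t - s))"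
    using p0 mult_left_mono[of "-1" "cos (t - s)" "2 * p"] by (intro mult_left_mono) auto
  also have "\<dots> = b\<^sup>2 * (cos t + p * cos s)\<^sup>2 + b\<^sup>2 * (sin t + p * sin s)\<^sup>2"
  proof -
    have "(cos t)\<^sup>2 + (sin t)\<^sup>2 = 1" "(cos s)\<^sup>2 + (sin s)\<^sup>2 = 1" by simp_all
    then show ?thesis unfolding cos_diff by algebra
  qed
  also have "\<dots> \<le> a\<^sup>2 * (cos t + p * cos s)\<^sup>2 + b\<^sup>2 * (sin t + p * sin s)\<^sup>2"
    using b0 ba by (intro add_right_mono mult_right_mono power_mono) auto
  finally have "\<bar>b * (1 - p)\<bar> \<le> \<Phi> t s"
    unfolding phase_def by (intro real_le_rsqrt) simp
  then show ?thesis using b0 by (simp add: phase_min_def abs_mult)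
qed

lemma phase_pos: "\<Phi> t s > 0"
  using phase_ge[of t s] phase_min_pos by linarith

lemma phase_sq: "(\<Phi> t s)\<^sup>2 = a\<^sup>2 * (cos t + p * cos s)\<^sup>2 + b\<^sup>2 * (sin t + p * sin s)\<^sup>2"
  unfolding phase_def by (rule real_sqrt_pow2) simp

lemma phase_has_deriv_t: "((\<lambda>t. \<Phi> t s) has_real_derivative phase_t a b p t s) (at t)"
  unfolding phase_t_def
  by (rule sqrt_has_derivative[where Q = "\<lambda>t. a\<^sup>2 * (cos t + p * cos s)\<^sup>2 + b\<^sup>2 * (sin t + p * sin s)\<^sup>2"])
     (auto intro!: derivative_eq_intros phase_pos phase_sq simp: algebra_simps)

lemma phase_has_deriv_s: "((\<lambda>s. \<Phi> t s) has_real_derivative phase_s a b p t s) (at s)"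
  unfolding phase_s_def
  by (rule sqrt_has_derivative[where Q = "\<lambda>s. a\<^sup>2 * (cos t + p * cos s)\<^sup>2 + b\<^sup>2 * (sin t + p * sin s)\<^sup>2"])
     (auto intro!: derivative_eq_intros phase_pos phase_sq simp: algebra_simps)

lemma quotient_deriv:
  assumes A: "(A has_real_derivative A') (at x)" and F: "(F has_real_derivative F') (at x)" and "F x > 0"
  shows "((\<lambda>x. A x / F x) has_real_derivative (A' - A x / F x * F') / F x) (at x)"
  using DERIV_divide[OF A F] assms(3) by (simp add: field_simps)

lemma phase_t_has_deriv_t: "((\<lambda>t. phase_t a b p t s) has_real_derivative phase_tt a b p t s) (at t)"
proof -
  have A: "((\<lambda>t. b\<^sup>2 * cos t * (sin t + p * sin s) - a\<^sup>2 * sin t * (cos t + p * cos s)) has_real_derivative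
     (b\<^sup>2 * ((cos t)\<^sup>2 - (sin t)\<^sup>2 - p * sin t * sin s) - a\<^sup>2 * ((cos t)\<^sup>2 - (sin t)\<^sup>2 + p * cos t * cos s))) (at t)"
    by (auto intro!: derivative_eq_intros simp: algebra_simps power2_eq_square)
  from quotient_deriv[OF A phase_has_deriv_t[where s = s] phase_pos] show ?thesis
    unfolding phase_t_def[symmetric] by (simp add: phase_tt_def power2_eq_square)
qed

lemma phase_s_has_deriv_s: "((\<lambda>s. phase_s a b p t s) has_real_derivative phase_ss a b p t s) (at s)"
proof -
  have A: "((\<lambda>s. p * (b\<^sup>2 * cos s * (sin t + p * sin s) - a\<^sup>2 * sin s * (cos t + p * cos s))) has_real_derivative
     (p * (b\<^sup>2 * (p * ((cos s)\<^sup>2 - (sin s)\<^sup>2) - sin t * sin s) - a\<^sup>2 * (p * ((cos s)\<^sup>2 - (sin s)\<^sup>2) + cos t * cos s)))) (at s)"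
    by (auto intro!: derivative_eq_intros simp: algebra_simps power2_eq_square)
  from quotient_deriv[OF A phase_has_deriv_s[where t = t] phase_pos] show ?thesis
    unfolding phase_s_def[symmetric] by (simp add: phase_ss_def power2_eq_square)
qed

lemma phase_s_has_deriv_t: "((\<lambda>t. phase_s a b p t s) has_real_derivative phase_st a b p t s) (at t)"
proof -
  have A: "((\<lambda>t. p * (b\<^sup>2 * cos s * (sin t + p * sin s) - a\<^sup>2 * sin s * (cos t + p * cos s))) has_real_derivative
     (p * (b\<^sup>2 * cos s * cos t + a\<^sup>2 * sin s * sin t))) (at t)"
    by (auto intro!: derivative_eq_intros simp: algebra_simps power2_eq_square)
  from quotient_deriv[OF A phase_has_deriv_t[where s = s] phase_pos] show ?thesis
    unfolding phase_s_def[symmetric] by (simp add: phase_st_def)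
qed

lemma phase_continuous:
  "continuous_on S (\<lambda>t. \<Phi> t s)" "continuous_on S (\<lambda>t. phase_t a b p t s)" "continuous_on S (\<lambda>t. phase_s a b p t s)"
  "continuous_on S (\<lambda>t. phase_tt a b p t s)" "continuous_on S (\<lambda>t. phase_st a b p t s)"
proof -
  show 1: "continuous_on S (\<lambda>t. \<Phi> t s)"
    by (rule DERIV_continuous_on) (rule has_field_derivative_at_within[OF phase_has_deriv_t])
  show 2: "continuous_on S (\<lambda>t. phase_t a b p t s)"
    by (rule DERIV_continuous_on) (rule has_field_derivative_at_within[OF phase_t_has_deriv_t])
  show 3: "continuous_on S (\<lambda>t. phase_s a b p t s)"
    by (rule DERIV_continuous_on) (rule has_field_derivative_at_within[OF phase_s_has_deriv_t])
  have ne: "\<Phi> t s \<noteq> 0" for t using phase_pos[of t s] by simp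
  show "continuous_on S (\<lambda>t. phase_tt a b p t s)" "continuous_on S (\<lambda>t. phase_st a b p t s)"
    unfolding phase_tt_def phase_st_def by (intro continuous_intros 1 2 3; use ne in simp)+
qed

text \<open>Uniformity in both variables serves the expansion: the perturbed direction changes with
  the wave number, and the error is integrated over all \<open>t\<close>.\<close>

lemma phase_bounds: "\<exists>C. \<forall>t s. \<bar>phase_s a b p t s\<bar> \<le> C \<and> \<bar>phase_ss a b p t s\<bar> \<le> C"
proof -
  define A where "A = p * (b\<^sup>2 * (1 + p) + a\<^sup>2 * (1 + p))"
  define C1 where "C1 = A / phase_min"
  define C2 where "C2 = (p * (b\<^sup>2 * (2 * p + 1) + a\<^sup>2 * (2 * p + 1)) + C1\<^sup>2) / phase_min"
  have tri: "\<bar>sin t + p * sin s\<bar> \<le> 1 + p" "\<bar>cos t + p * cos s\<bar> \<le> 1 + p" for t s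
  proof -
    have "\<bar>p * sin s\<bar> \<le> p * 1" "\<bar>p * cos s\<bar> \<le> p * 1"
      unfolding abs_mult using p0 by (auto intro!: mult_left_mono)
    then show "\<bar>sin t + p * sin s\<bar> \<le> 1 + p" "\<bar>cos t + p * cos s\<bar> \<le> 1 + p"
      using abs_sin_le_one[of t] abs_cos_le_one[of t] by linarith+
  qed
  have div: "\<bar>x / \<Phi> t s\<bar> \<le> y / phase_min" if "\<bar>x\<bar> \<le> y" for x y t s
    unfolding abs_divide using that phase_ge[of t s] phase_min_pos phase_pos[of t s] by (intro frac_le) auto
  have s1: "\<bar>phase_s a b p t s\<bar> \<le> C1" for t s
    unfolding phase_s_def C1_def
  proof (rule div)
    have "\<bar>cos s * (sin t + p * sin s)\<bar> \<le> 1 * (1 + p)" "\<bar>sin s * (cos t + p * cos s)\<bar> \<le> 1 * (1 + p)"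
      unfolding abs_mult using p0 by (intro mult_mono tri; simp)+
    then have "\<bar>b\<^sup>2 * (cos s * (sin t + p * sin s))\<bar> \<le> b\<^sup>2 * (1 + p)" "\<bar>a\<^sup>2 * (sin s * (cos t + p * cos s))\<bar> \<le> a\<^sup>2 * (1 + p)"
      unfolding abs_mult[of "b\<^sup>2"] abs_mult[of "a\<^sup>2"] by (auto intro!: mult_left_mono)
    then have "\<bar>b\<^sup>2 * cos s * (sin t + p * sin s) - a\<^sup>2 * sin s * (cos t + p * cos s)\<bar> \<le> b\<^sup>2 * (1 + p) + a\<^sup>2 * (1 + p)"
      unfolding mult.assoc by linarith
    then show "\<bar>p * (b\<^sup>2 * cos s * (sin t + p * sin s) - a\<^sup>2 * sin s * (cos t + p * cos s))\<bar> \<le> A"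
      unfolding A_def abs_mult[of p] using p0 by simp
  qed
  have s2: "\<bar>phase_ss a b p t s\<bar> \<le> C2" for t s
    unfolding phase_ss_def C2_def
  proof (rule div)
    have "\<bar>(cos s)\<^sup>2 - (sin s)\<^sup>2\<bar> \<le> 1" unfolding cos_double[symmetric] by simp
    then have "\<bar>p * ((cos s)\<^sup>2 - (sin s)\<^sup>2)\<bar> \<le> 2 * p" unfolding abs_mult using p0 mult_left_mono[of "\<bar>(cos s)\<^sup>2 - (sin s)\<^sup>2\<bar>" 1 p] by simp
    moreover have "\<bar>sin t * sin s\<bar> \<le> 1" "\<bar>cos t * cos s\<bar> \<le> 1"
      unfolding abs_mult by (simp_all add: mult_le_one)
    ultimately have "\<bar>p * ((cos s)\<^sup>2 - (sin s)\<^sup>2) - sin t * sin s\<bar> \<le> 2 * p + 1"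
      "\<bar>p * ((cos s)\<^sup>2 - (sin s)\<^sup>2) + cos t * cos s\<bar> \<le> 2 * p + 1" by linarith+
    then have "\<bar>b\<^sup>2 * (p * ((cos s)\<^sup>2 - (sin s)\<^sup>2) - sin t * sin s)\<bar> \<le> b\<^sup>2 * (2 * p + 1)"
      "\<bar>a\<^sup>2 * (p * ((cos s)\<^sup>2 - (sin s)\<^sup>2) + cos t * cos s)\<bar> \<le> a\<^sup>2 * (2 * p + 1)"
      unfolding abs_mult[of "b\<^sup>2"] abs_mult[of "a\<^sup>2"] by (auto intro!: mult_left_mono)
    then have "\<bar>b\<^sup>2 * (p * ((cos s)\<^sup>2 - (sin s)\<^sup>2) - sin t * sin s) - a\<^sup>2 * (p * ((cos s)\<^sup>2 - (sin s)\<^sup>2) + cos t * cos s)\<bar>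
        \<le> b\<^sup>2 * (2 * p + 1) + a\<^sup>2 * (2 * p + 1)" by linarith
    then have "\<bar>p * (b\<^sup>2 * (p * ((cos s)\<^sup>2 - (sin s)\<^sup>2) - sin t * sin s) - a\<^sup>2 * (p * ((cos s)\<^sup>2 - (sin s)\<^sup>2) + cos t * cos s))\<bar>
        \<le> p * (b\<^sup>2 * (2 * p + 1) + a\<^sup>2 * (2 * p + 1))"
      unfolding abs_mult[of p] using p0 by simp
    moreover have "(phase_s a b p t s)\<^sup>2 \<le> C1\<^sup>2" using s1[of t s] by (metis abs_ge_zero power2_abs power_mono)
    moreover have "(phase_s a b p t s)\<^sup>2 \<ge> 0" by simp
    ultimately show "\<bar>p * (b\<^sup>2 * (p * ((cos s)\<^sup>2 - (sin s)\<^sup>2) - sin t * sin s) - a\<^sup>2 * (p * ((cos s)\<^sup>2 - (sin s)\<^sup>2) + cos t * cos s))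
        - (phase_s a b p t s)\<^sup>2\<bar> \<le> p * (b\<^sup>2 * (2 * p + 1) + a\<^sup>2 * (2 * p + 1)) + C1\<^sup>2" by linarith
  qed
  show ?thesis
    using s1 s2 by (intro exI[of _ "max C1 C2"]) (auto simp: le_max_iff_disj)
qed

lemma phase_t_eq_0_iff: "phase_t a b p t s = 0 \<longleftrightarrow> snell a b p t s"
proof -
  have "phase_t a b p t s = 0 \<longleftrightarrow> b\<^sup>2 * cos t * (sin t + p * sin s) - a\<^sup>2 * sin t * (cos t + p * cos s) = 0"
    using phase_pos[of t s] by (simp add: phase_t_def)
  also have "\<dots> \<longleftrightarrow> snell a b p t s" unfolding snell_def by (auto simp: algebra_simps)
  finally show ?thesis .
qed

lemma phase_tt_nonzero:
  assumes "a\<^sup>2 - b\<^sup>2 < p * b\<^sup>2" "phase_t a b p t s = 0" shows "phase_tt a b p t s \<noteq> 0"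
proof -
  have "snell a b p t s" using assms(2) phase_t_eq_0_iff by simp
  from snell_nondegenerate[OF b0 ba p0 assms(1) this]
  have "b\<^sup>2 * ((cos t)\<^sup>2 - (sin t)\<^sup>2 - p * sin t * sin s) - a\<^sup>2 * ((cos t)\<^sup>2 - (sin t)\<^sup>2 + p * cos t * cos s) \<noteq> 0"
    by (simp add: algebra_simps)
  then show ?thesis using phase_pos[of t s] assms(2) by (simp add: phase_tt_def)
qed

text \<open>At a critical point the boundary normal is a refracted direction, and \<open>phase_s\<close> is the
  impact parameter of the refracted ray.\<close>

lemma phase_s_critical:
  assumes "phase_t a b p t s = 0"
  shows "(phase_s a b p t s)\<^sup>2 = p\<^sup>2 * a\<^sup>2 * b\<^sup>2 * ((sin t * cos s - cos t * sin s)\<^sup>2 / (b\<^sup>2 * (cos t)\<^sup>2 + a\<^sup>2 * (sin t)\<^sup>2))"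
proof -
  define x y where "x = a\<^sup>2 * (cos t + p * cos s)" and "y = b\<^sup>2 * (sin t + p * sin s)"
  define c z where "c = cos t" and "z = sin t"
  define N where "N = b\<^sup>2 * c\<^sup>2 + a\<^sup>2 * z\<^sup>2"
  have u: "c\<^sup>2 + z\<^sup>2 = 1" by (simp add: c_def z_def)
  have 0: "c * y - z * x = 0"
    using assms phase_pos[of t s] by (simp add: phase_t_def x_def y_def c_def z_def algebra_simps)
  define r where "r = c * x + z * y"
  \<comment> \<open>The critical equation makes \<open>(x, y)\<close> parallel to the unit vector
    \<open>(c, z)\<close>. All quantities are expressed through the factor \<open>r\<close>, which
    cancels at the end.\<close>
  have x: "x = r * c" and y: "y = r * z" unfolding r_def using 0 u by algebra+
  have F2: "(\<Phi> t s)\<^sup>2 * (a\<^sup>2 * b\<^sup>2) = r\<^sup>2 * N"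
  proof -
    have "(\<Phi> t s)\<^sup>2 * (a\<^sup>2 * b\<^sup>2) = b\<^sup>2 * x\<^sup>2 + a\<^sup>2 * y\<^sup>2"
      unfolding phase_sq x_def y_def by algebra
    also have "\<dots> = r\<^sup>2 * N" unfolding x y N_def by algebra
    finally show ?thesis .
  qed
  have "phase_s a b p t s * \<Phi> t s = p * (b\<^sup>2 * cos s * (sin t + p * sin s) - a\<^sup>2 * sin s * (cos t + p * cos s))"
    using phase_pos[of t s] by (simp add: phase_s_def)
  also have "\<dots> = p * (cos s * y - sin s * x)" unfolding x_def y_def by algebra
  also have "\<dots> = p * r * (z * cos s - c * sin s)" unfolding x y by algebra
  finally have S: "(phase_s a b p t s)\<^sup>2 * (\<Phi> t s)\<^sup>2 = p\<^sup>2 * r\<^sup>2 * (z * cos s - c * sin s)\<^sup>2"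
    by (metis power_mult_distrib)
  have ab: "a\<^sup>2 * b\<^sup>2 > 0" using b0 ba by simp
  have rN: "r\<^sup>2 * N > 0" unfolding F2[symmetric] using phase_pos[of t s] ab by (intro mult_pos_pos) auto
  then have N: "N \<noteq> 0" and r: "r\<^sup>2 \<noteq> 0" by auto
  have "(phase_s a b p t s)\<^sup>2 * (r\<^sup>2 * N) = p\<^sup>2 * r\<^sup>2 * (z * cos s - c * sin s)\<^sup>2 * (a\<^sup>2 * b\<^sup>2)"
    unfolding F2[symmetric] S[symmetric] by algebra
  then have "r\<^sup>2 * ((phase_s a b p t s)\<^sup>2 * N) = r\<^sup>2 * (p\<^sup>2 * a\<^sup>2 * b\<^sup>2 * (z * cos s - c * sin s)\<^sup>2)" by algebra
  then have "(phase_s a b p t s)\<^sup>2 * N = p\<^sup>2 * a\<^sup>2 * b\<^sup>2 * (z * cos s - c * sin s)\<^sup>2" using r by simp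
  then have "(phase_s a b p t s)\<^sup>2 = p\<^sup>2 * a\<^sup>2 * b\<^sup>2 * (z * cos s - c * sin s)\<^sup>2 / N" using N by (simp add: eq_divide_eq)
  then show ?thesis by (simp add: N_def c_def z_def)
qed

end

section \<open>Expansion of the transform in a perturbed direction\<close>

lemma taylor2_bound:
  fixes g g1 g2 :: "real \<Rightarrow> real"
  assumes g: "\<And>x. (g has_real_derivative g1 x) (at x)" and g1: "\<And>x. (g1 has_real_derivative g2 x) (at x)"
    and C: "\<And>x. \<bar>g2 x\<bar> \<le> C"
  shows "\<bar>g (x + d) - g x - d * g1 x\<bar> \<le> C * d\<^sup>2"
proof -
  have C0: "C \<ge> 0" using C[of 0] by linarith
  have lip: "\<bar>g1 y - g1 x\<bar> \<le> C * \<bar>y - x\<bar>" for y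
    using field_differentiable_bound[of UNIV g1 g2 C y x] g1 C by (auto simp: has_field_derivative_at_within)
  have "norm ((\<lambda>y. g y - y * g1 x) (x + d) - (\<lambda>y. g y - y * g1 x) x) \<le> (C * \<bar>d\<bar>) * norm (x + d - x)"
  proof (rule field_differentiable_bound[where S = "closed_segment x (x + d)" and f' = "\<lambda>y. g1 y - g1 x"])
    show "((\<lambda>y. g y - y * g1 x) has_field_derivative g1 y - g1 x) (at y within closed_segment x (x + d))" for y
      by (auto intro!: derivative_eq_intros has_field_derivative_at_within[OF g])
    show "norm (g1 y - g1 x) \<le> C * \<bar>d\<bar>" if "y \<in> closed_segment x (x + d)" for y
    proof -
      have "\<bar>y - x\<bar> \<le> \<bar>d\<bar>" using that by (auto simp: closed_segment_eq_real_ivl split: if_splits)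
      then have "C * \<bar>y - x\<bar> \<le> C * \<bar>d\<bar>" using C0 by (rule mult_left_mono)
      then show ?thesis using lip[of y] by simp
    qed
  qed auto
  then show ?thesis by (simp add: algebra_simps power2_eq_square abs_mult[symmetric])
qed

lemma norm_cis_diff_le: "norm (cis u - cis v) \<le> \<bar>u - v\<bar>"
proof -
  have "cis u - cis v = cis v * (cis (u - v) - 1)" by (simp add: algebra_simps cis_mult)
  then show ?thesis using norm_cis_diff_1_le[of "u - v"] by (simp add: norm_mult)
qed

lemma inverse_three_halves_deriv:
  assumes "x > 0" shows "((\<lambda>x. 1 / (x * sqrt x)) has_real_derivative - 3 / (2 * x\<^sup>2 * sqrt x)) (at x)"
proof -
  define r where "r = sqrt x"
  have r: "r > 0" "x = r * r" using assms by (simp_all add: r_def)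
  have s: "(sqrt has_real_derivative 1 / (2 * r)) (at x)"
    using DERIV_real_sqrt[OF assms] unfolding r_def[symmetric] by (simp add: inverse_eq_divide mult.commute)
  have "((\<lambda>x. x * sqrt x) has_real_derivative 1 * sqrt x + 1 / (2 * r) * x) (at x)"
    by (rule DERIV_mult[OF DERIV_ident s])
  then have "((\<lambda>x. x * sqrt x) has_real_derivative 3 / 2 * r) (at x)"
    unfolding r_def[symmetric] using r by (simp add: field_simps)
  from DERIV_divide[OF DERIV_const this, of 1]
  have "((\<lambda>x. 1 / (x * sqrt x)) has_real_derivative - (3 / 2 * r) / ((x * r) * (x * r))) (at x)"
    using r by (simp add: r_def[symmetric])
  moreover have "- (3 / 2 * r) / ((x * r) * (x * r)) = - 3 / (2 * x\<^sup>2 * r)"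
    using r by (simp add: field_simps power2_eq_square)
  ultimately show ?thesis by (simp add: r_def)
qed

context ellipse_phase
begin

lemma shift_deriv:
  assumes "\<And>t. (g has_real_derivative g1 t) (at t)"
  shows "((\<lambda>t. g (t - \<alpha>)) has_real_derivative g1 (t - \<alpha>)) (at t)"
proof -
  have "((\<lambda>t. t - \<alpha>) has_real_derivative 1) (at t)" by (auto intro!: derivative_eq_intros)
  from DERIV_chain2[where f = g and g = "\<lambda>t. t - \<alpha>", OF assms this] show ?thesis by simp
qed

text \<open>Read off from the finiteness part of \<open>stationary_phase\<close>, applied with
  amplitude 0 and one explicit sequence tending to infinity.\<close>

lemma finite_snell:
  assumes nd: "a\<^sup>2 - b\<^sup>2 < p * b\<^sup>2"
  shows "finite {t \<in> {-pi..pi}. snell a b p (t - \<alpha>) s}"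
proof -
  have "finite ({t. phase_t a b p (t - \<alpha>) s = 0} \<inter> {-pi..pi})"
  proof (rule conjunct1[OF stationary_phase[where h = "\<lambda>_. 0" and ?h1.0 = "\<lambda>_. 0" and k = "\<lambda>n. real (Suc n)"
        and f = "\<lambda>t. \<Phi> (t - \<alpha>) s" and ?f2.0 = "\<lambda>t. phase_tt a b p (t - \<alpha>) s"]])
    show "((\<lambda>t. \<Phi> (t - \<alpha>) s) has_real_derivative phase_t a b p (t - \<alpha>) s) (at t)" for t
      by (rule shift_deriv[OF phase_has_deriv_t])
    show "((\<lambda>t. phase_t a b p (t - \<alpha>) s) has_real_derivative phase_tt a b p (t - \<alpha>) s) (at t)" for t
      by (rule shift_deriv[OF phase_t_has_deriv_t])
    show "continuous_on UNIV (\<lambda>t. phase_tt a b p (t - \<alpha>) s)"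
      by (rule continuous_on_compose2[OF phase_continuous(4)[of UNIV]]) (auto intro!: continuous_intros)
    show "filterlim (\<lambda>n. real (Suc n)) at_top sequentially"
      by (rule filterlim_compose[OF filterlim_real_sequentially filterlim_Suc])
    show "phase_tt a b p (t - \<alpha>) s \<noteq> 0" if "phase_t a b p (t - \<alpha>) s = 0" for t
      by (rule phase_tt_nonzero[OF nd that])
  qed auto
  moreover have "{t \<in> {-pi..pi}. snell a b p (t - \<alpha>) s} = {t. phase_t a b p (t - \<alpha>) s = 0} \<inter> {-pi..pi}"
    by (auto simp: phase_t_eq_0_iff)
  ultimately show ?thesis by simp
qed

text \<open>Moving the refracted direction by \<open>\<sigma> / k\<close> changes the phase by \<open>\<sigma> * phase_s\<close> to leading order.\<close>

lemma disc_ft_phase_expansion: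
  assumes Z: "\<And>x. x \<ge> 1 \<Longrightarrow> \<bar>x * sqrt x * disc_ft x - Re (Z * cis (- x))\<bar> \<le> C1 / x"
  shows "\<exists>C\<ge>0. \<forall>K t. K \<ge> 1 \<and> K * phase_min \<ge> 1 \<longrightarrow>
     \<bar>K * sqrt K * disc_ft (K * \<Phi> t (s + \<sigma> / K))
      - 1 / (\<Phi> t s * sqrt (\<Phi> t s)) * Re (Z * cis (- (K * \<Phi> t s + \<sigma> * phase_s a b p t s)))\<bar> \<le> C / K"
proof -
  obtain C where C: "\<And>t s. \<bar>phase_s a b p t s\<bar> \<le> C" "\<And>t s. \<bar>phase_ss a b p t s\<bar> \<le> C"
    using phase_bounds by blast
  have C0: "C \<ge> 0" using C(1)[of 0 0] by linarith
  have C10: "C1 \<ge> 0" using Z[of 1] by simp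
  let ?m = phase_min
  note m = phase_min_pos
  define w where "w x = 1 / (x * sqrt x)" for x :: real
  define Wm where "Wm = 1 / (?m * sqrt ?m)"
  define Lw where "Lw = 3 / (2 * ?m\<^sup>2 * sqrt ?m)"
  have w: "\<bar>w x\<bar> \<le> Wm" if "x \<ge> ?m" for x
  proof -
    have "?m * sqrt ?m \<le> x * sqrt x" using that m by (intro mult_mono) auto
    then show ?thesis using that m by (simp add: w_def Wm_def frac_le)
  qed
  have lip: "\<bar>w x - w y\<bar> \<le> Lw * \<bar>x - y\<bar>" if xy: "x \<ge> ?m" "y \<ge> ?m" for x y
  proof -
    have "norm (w x - w y) \<le> Lw * norm (x - y)"
    proof (rule field_differentiable_bound[where S = "{?m..}" and f' = "\<lambda>x. - 3 / (2 * x\<^sup>2 * sqrt x)"])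
      show "(w has_field_derivative - 3 / (2 * x\<^sup>2 * sqrt x)) (at x within {?m..})" if "x \<in> {?m..}" for x
        unfolding w_def[abs_def]
        by (rule has_field_derivative_at_within, rule inverse_three_halves_deriv) (use that m in auto)
      show "norm (- 3 / (2 * x\<^sup>2 * sqrt x)) \<le> Lw" if "x \<in> {?m..}" for x
      proof -
        have "2 * ?m\<^sup>2 * sqrt ?m \<le> 2 * x\<^sup>2 * sqrt x" using that m by (intro mult_mono power_mono) auto
        moreover have "norm (- 3 / (2 * x\<^sup>2 * sqrt x)) = 3 / (2 * x\<^sup>2 * sqrt x)" using that m by (simp add: abs_mult)
        ultimately show ?thesis using m by (simp add: Lw_def frac_le)
      qed
    qed (use xy in auto)
    then show ?thesis by simp
  qed
  \<comment> \<open>Three sources of error: the remainder of the asymptotics, the change of the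
    weight \<open>w\<close> from the perturbed to the original direction, and the second order term
    of the phase.\<close>
  define Cc where "Cc = C1 / ?m * Wm + norm Z * (Lw * (C * \<bar>\<sigma>\<bar>)) + Wm * (norm Z * (C * \<sigma>\<^sup>2))"
  have Wm0: "Wm \<ge> 0" and Lw0: "Lw \<ge> 0" using m by (simp_all add: Wm_def Lw_def)
  have "Cc \<ge> 0" unfolding Cc_def using C0 C10 m Wm0 Lw0 by (intro add_nonneg_nonneg mult_nonneg_nonneg divide_nonneg_nonneg) auto
  moreover have "\<bar>K * sqrt K * disc_ft (K * \<Phi> t (s + \<sigma> / K))
      - w (\<Phi> t s) * Re (Z * cis (- (K * \<Phi> t s + \<sigma> * phase_s a b p t s)))\<bar> \<le> Cc / K"
    if K: "K \<ge> 1" "K * ?m \<ge> 1" for K t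
  proof -
    define x F \<mu> where "x = \<Phi> t (s + \<sigma> / K)" and "F = \<Phi> t s" and "\<mu> = phase_s a b p t s"
    define y where "y = K * x"
    have xm: "x \<ge> ?m" and Fm: "F \<ge> ?m" by (simp_all add: x_def F_def phase_ge)
    have x0: "x > 0" using xm m by linarith
    have Km: "K * ?m \<le> y" unfolding y_def using xm K by (intro mult_left_mono) auto
    define R where "R = y * sqrt y * disc_ft y - Re (Z * cis (- y))"
    have y1: "y \<ge> 1" using Km K by linarith
    have "\<bar>R\<bar> \<le> C1 / y" unfolding R_def by (rule Z[OF y1])
    also have "\<dots> \<le> C1 / (K * ?m)" using Km K C10 by (intro divide_left_mono) auto
    finally have R: "\<bar>R\<bar> \<le> C1 / ?m / K" by (simp add: mult.commute)
    have e: "K * sqrt K * disc_ft y = (Re (Z * cis (- y)) + R) * w x"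
    proof -
      have "y * sqrt y = (K * sqrt K) * (x * sqrt x)" by (simp add: y_def real_sqrt_mult)
      then have "(Re (Z * cis (- y)) + R) * w x = (K * sqrt K) * ((x * sqrt x) * w x) * disc_ft y"
        by (simp add: R_def mult_ac)
      also have "(x * sqrt x) * w x = 1" using x0 by (simp add: w_def)
      finally show ?thesis by simp
    qed
    have xF: "\<bar>x - F\<bar> \<le> C * \<bar>\<sigma>\<bar> / K"
    proof -
      have "norm (\<Phi> t (s + \<sigma> / K) - \<Phi> t s) \<le> C * norm (s + \<sigma> / K - s)"
        by (rule field_differentiable_bound[where S = UNIV and f' = "phase_s a b p t"])
           (auto intro: phase_has_deriv_s C)
      then show ?thesis using K by (simp add: x_def F_def abs_divide)
    qed
    have xF2: "\<bar>x - F - \<sigma> / K * \<mu>\<bar> \<le> C * (\<sigma> / K)\<^sup>2"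
      unfolding x_def F_def \<mu>_def by (rule taylor2_bound[OF phase_has_deriv_s phase_s_has_deriv_s C(2)])
    \<comment> \<open>The Taylor error of order \<open>(\<sigma> / K)^2\<close> is multiplied by
      \<open>K\<close> in the phase and still leaves order \<open>1 / K\<close>, while the first
      order term survives as \<open>\<sigma> * \<mu>\<close>. This balance dictates the size of the
      shift.\<close>
    have ph: "\<bar>Re (Z * cis (- y)) - Re (Z * cis (- (K * F + \<sigma> * \<mu>)))\<bar> \<le> norm Z * (C * \<sigma>\<^sup>2 / K)"
    proof -
      have "\<bar>Re (Z * cis (- y)) - Re (Z * cis (- (K * F + \<sigma> * \<mu>)))\<bar> = \<bar>Re (Z * (cis (- y) - cis (- (K * F + \<sigma> * \<mu>))))\<bar>"
        by (simp add: algebra_simps)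
      also have "\<dots> \<le> norm (Z * (cis (- y) - cis (- (K * F + \<sigma> * \<mu>))))" by (rule abs_Re_le_cmod)
      also have "\<dots> \<le> norm Z * \<bar>- y - (- (K * F + \<sigma> * \<mu>))\<bar>"
        unfolding norm_mult by (intro mult_left_mono norm_cis_diff_le) auto
      also have "- y - (- (K * F + \<sigma> * \<mu>)) = - (K * (x - F - \<sigma> / K * \<mu>))"
        using K by (simp add: y_def algebra_simps)
      also have "\<bar>- (K * (x - F - \<sigma> / K * \<mu>))\<bar> = K * \<bar>x - F - \<sigma> / K * \<mu>\<bar>" using K by (simp add: abs_mult)
      also have "norm Z * (K * \<bar>x - F - \<sigma> / K * \<mu>\<bar>) \<le> norm Z * (K * (C * (\<sigma> / K)\<^sup>2))"
        using xF2 K by (intro mult_left_mono) auto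
      also have "K * (C * (\<sigma> / K)\<^sup>2) = C * \<sigma>\<^sup>2 / K" using K by (simp add: power2_eq_square field_simps)
      finally show ?thesis .
    qed
    have ReZ: "\<bar>Re (Z * cis (- y))\<bar> \<le> norm Z" using abs_Re_le_cmod[of "Z * cis (- y)"] by (simp add: norm_mult)
    have "K * sqrt K * disc_ft y - w F * Re (Z * cis (- (K * F + \<sigma> * \<mu>)))
      = R * w x + Re (Z * cis (- y)) * (w x - w F) + w F * (Re (Z * cis (- y)) - Re (Z * cis (- (K * F + \<sigma> * \<mu>))))"
      unfolding e by (simp add: algebra_simps)
    moreover have "\<bar>R * w x\<bar> \<le> C1 / ?m / K * Wm"
      unfolding abs_mult by (rule mult_mono[OF R w[OF xm]]) (use C10 m K in auto)
    moreover have "\<bar>Re (Z * cis (- y)) * (w x - w F)\<bar> \<le> norm Z * (Lw * (C * \<bar>\<sigma>\<bar> / K))"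
      unfolding abs_mult[of "Re _"]
      by (rule mult_mono[OF ReZ order_trans[OF lip[OF xm Fm] mult_left_mono[OF xF Lw0]]]) auto
    moreover have "\<bar>w F * (Re (Z * cis (- y)) - Re (Z * cis (- (K * F + \<sigma> * \<mu>))))\<bar> \<le> Wm * (norm Z * (C * \<sigma>\<^sup>2 / K))"
      unfolding abs_mult[of "w F"] by (rule mult_mono[OF w[OF Fm] ph Wm0]) auto
    moreover have "C1 / ?m / K * Wm + norm Z * (Lw * (C * \<bar>\<sigma>\<bar> / K)) + Wm * (norm Z * (C * \<sigma>\<^sup>2 / K)) = Cc / K"
      unfolding Cc_def add_divide_distrib by simp
    ultimately show ?thesis unfolding y_def x_def F_def \<mu>_def by linarith
  qed
  ultimately show ?thesis unfolding w_def by blast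
qed

text \<open>Stationary phase turns the vanishing integrals into exponential sums in \<sigma> that
  tend to zero, with frequencies \<open>\<mu> t\<close> and \<open>- \<mu> t\<close> over the
  critical points. The assumptions isolate \<open>\<mu> t1\<close> among these frequencies, and its
  coefficient has constant modulus, proportional to that of \<open>\<phi> t1\<close>.\<close>

lemma density_zero_at_critical:
  fixes \<phi> \<phi>1 :: "real \<Rightarrow> complex" and k :: "nat \<Rightarrow> real"
  assumes \<phi>: "\<And>t. (\<phi> has_vector_derivative \<phi>1 t) (at t)" and \<phi>1: "continuous_on UNIV \<phi>1"
    and k: "\<And>n. k n \<ge> 1" "filterlim k at_top sequentially"
    and zero: "\<And>n s. integral {-pi..pi} (\<lambda>t. \<phi> t * of_real (disc_ft (k n * \<Phi> (t - \<alpha>) s))) = 0"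
    and nd: "a\<^sup>2 - b\<^sup>2 < p * b\<^sup>2"
    and t1: "- pi < t1" "t1 < pi" and crit: "snell a b p (t1 - \<alpha>) s"
    and ne0: "sin (t1 - \<alpha>) * cos s - cos (t1 - \<alpha>) * sin s \<noteq> 0"
    and sep: "\<And>t. snell a b p (t - \<alpha>) s \<Longrightarrow> (cos (t - \<alpha>), sin (t - \<alpha>)) \<noteq> (cos (t1 - \<alpha>), sin (t1 - \<alpha>)) \<Longrightarrow>
       (sin (t - \<alpha>) * cos s - cos (t - \<alpha>) * sin s)\<^sup>2 / (b\<^sup>2 * (cos (t - \<alpha>))\<^sup>2 + a\<^sup>2 * (sin (t - \<alpha>))\<^sup>2)
       \<noteq> (sin (t1 - \<alpha>) * cos s - cos (t1 - \<alpha>) * sin s)\<^sup>2 / (b\<^sup>2 * (cos (t1 - \<alpha>))\<^sup>2 + a\<^sup>2 * (sin (t1 - \<alpha>))\<^sup>2)"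
  shows "\<phi> t1 = 0"
proof -
  define F F1 F2 \<mu> \<mu>1 where "F t = \<Phi> (t - \<alpha>) s" and "F1 t = phase_t a b p (t - \<alpha>) s"
    and "F2 t = phase_tt a b p (t - \<alpha>) s" and "\<mu> t = phase_s a b p (t - \<alpha>) s" and "\<mu>1 t = phase_st a b p (t - \<alpha>) s" for t
  have dF: "(F has_real_derivative F1 t) (at t)" and dF1: "(F1 has_real_derivative F2 t) (at t)"
    and d\<mu>: "(\<mu> has_real_derivative \<mu>1 t) (at t)" for t
    unfolding F_def[abs_def] F1_def[abs_def] F2_def[abs_def] \<mu>_def[abs_def] \<mu>1_def[abs_def]
    by (rule shift_deriv phase_has_deriv_t phase_t_has_deriv_t phase_s_has_deriv_t)+
  have sh: "continuous_on UNIV (\<lambda>t::real. t - \<alpha>)" by (intro continuous_intros)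
  have cF: "continuous_on UNIV F" and cF1: "continuous_on UNIV F1" and cF2: "continuous_on UNIV F2"
    and c\<mu>: "continuous_on UNIV \<mu>" and c\<mu>1: "continuous_on UNIV \<mu>1"
    unfolding F_def[abs_def] F1_def[abs_def] F2_def[abs_def] \<mu>_def[abs_def] \<mu>1_def[abs_def]
    by (rule continuous_on_compose2[OF phase_continuous(1)[of UNIV] sh] continuous_on_compose2[OF phase_continuous(2)[of UNIV] sh]
        continuous_on_compose2[OF phase_continuous(3)[of UNIV] sh] continuous_on_compose2[OF phase_continuous(4)[of UNIV] sh]
        continuous_on_compose2[OF phase_continuous(5)[of UNIV] sh]; simp)+
  have c\<phi>: "continuous_on UNIV \<phi>"
    by (rule continuous_on_vector_derivative) (rule has_vector_derivative_at_within[OF \<phi>])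
  have F0: "F t > 0" for t by (simp add: F_def phase_pos)
  define w where "w t = 1 / (F t * sqrt (F t))" for t
  define w1 where "w1 t = - 3 / (2 * (F t)\<^sup>2 * sqrt (F t)) * F1 t" for t
  have dw: "(w has_real_derivative w1 t) (at t)" for t
    unfolding w_def[abs_def] w1_def by (rule DERIV_chain2[where f = "\<lambda>x. 1 / (x * sqrt x)" and g = F, OF inverse_three_halves_deriv[OF F0] dF])
  have Fne: "F t \<noteq> 0" for t using F0[of t] by simp
  have cw: "continuous_on UNIV w" and cw1: "continuous_on UNIV w1"
    unfolding w_def[abs_def] w1_def[abs_def] by (intro continuous_intros cF cF1; use Fne in simp)+
  obtain Z C1 where Z0: "Z \<noteq> 0" and Z: "\<And>x. x \<ge> 1 \<Longrightarrow> \<bar>x * sqrt x * disc_ft x - Re (Z * cis (- x))\<bar> \<le> C1 / x"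
    using disc_ft_asymptotics by blast
  have k0: "k n > 0" for n using k(1)[of n] by linarith
  have sk: "filterlim (\<lambda>n. sqrt (k n)) at_top sequentially"
    using k(2) by (rule filterlim_compose[OF sqrt_at_top])
  have isk: "(\<lambda>n. 1 / sqrt (k n)) \<longlonglongrightarrow> 0"
    using tendsto_divide_0[OF tendsto_const filterlim_at_top_imp_at_infinity[OF sk], of 1] by simp
  obtain M where M: "M > 0" "\<And>t. t \<in> {-pi..pi} \<Longrightarrow> norm (\<phi> t) \<le> M"
    using compact_imp_bounded[OF compact_continuous_image[OF continuous_on_subset[OF c\<phi>] compact_Icc], of "-pi" pi]
    by (auto simp: bounded_pos)

  \<comment> \<open>The direction \<open>s + \<sigma> / k n\<close> changes with \<open>n\<close>,
    which is possible because \<open>zero\<close> holds for all directions. The expansion has an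
    error of order \<open>1 / k n\<close>, small even after multiplication by
    \<open>sqrt (k n)\<close>.\<close>
  have main: "(\<lambda>n. sqrt (k n) *\<^sub>R integral {-pi..pi} (\<lambda>t. \<phi> t * of_real (w t * Re (Z * cis (- (k n * F t + \<sigma> * \<mu> t)))))) \<longlonglongrightarrow> 0" for \<sigma>
  proof -
    obtain C where C: "C \<ge> 0" "\<And>K t. K \<ge> 1 \<Longrightarrow> K * phase_min \<ge> 1 \<Longrightarrow>
       \<bar>K * sqrt K * disc_ft (K * \<Phi> t (s + \<sigma> / K))
        - 1 / (\<Phi> t s * sqrt (\<Phi> t s)) * Re (Z * cis (- (K * \<Phi> t s + \<sigma> * phase_s a b p t s)))\<bar> \<le> C / K"
      using disc_ft_phase_expansion[OF Z] by blast
    have ev: "\<forall>\<^sub>F n in sequentially. k n * phase_min \<ge> 1"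
    proof -
      have "\<forall>\<^sub>F n in sequentially. k n \<ge> 1 / phase_min" using k(2) by (simp add: filterlim_at_top)
      then show ?thesis by eventually_elim (use phase_min_pos in \<open>simp add: field_simps\<close>)
    qed
    show ?thesis
    proof (rule Lim_null_comparison[where g = "\<lambda>n. (M * C * (2 * pi)) * (1 / sqrt (k n))"])
      show "\<forall>\<^sub>F n in sequentially. norm (sqrt (k n) *\<^sub>R integral {-pi..pi} (\<lambda>t. \<phi> t * of_real (w t * Re (Z * cis (- (k n * F t + \<sigma> * \<mu> t))))))
         \<le> (M * C * (2 * pi)) * (1 / sqrt (k n))"
        using ev
      proof eventually_elim
        case (elim n)
        define K where "K = k n"
        have K: "K \<ge> 1" "K > 0" using k(1)[of n] k0[of n] by (simp_all add: K_def)
        define J where "J t = disc_ft (K * \<Phi> (t - \<alpha>) (s + \<sigma> / K))" for t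
        define V where "V t = w t * Re (Z * cis (- (K * F t + \<sigma> * \<mu> t)))" for t
        have cJ: "continuous_on {-pi..pi} J"
          unfolding J_def[abs_def]
          by (rule continuous_on_compose2[OF continuous_on_disc_ft[of UNIV]])
             (auto intro!: continuous_intros continuous_on_compose2[OF phase_continuous(1)[of UNIV]])
        have cV: "continuous_on {-pi..pi} V"
          unfolding V_def[abs_def] cis.ctr Complex_eq
          by (intro continuous_intros continuous_on_subset[OF cw] continuous_on_subset[OF cF] continuous_on_subset[OF c\<mu>]) auto
        have c\<phi>': "continuous_on {-pi..pi} \<phi>" using c\<phi> by (rule continuous_on_subset) simp
        have i1: "(\<lambda>t. \<phi> t * of_real (J t)) integrable_on {-pi..pi}" and i2: "(\<lambda>t. \<phi> t * of_real (V t)) integrable_on {-pi..pi}"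
          by (intro integrable_continuous_real continuous_intros c\<phi>' cJ cV)+
        have "integral {-pi..pi} (\<lambda>t. \<phi> t * of_real (K * sqrt K * J t - V t))
          = integral {-pi..pi} (\<lambda>t. (K * sqrt K) *\<^sub>R (\<phi> t * of_real (J t)) - \<phi> t * of_real (V t))"
          by (rule integral_cong) (simp add: algebra_simps scaleR_conv_of_real)
        also have "\<dots> = (K * sqrt K) *\<^sub>R integral {-pi..pi} (\<lambda>t. \<phi> t * of_real (J t)) - integral {-pi..pi} (\<lambda>t. \<phi> t * of_real (V t))"
          using i1 i2 by (simp add: Henstock_Kurzweil_Integration.integral_diff integrable_cmul)
        also have "integral {-pi..pi} (\<lambda>t. \<phi> t * of_real (J t)) = 0"
          using zero[of n "s + \<sigma> / K"] by (simp add: J_def K_def)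
        finally have eq: "integral {-pi..pi} (\<lambda>t. \<phi> t * of_real (V t)) = - integral {-pi..pi} (\<lambda>t. \<phi> t * of_real (K * sqrt K * J t - V t))"
          by simp
        have "norm (integral {-pi..pi} (\<lambda>t. \<phi> t * of_real (K * sqrt K * J t - V t))) \<le> M * (C / K) * (pi - (- pi))"
        proof (rule integral_bound)
          show "continuous_on {-pi..pi} (\<lambda>t. \<phi> t * of_real (K * sqrt K * J t - V t))"
            by (intro continuous_intros c\<phi>' cJ cV)
          show "norm (\<phi> t * of_real (K * sqrt K * J t - V t)) \<le> M * (C / K)" if "t \<in> {-pi..pi}" for t
          proof -
            have "\<bar>K * sqrt K * J t - V t\<bar> \<le> C / K"
              using C(2)[OF K(1), of "t - \<alpha>"] elim by (simp add: J_def V_def w_def F_def \<mu>_def K_def)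
            then show ?thesis unfolding norm_mult norm_of_real using M(2)[OF that] M(1) by (intro mult_mono) auto
          qed
        qed simp
        then have "norm (sqrt K *\<^sub>R integral {-pi..pi} (\<lambda>t. \<phi> t * of_real (V t))) \<le> sqrt K * (M * (C / K) * (2 * pi))"
          unfolding eq norm_scaleR norm_minus_cancel using K by (intro mult_mono) auto
        also have "\<dots> = (M * C * (2 * pi)) * (sqrt K / K)" by simp
        also have "\<dots> = (M * C * (2 * pi)) * (1 / sqrt K)" using K by (simp add: sqrt_divide_self_eq inverse_eq_divide)
        finally show ?case by (simp add: V_def K_def)
      qed
    qed (use tendsto_mult_right_zero[OF isk] in blast)
  qed

  define S where "S = {t. F1 t = 0} \<inter> {-pi..pi}"
  have nondeg: "F2 t \<noteq> 0" if "F1 t = 0" for t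
    using phase_tt_nonzero[OF nd] that by (simp add: F1_def F2_def)
  define c where "c t = fresnel_const (F2 t)" for t
  \<comment> \<open>The amplitude \<open>g\<close> is general, to be taken as \<phi> and as its
    conjugate. The modulation by \<sigma> belongs to the amplitude, so the phase \<open>F\<close>
    and its critical points do not depend on it.\<close>
  have sp: "finite S \<and> (\<lambda>n. sqrt (k n) *\<^sub>R integral {-pi..pi} (\<lambda>t. (g t * of_real (w t) * cis (\<sigma> * \<mu> t)) * cis (k n * F t))
      - (\<Sum>t\<in>S. of_real (side_count (-pi) pi t) * ((g t * of_real (w t) * cis (\<sigma> * \<mu> t)) * c t * cis (k n * F t)))) \<longlonglongrightarrow> 0"
    if g: "\<And>t. (g has_vector_derivative g1 t) (at t)" and g1: "continuous_on UNIV g1" for g g1 :: "real \<Rightarrow> complex" and \<sigma>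
  proof -
    have cg: "continuous_on UNIV g"
      by (rule continuous_on_vector_derivative) (rule has_vector_derivative_at_within[OF g])
    have hd: "((\<lambda>t. g t * of_real (w t) * cis (\<sigma> * \<mu> t)) has_vector_derivative
       g t * of_real (w t) * (of_real (\<sigma> * \<mu>1 t) * \<i> * cis (\<sigma> * \<mu> t)) + (g t * of_real (w1 t) + g1 t * of_real (w t)) * cis (\<sigma> * \<mu> t)) (at t)" for t
      by (intro has_vector_derivative_mult has_vector_derivative_of_real has_vector_derivative_cis dw g DERIV_cmult d\<mu>)
    have hc: "continuous_on UNIV (\<lambda>t. g t * of_real (w t) * (of_real (\<sigma> * \<mu>1 t) * \<i> * cis (\<sigma> * \<mu> t)) + (g t * of_real (w1 t) + g1 t * of_real (w t)) * cis (\<sigma> * \<mu> t))"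
      unfolding cis.ctr Complex_eq by (intro continuous_intros cg g1 cw cw1 c\<mu> c\<mu>1)
    show ?thesis
      unfolding S_def c_def by (rule stationary_phase[OF dF dF1 cF2 hd hc _ nondeg k]) simp
  qed
  have d\<phi>c: "((\<lambda>t. cnj (\<phi> t)) has_vector_derivative cnj (\<phi>1 t)) (at t)" for t
    using \<phi>[of t] by (rule has_vector_derivative_cnj)
  have c\<phi>1c: "continuous_on UNIV (\<lambda>t. cnj (\<phi>1 t))" using \<phi>1 by (intro continuous_intros)
  have fin: "finite S" using sp[OF \<phi> \<phi>1] by blast

  define sc where "sc t = complex_of_real (side_count (-pi) pi t)" for t
  \<comment> \<open>\<open>A\<close> collects the contributions that oscillate like
    \<open>cis (k n * F t)\<close>, and \<open>A'\<close> those of the conjugate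
    oscillation.\<close>
  define A where "A n t = cnj Z * sc t * \<phi> t * of_real (w t) * c t * cis (k n * F t)" for n t
  define A' where "A' n t = Z * sc t * \<phi> t * of_real (w t) * cnj (c t) * cis (- (k n * F t))" for n t
  have lim: "(\<lambda>n. (\<Sum>t\<in>S. A n t * cis (\<sigma> * \<mu> t)) + (\<Sum>t\<in>S. A' n t * cis (\<sigma> * (- \<mu> t)))) \<longlonglongrightarrow> 0" for \<sigma>
  proof -
    define I I' where "I n = sqrt (k n) *\<^sub>R integral {-pi..pi} (\<lambda>t. (\<phi> t * of_real (w t) * cis (\<sigma> * \<mu> t)) * cis (k n * F t))"
      and "I' n = sqrt (k n) *\<^sub>R integral {-pi..pi} (\<lambda>t. (cnj (\<phi> t) * of_real (w t) * cis (\<sigma> * \<mu> t)) * cis (k n * F t))" for n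
    define S1 S2 where "S1 n = (\<Sum>t\<in>S. sc t * ((\<phi> t * of_real (w t) * cis (\<sigma> * \<mu> t)) * c t * cis (k n * F t)))"
      and "S2 n = (\<Sum>t\<in>S. sc t * ((cnj (\<phi> t) * of_real (w t) * cis (\<sigma> * \<mu> t)) * c t * cis (k n * F t)))" for n
    have l1: "(\<lambda>n. I n - S1 n) \<longlonglongrightarrow> 0" using sp[OF \<phi> \<phi>1, of \<sigma>] by (simp add: I_def S1_def sc_def)
    have l2: "(\<lambda>n. I' n - S2 n) \<longlonglongrightarrow> 0" using sp[OF d\<phi>c c\<phi>1c, of \<sigma>] by (simp add: I'_def S2_def sc_def)
    \<comment> \<open>Twice a real part is the sum of a number and its conjugate. \<open>I\<close>
      carries one of the two exponentials; the other is the conjugate of \<open>I'\<close>, which is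
      formed with the conjugate density so that \<phi> itself reappears.\<close>
    have l3: "(\<lambda>n. cnj Z * I n + Z * cnj (I' n)) \<longlonglongrightarrow> 0"
    proof -
      have ii: "(\<lambda>t. (g t * of_real (w t) * cis (\<sigma> * \<mu> t)) * cis (k n * F t)) integrable_on {-pi..pi}"
        if "continuous_on UNIV g" for g :: "real \<Rightarrow> complex" and n
        unfolding cis.ctr Complex_eq using that
        by (intro integrable_continuous_real continuous_on_subset[of UNIV _ "{-pi..pi}"] continuous_intros cw c\<mu> cF) auto
      have ccj: "continuous_on UNIV (\<lambda>t. cnj (\<phi> t))" using c\<phi> by (intro continuous_intros)
      have "cnj Z * I n + Z * cnj (I' n) = 2 * (sqrt (k n) *\<^sub>R integral {-pi..pi} (\<lambda>t. \<phi> t * of_real (w t * Re (Z * cis (- (k n * F t + \<sigma> * \<mu> t))))))" for n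
      proof -
        let ?u = "\<lambda>t. (\<phi> t * of_real (w t) * cis (\<sigma> * \<mu> t)) * cis (k n * F t)"
        let ?u' = "\<lambda>t. (cnj (\<phi> t) * of_real (w t) * cis (\<sigma> * \<mu> t)) * cis (k n * F t)"
        have h1: "(?u has_integral integral {-pi..pi} ?u) {-pi..pi}" using ii[OF c\<phi>] by (rule integrable_integral)
        have h2: "((\<lambda>t. cnj (?u' t)) has_integral cnj (integral {-pi..pi} ?u')) {-pi..pi}"
          using integrable_integral[OF ii[OF ccj, of n]] has_integral_cnj[of ?u' "integral {-pi..pi} ?u'" "{-pi..pi}"]
          by (simp only: o_def)
        have "((\<lambda>t. cnj Z * ?u t + Z * cnj (?u' t)) has_integral (cnj Z * integral {-pi..pi} ?u + Z * cnj (integral {-pi..pi} ?u'))) {-pi..pi}"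
          by (intro has_integral_add has_integral_mult_right h1 h2)
        moreover have "cnj Z * ?u t + Z * cnj (?u' t) = 2 * (\<phi> t * of_real (w t * Re (Z * cis (- (k n * F t + \<sigma> * \<mu> t)))))" for t
        proof -
          have 1: "?u t = \<phi> t * of_real (w t) * cis (k n * F t + \<sigma> * \<mu> t)" by (simp add: mult.assoc cis_mult add.commute)
          have 2: "cnj (?u' t) = \<phi> t * of_real (w t) * cis (- (k n * F t + \<sigma> * \<mu> t))"
            by (simp add: mult.assoc cis_mult cis_cnj add.commute)
          have 3: "2 * complex_of_real (Re (Z * cis (- x))) = Z * cis (- x) + cnj Z * cis x" for x
            using complex_add_cnj[of "Z * cis (- x)"] by (simp add: cis_cnj)
          have "cnj Z * ?u t + Z * cnj (?u' t) = \<phi> t * of_real (w t) * (Z * cis (- (k n * F t + \<sigma> * \<mu> t)) + cnj Z * cis (k n * F t + \<sigma> * \<mu> t))"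
            unfolding 1 2 by (simp add: algebra_simps)
          also have "\<dots> = \<phi> t * of_real (w t) * (2 * of_real (Re (Z * cis (- (k n * F t + \<sigma> * \<mu> t)))))" unfolding 3 ..
          finally show ?thesis unfolding of_real_mult by (simp only: mult_ac)
        qed
        ultimately have "integral {-pi..pi} (\<lambda>t. 2 * (\<phi> t * of_real (w t * Re (Z * cis (- (k n * F t + \<sigma> * \<mu> t))))))
           = cnj Z * integral {-pi..pi} ?u + Z * cnj (integral {-pi..pi} ?u')"
          by (simp only: integral_unique)
        then have "2 * integral {-pi..pi} (\<lambda>t. \<phi> t * of_real (w t * Re (Z * cis (- (k n * F t + \<sigma> * \<mu> t)))))
           = cnj Z * integral {-pi..pi} ?u + Z * cnj (integral {-pi..pi} ?u')"
          by (simp only: integral_mult_right)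
        then show ?thesis
          unfolding I_def I'_def complex_cnj_scaleR mult_scaleR_right scaleR_add_right[symmetric] by (simp only:)
      qed
      then show ?thesis using tendsto_mult_left[OF main[of \<sigma>], of 2] by simp
    qed
    have "(\<lambda>n. (cnj Z * I n + Z * cnj (I' n)) - cnj Z * (I n - S1 n) - Z * cnj (I' n - S2 n)) \<longlonglongrightarrow> 0 - cnj Z * 0 - Z * cnj 0"
      by (intro tendsto_intros l1 l2 l3)
    moreover have "(cnj Z * I n + Z * cnj (I' n)) - cnj Z * (I n - S1 n) - Z * cnj (I' n - S2 n) = cnj Z * S1 n + Z * cnj (S2 n)" for n
      by (simp add: algebra_simps)
    moreover have "cnj Z * S1 n = (\<Sum>t\<in>S. A n t * cis (\<sigma> * \<mu> t))" for n
      unfolding S1_def A_def sum_distrib_left by (intro sum.cong refl) (simp only: mult_ac)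
    moreover have "Z * cnj (S2 n) = (\<Sum>t\<in>S. A' n t * cis (\<sigma> * (- \<mu> t)))" for n
      unfolding S2_def A'_def cnj_sum sum_distrib_left
      by (intro sum.cong refl) (simp add: cis_cnj sc_def mult_ac)
    ultimately show ?thesis by simp
  qed

  have t1S: "t1 \<in> S" using crit t1 by (simp add: S_def F1_def phase_t_eq_0_iff)
  have N: "p\<^sup>2 * a\<^sup>2 * b\<^sup>2 \<noteq> 0" using p0 b0 ba by simp
  have \<mu>2: "(\<mu> t)\<^sup>2 = p\<^sup>2 * a\<^sup>2 * b\<^sup>2 * ((sin (t - \<alpha>) * cos s - cos (t - \<alpha>) * sin s)\<^sup>2 / (b\<^sup>2 * (cos (t - \<alpha>))\<^sup>2 + a\<^sup>2 * (sin (t - \<alpha>))\<^sup>2))"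
    if "t \<in> S" for t
    unfolding \<mu>_def using that by (intro phase_s_critical) (simp add: S_def F1_def)
  \<comment> \<open>Equal squared frequencies give the same point of the circle by
    \<open>sep\<close>. The closed interval contains both \<open>- pi\<close> and \<open>pi\<close>,
    but \<open>t1\<close> is interior, so a difference of a full period cannot occur.\<close>
  have uniq: "t = t1" if t: "t \<in> S" and eq: "(\<mu> t)\<^sup>2 = (\<mu> t1)\<^sup>2" for t
  proof -
    have "snell a b p (t - \<alpha>) s" using t by (simp add: S_def F1_def phase_t_eq_0_iff)
    moreover have "(sin (t - \<alpha>) * cos s - cos (t - \<alpha>) * sin s)\<^sup>2 / (b\<^sup>2 * (cos (t - \<alpha>))\<^sup>2 + a\<^sup>2 * (sin (t - \<alpha>))\<^sup>2)
       = (sin (t1 - \<alpha>) * cos s - cos (t1 - \<alpha>) * sin s)\<^sup>2 / (b\<^sup>2 * (cos (t1 - \<alpha>))\<^sup>2 + a\<^sup>2 * (sin (t1 - \<alpha>))\<^sup>2)"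
      using eq unfolding \<mu>2[OF t] \<mu>2[OF t1S] mult_left_cancel[OF N] .
    ultimately have "cos (t - \<alpha>) = cos (t1 - \<alpha>) \<and> sin (t - \<alpha>) = sin (t1 - \<alpha>)"
      using sep[of t] by blast
    then obtain n :: int where n: "t - \<alpha> = t1 - \<alpha> + 2 * pi * of_int n" using sin_cos_eq_iff by blast
    have "\<bar>t - t1\<bar> < 2 * pi" using t t1 by (auto simp: S_def)
    then have "\<bar>2 * pi * of_int n\<bar> < 2 * pi * 1" using n by simp
    then have "\<bar>of_int n\<bar> < (1::real)" by (simp add: abs_mult)
    then have "n = 0" by linarith
    then show ?thesis using n by simp
  qed
  have \<mu>1: "\<mu> t1 \<noteq> 0"
  proof
    assume "\<mu> t1 = 0"
    then have "(sin (t1 - \<alpha>) * cos s - cos (t1 - \<alpha>) * sin s)\<^sup>2 / (b\<^sup>2 * (cos (t1 - \<alpha>))\<^sup>2 + a\<^sup>2 * (sin (t1 - \<alpha>))\<^sup>2) = 0"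
      using \<mu>2[OF t1S] N by simp
    moreover have "b\<^sup>2 * (cos (t1 - \<alpha>))\<^sup>2 + a\<^sup>2 * (sin (t1 - \<alpha>))\<^sup>2 \<noteq> 0"
    proof
      assume "b\<^sup>2 * (cos (t1 - \<alpha>))\<^sup>2 + a\<^sup>2 * (sin (t1 - \<alpha>))\<^sup>2 = 0"
      then have "cos (t1 - \<alpha>) = 0" "sin (t1 - \<alpha>) = 0" using b0 ba by (auto simp: add_nonneg_eq_0_iff)
      then show False using sin_zero_norm_cos_one[of "t1 - \<alpha>"] by simp
    qed
    ultimately show False using ne0 by simp
  qed
  \<comment> \<open>The disjoint sum of index sets keeps \<open>- \<mu> t1\<close> among the
    competing frequencies; it differs from \<open>\<mu> t1\<close> because the latter is
    nonzero.\<close>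
  have "(\<lambda>n. A n t1) \<longlonglongrightarrow> 0"
  proof (rule exponential_separation[where I = "(S - {t1}) <+> S" and ?\<nu>0.0 = "\<mu> t1"
        and a = "\<lambda>n. case_sum (A n) (A' n)" and \<nu> = "case_sum \<mu> (\<lambda>t. - \<mu> t)"])
    show "finite ((S - {t1}) <+> S)" using fin by simp
    have "A n t1 * cis (\<sigma> * \<mu> t1) + (\<Sum>i\<in>(S - {t1}) <+> S. case_sum (A n) (A' n) i * cis (\<sigma> * case_sum \<mu> (\<lambda>t. - \<mu> t) i))
       = (\<Sum>t\<in>S. A n t * cis (\<sigma> * \<mu> t)) + (\<Sum>t\<in>S. A' n t * cis (\<sigma> * (- \<mu> t)))" for n \<sigma>
      using fin by (simp add: sum.Plus o_def sum.remove[OF fin t1S])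
    then show "(\<lambda>n. A n t1 * cis (\<sigma> * \<mu> t1) + (\<Sum>i\<in>(S - {t1}) <+> S. case_sum (A n) (A' n) i * cis (\<sigma> * case_sum \<mu> (\<lambda>t. - \<mu> t) i))) \<longlonglongrightarrow> 0" for \<sigma>
      using lim[of \<sigma>] by simp
    show "case_sum \<mu> (\<lambda>t. - \<mu> t) i \<noteq> \<mu> t1" if "i \<in> (S - {t1}) <+> S" for i
      using that
    proof
      fix t assume i: "i = Inl t" and "t \<in> S - {t1}"
      then have "\<mu> t \<noteq> \<mu> t1" using uniq[of t] by auto
      then show ?thesis by (simp add: i)
    next
      fix t assume i: "i = Inr t" and t: "t \<in> S"
      have "- \<mu> t \<noteq> \<mu> t1"
      proof
        assume e: "- \<mu> t = \<mu> t1"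
        then have "(\<mu> t)\<^sup>2 = (\<mu> t1)\<^sup>2" by (metis power2_minus)
        then have "t = t1" by (rule uniq[OF t])
        then show False using e \<mu>1 by simp
      qed
      then show ?thesis by (simp add: i)
    qed
  qed
  \<comment> \<open>The oscillating factor of \<open>A n t1\<close> is unimodular, so the norms form
    a constant sequence that tends to 0.\<close>
  then have "(\<lambda>n. norm (A n t1)) \<longlonglongrightarrow> 0" by (rule tendsto_norm_zero)
  moreover have "norm (A n t1) = norm Z * norm (sc t1) * norm (\<phi> t1) * \<bar>w t1\<bar> * norm (c t1)" for n
    by (simp add: A_def norm_mult)
  ultimately have "norm Z * norm (sc t1) * norm (\<phi> t1) * \<bar>w t1\<bar> * norm (c t1) = 0" by (simp add: LIMSEQ_const_iff)
  moreover have "c t1 \<noteq> 0" unfolding c_def using t1S by (intro fresnel_const_nonzero nondeg) (simp add: S_def)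
  moreover have "w t1 \<noteq> 0" using F0[of t1] by (simp add: w_def)
  moreover have "sc t1 \<noteq> 0" using t1 by (simp add: sc_def side_count_def)
  ultimately show ?thesis using Z0 by simp
qed

end

section \<open>Periodic densities and the conclusion\<close>

lemma periodic_int:
  fixes \<phi> :: "real \<Rightarrow> complex"
  assumes per: "\<And>t. \<phi> (t + 2 * pi) = \<phi> t"
  shows "\<phi> (t + 2 * pi * of_int n) = \<phi> t"
proof -
  have nat: "\<phi> (t + 2 * pi * real m) = \<phi> t" for m :: nat and t
  proof (induction m)
    case (Suc m)
    have eq: "t + 2 * pi * real (Suc m) = (t + 2 * pi * real m) + 2 * pi" by (simp add: algebra_simps)
    show ?case unfolding eq per by (rule Suc)
  qed simp
  show ?thesis
  proof (cases "n \<ge> 0")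
    case True
    then show ?thesis using nat[of t "nat n"] by simp
  next
    case False
    then show ?thesis using nat[of "t + 2 * pi * of_int n" "nat (- n)"] by (simp add: algebra_simps)
  qed
qed

text \<open>Periodicity moves a point where \<phi> is nonzero into one period, and continuity
  spreads it to an interval. This contradicts vanishing outside a finite set.\<close>

lemma nonzero_interval:
  fixes \<phi> :: "real \<Rightarrow> complex"
  assumes per: "\<And>t. \<phi> (t + 2 * pi) = \<phi> t" and cont: "continuous_on UNIV \<phi>" and ne: "\<phi> t \<noteq> 0"
  shows "infinite {t. - pi < t \<and> t < pi \<and> \<phi> t \<noteq> 0}"
proof -
  define n where "n = \<lfloor>(t + pi) / (2 * pi)\<rfloor>"
  define u where "u = t + 2 * pi * of_int (- n)"
  have "\<phi> u \<noteq> 0" using periodic_int[where \<phi> = \<phi>, OF per, of t "- n"] ne unfolding u_def by simp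
  have "of_int n \<le> (t + pi) / (2 * pi)" "(t + pi) / (2 * pi) < of_int n + 1" unfolding n_def by linarith+
  then have "of_int n * (2 * pi) \<le> t + pi" "t + pi < (of_int n + 1) * (2 * pi)"
    by (simp_all add: pos_le_divide_eq pos_divide_less_eq)
  then have u: "- pi \<le> u" "u < pi" by (simp_all add: u_def algebra_simps)
  have "isCont \<phi> u" using cont by (simp add: continuous_on_eq_continuous_at)
  then obtain e where e: "e > 0" "\<And>y. dist u y < e \<Longrightarrow> \<phi> y \<noteq> 0"
    using continuous_at_avoid[of u \<phi> 0] \<open>\<phi> u \<noteq> 0\<close> by auto
  \<comment> \<open>The point \<open>u\<close> may be the end point \<open>- pi\<close>, so the
    neighbourhood is taken to the right of it; the bound \<open>pi - u\<close> keeps it inside the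
    open period.\<close>
  define e' where "e' = min e (pi - u)"
  have e': "e' > 0" using e u by (simp add: e'_def)
  have "{u<..<u + e'} \<subseteq> {t. - pi < t \<and> t < pi \<and> \<phi> t \<noteq> 0}"
  proof
    fix y assume y: "y \<in> {u<..<u + e'}"
    then have "dist u y < e" by (auto simp: dist_real_def e'_def min_def split: if_splits)
    then show "y \<in> {t. - pi < t \<and> t < pi \<and> \<phi> t \<noteq> 0}" using y u e(2)[of y]
      by (auto simp: e'_def min_def split: if_splits)
  qed
  moreover have "infinite {u<..<u + e'}" using e' by simp
  ultimately show ?thesis using finite_subset by blast
qed

theorem theorem1:
  fixes q a b \<alpha> :: real and \<phi> :: "real \<Rightarrow> complex"
  assumes "q > 0" and "q \<noteq> 1"
    and "0 < b" and "b \<le> a"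
    and "0 < (eccentricity a b)\<^sup>2"
    and "(eccentricity a b)\<^sup>2 < sqrt q / (1 + sqrt q)"
    and "\<phi> C1_differentiable_on UNIV"
    and "\<And>\<theta>. \<phi> (\<theta> + 2 * pi) = \<phi> \<theta>"
    and "\<exists>\<theta>. \<phi> \<theta> \<noteq> 0"
  shows "finite {k::real. k > 0 \<and> non_scattering (ellipse a b \<alpha>) q k (herglotz k \<phi>)}"
proof (rule ccontr)
  let ?K = "{k::real. k > 0 \<and> non_scattering (ellipse a b \<alpha>) q k (herglotz k \<phi>)}"
  assume inf: "infinite ?K"
  define p where "p = sqrt q"
  have p: "p > 0" "p \<noteq> 1" using assms(1,2) by (simp_all add: p_def)
  have a0: "0 < a" using assms by simp
  have "b\<^sup>2 / a\<^sup>2 \<le> 1" using assms(3,4) a0 by (simp add: power_mono)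
  then have ecc: "(eccentricity a b)\<^sup>2 = 1 - b\<^sup>2 / a\<^sup>2" by (simp add: eccentricity_def)
  have "b \<noteq> a" using assms(5) a0 unfolding ecc by auto
  then have ba: "b < a" using assms(4) by simp
  \<comment> \<open>The eccentricity bound with denominators cleared: multiplication by
    \<open>a^2 * (1 + p)\<close>, then cancellation of \<open>p * a^2 - p * b^2\<close>.\<close>
  have nd: "a\<^sup>2 - b\<^sup>2 < p * b\<^sup>2"
  proof -
    have "1 - b\<^sup>2 / a\<^sup>2 < p / (1 + p)" using assms(6) unfolding ecc p_def .
    then have "(1 - b\<^sup>2 / a\<^sup>2) * a\<^sup>2 * (1 + p) < p / (1 + p) * a\<^sup>2 * (1 + p)"
      using a0 p by (intro mult_strict_right_mono) auto
    then have "(a\<^sup>2 - b\<^sup>2) * (1 + p) < p * a\<^sup>2"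
      using a0 p by (simp add: left_diff_distrib)
    then show ?thesis by (simp add: algebra_simps)
  qed
  interpret ellipse_phase a b p
    using assms(3) ba p by unfold_locales auto
  obtain \<phi>1 where \<phi>: "\<And>t. (\<phi> has_vector_derivative \<phi>1 t) (at t)" and \<phi>1: "continuous_on UNIV \<phi>1"
    using assms(7) unfolding C1_differentiable_on_def by auto
  have c\<phi>: "continuous_on UNIV \<phi>"
    by (rule continuous_on_vector_derivative) (rule has_vector_derivative_at_within[OF \<phi>])
  have "\<exists>k::nat \<Rightarrow> real. (\<forall>n. k n \<ge> 1) \<and> filterlim k at_top sequentially \<and>
    (\<forall>n s. integral {-pi..pi} (\<lambda>t. \<phi> t * of_real (disc_ft (k n * \<Phi> (t - \<alpha>) s))) = 0)"
  proof (rule unbounded_zeros[OF c\<phi> _ inf, where f = "\<lambda>s t. \<Phi> (t - \<alpha>) s"])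
    show "continuous_on UNIV (\<lambda>t. \<Phi> (t - \<alpha>) s)" for s
      by (rule continuous_on_compose2[OF phase_continuous(1)[of UNIV]]) (auto intro!: continuous_intros)
    show "k > 0 \<and> integral {-pi..pi} (\<lambda>t. \<phi> t * of_real (disc_ft (k * \<Phi> (t - \<alpha>) s))) = 0" if "k \<in> ?K" for k s
      using that herglotz_pairing[OF a0 assms(3,1,2) _ c\<phi>] by (simp add: p_def)
  qed
  then obtain k :: "nat \<Rightarrow> real" where k: "\<And>n. k n \<ge> 1" "filterlim k at_top sequentially"
    and zero: "\<And>n s. integral {-pi..pi} (\<lambda>t. \<phi> t * of_real (disc_ft (k n * \<Phi> (t - \<alpha>) s))) = 0" by blast
  obtain F where F: "finite F" and sep: "\<And>s. cos s \<notin> F \<Longrightarrow>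
     (\<forall>t. snell a b p t s \<longrightarrow> sin t * cos s - cos t * sin s \<noteq> 0) \<and>
     (\<forall>t t'. snell a b p t s \<longrightarrow> snell a b p t' s \<longrightarrow> (cos t, sin t) \<noteq> (cos t', sin t') \<longrightarrow>
        (sin t * cos s - cos t * sin s)\<^sup>2 / (b\<^sup>2 * (cos t)\<^sup>2 + a\<^sup>2 * (sin t)\<^sup>2)
        \<noteq> (sin t' * cos s - cos t' * sin s)\<^sup>2 / (b\<^sup>2 * (cos t')\<^sup>2 + a\<^sup>2 * (sin t')\<^sup>2))"
    using snell_separation[OF assms(3) ba p] by blast
  \<comment> \<open>The critical points of the exceptional directions. One period contains finitely
    many such directions, each with finitely many critical points.\<close>
  define X where "X = (\<Union>s\<in>{s \<in> {0..2*pi}. cos s \<in> F}. {t \<in> {-pi..pi}. snell a b p (t - \<alpha>) s})"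
  have "finite X" unfolding X_def using finite_cos_vimage[OF F] finite_snell[OF nd] by blast
  moreover have "{t. - pi < t \<and> t < pi \<and> \<phi> t \<noteq> 0} \<subseteq> X"
  proof
    fix t assume t: "t \<in> {t. - pi < t \<and> t < pi \<and> \<phi> t \<noteq> 0}"
    obtain s where s: "s \<in> {0..2*pi}" "snell a b p (t - \<alpha>) s"
      using snell_exists[OF assms(3) ba p(1) nd] by blast
    have "cos s \<in> F"
    proof (rule ccontr)
      assume nF: "cos s \<notin> F"
      have "\<phi> t = 0"
      proof (rule density_zero_at_critical[OF \<phi> \<phi>1 k zero nd _ _ s(2)])
        show "sin (t - \<alpha>) * cos s - cos (t - \<alpha>) * sin s \<noteq> 0" using sep[OF nF] s(2) by blast
      qed (use t sep[OF nF] s(2) in blast)+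
      then show False using t by simp
    qed
    then show "t \<in> X" using s t by (auto simp: X_def)
  qed
  ultimately have "finite {t. - pi < t \<and> t < pi \<and> \<phi> t \<noteq> 0}" using finite_subset by blast
  moreover obtain \<theta> where "\<phi> \<theta> \<noteq> 0" using assms(9) by blast
  ultimately show False using nonzero_interval[OF assms(8) c\<phi>] by blast
qed

end
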